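(* Let $\lambda=(n-l,1^l)$ be a hook partition of $n$ ($0\le l\le n-1$), and let $q\in\mathbb{C}$ with $|q|=1$, $q$ not a root of unity. For a suitable choice of the nonzero real normalization of the invariant Hermitian form on $S^\lambda=S^\lambda(q^2)$, $$s_z(S^\lambda)=\sum_{2\le j_1<j_2<\cdots<j_l\le n}\ \prod_{i=1}^l a_{j_i-1}\,a_{j_i}\quad\text{in }\mathbb{Z}[z]/(z^2-1).$$
   Context: For $Q\in\mathbb{C}$, $|Q|=1$, $Q$ not a root of unity, $\mathcal{H}_n(Q)$ is the $\mathbb{C}$-algebra with generators $T_1,\dots,T_{n-1}$ and relations $T_iT_j=T_jT_i$ for $|i-j|>1$, $T_iT_{i+1}T_i=T_{i+1}T_iT_{i+1}$, $(T_i+1)(T_i-Q)=0$. $S^\lambda(Q)$ is the irreducible (Specht) module indexed by $\lambda$, with $(n)$ corresponding to $T_i\mapsto Q$; it carries a nondegenerate Hermitian form for which each $T_i$ is unitary, unique up to a nonzero real scalar. The refined signature is $s_z(S^\lambda)=p+mz\in\mathbb{Z}[z]/(z^2-1)$, where $p$ (resp. $m$) is the number of vectors of positive (resp. negative) norm in an orthogonal basis of $S^\lambda(q^2)$. (Setting $z=-1$ gives the signature, $z=1$ the dimension.) For nonzero integers $i$, $[[i]]_q=\frac{q^i-q^{-i}}{q-q^{-1}}\in\mathbb{R}$, and $a_i=a_i(q)\in\mathbb{Z}[z]/(z^2-1)$ equals $1$ if $[[i]]_q>0$ and $z$ if $[[i]]_q<0$. *)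

theory Defs
  imports
    Complex_Main
    "HOL-Library.Function_Algebras"
    "HOL-Combinatorics.Combinatorics"
    "HOL-Computational_Algebra.Polynomial"
begin

section \<open>The ring of integer polynomials in z modulo z^2 - 1\<close>

quotient_type sgn_ring = "int poly" / "\<lambda>p r. [:-1, 0, 1:] dvd (p - r)"
proof (rule equivpI)
  show "reflp (\<lambda>p r :: int poly. [:-1, 0, 1:] dvd (p - r))"
    by (simp add: reflp_def)
  show "symp (\<lambda>p r :: int poly. [:-1, 0, 1:] dvd (p - r))"
    by (rule sympI) (metis dvd_minus_iff minus_diff_eq)
  show "transp (\<lambda>p r :: int poly. [:-1, 0, 1:] dvd (p - r))"
  proof (rule transpI)
    fix p r s :: "int poly"
    assume "[:-1, 0, 1:] dvd (p - r)" "[:-1, 0, 1:] dvd (r - s)"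
    from dvd_add[OF this] show "[:-1, 0, 1:] dvd (p - s)" by simp
  qed
qed

instantiation sgn_ring :: comm_ring_1
begin

lift_definition zero_sgn_ring :: sgn_ring is "0" .
lift_definition one_sgn_ring :: sgn_ring is "1" .
lift_definition plus_sgn_ring :: "sgn_ring \<Rightarrow> sgn_ring \<Rightarrow> sgn_ring" is "(+)"
  by (metis add_diff_add dvd_add)
lift_definition uminus_sgn_ring :: "sgn_ring \<Rightarrow> sgn_ring" is "uminus"
  by (metis minus_diff_minus dvd_minus_iff)
lift_definition minus_sgn_ring :: "sgn_ring \<Rightarrow> sgn_ring \<Rightarrow> sgn_ring" is "(-)"
proof -
  fix a b c d :: "int poly"
  assume "[:-1, 0, 1:] dvd (a - b)" "[:-1, 0, 1:] dvd (c - d)"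
  from dvd_diff[OF this] show "[:-1, 0, 1:] dvd (a - c - (b - d))"
    by (simp add: algebra_simps)
qed
lift_definition times_sgn_ring :: "sgn_ring \<Rightarrow> sgn_ring \<Rightarrow> sgn_ring" is "(*)"
proof -
  fix a b c d :: "int poly"
  assume "[:-1, 0, 1:] dvd (a - b)" "[:-1, 0, 1:] dvd (c - d)"
  hence "[:-1, 0, 1:] dvd ((a - b) * c + b * (c - d))"
    by (intro dvd_add dvd_mult dvd_mult2)
  thus "[:-1, 0, 1:] dvd (a * c - b * d)"
    by (simp add: ring_distribs)
qed

instance
proof
  show "(0::sgn_ring) \<noteq> 1"
  proof (transfer, rule notI)
    assume "[:-1, 0, 1:] dvd (0 - 1 :: int poly)"
    hence "degree [:-1, 0, 1 :: int:] \<le> degree (0 - 1 :: int poly)"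
      by (rule dvd_imp_degree_le) simp
    thus False by simp
  qed
qed (transfer; simp add: algebra_simps)+

end

lift_definition zz :: sgn_ring is "[:0, 1:]" .


section \<open>Modules over the Hecke algebra\<close>

text \<open>
  A function \<^term>\<open>f :: 'w \<Rightarrow> complex\<close> stands for the formal combination of the elements of
  \<^typ>\<open>'w\<close> with coefficients \<^term>\<open>f w\<close>. Addition is pointwise.
\<close>

definition fscale :: "complex \<Rightarrow> ('w \<Rightarrow> complex) \<Rightarrow> 'w \<Rightarrow> complex" where
  "fscale c f = (\<lambda>w. c * f w)"

definition basis_vec :: "'w \<Rightarrow> 'w \<Rightarrow> complex" where
  "basis_vec u = (\<lambda>w. if w = u then 1 else 0)"

global_interpretation fvs: vector_space "fscale :: complex \<Rightarrow> ('w \<Rightarrow> complex) \<Rightarrow> 'w \<Rightarrow> complex"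
  by unfold_locales (auto simp: fscale_def fun_eq_iff algebra_simps)

text \<open>
  A module over the Hecke algebra given by generators and relations is a space \<^term>\<open>V\<close> with
  operators \<^term>\<open>T i\<close>, \<open>1 \<le> i < n\<close>, on \<^term>\<open>V\<close> satisfying the relations. The last relation is
  \<open>(T i + 1) (T i - Q) = 0\<close>.
\<close>

definition hecke_module ::
  "nat \<Rightarrow> complex \<Rightarrow> ('w \<Rightarrow> complex) set \<Rightarrow> (nat \<Rightarrow> ('w \<Rightarrow> complex) \<Rightarrow> 'w \<Rightarrow> complex) \<Rightarrow> bool" where
  "hecke_module n Q V T \<longleftrightarrow>
     fvs.subspace V \<and>
     (\<forall>i\<in>{1..<n}. \<forall>u\<in>V. T i u \<in> V) \<and>
     (\<forall>i\<in>{1..<n}. \<forall>u\<in>V. \<forall>v\<in>V. T i (u + v) = T i u + T i v) \<and>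
     (\<forall>i\<in>{1..<n}. \<forall>c. \<forall>u\<in>V. T i (fscale c u) = fscale c (T i u)) \<and>
     (\<forall>i\<in>{1..<n}. \<forall>j\<in>{1..<n}. \<bar>int i - int j\<bar> > 1 \<longrightarrow> (\<forall>u\<in>V. T i (T j u) = T j (T i u))) \<and>
     (\<forall>i. 1 \<le> i \<and> Suc i < n \<longrightarrow>
        (\<forall>u\<in>V. T i (T (Suc i) (T i u)) = T (Suc i) (T i (T (Suc i) u)))) \<and>
     (\<forall>i\<in>{1..<n}. \<forall>u\<in>V. T i (T i u - fscale Q u) + (T i u - fscale Q u) = 0)"


section \<open>Specht modules\<close>

text \<open>
  This is the construction of Dipper and James. A row standard tableau of shape \<open>\<lambda>\<close>, a partition
  of \<open>n\<close>, is encoded by the word of length \<open>n\<close> whose \<open>k\<close>-th letter is the (0-based) row containing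
  \<open>k\<close>. The span of these words is the permutation module \<open>H x\<^sub>\<lambda>\<close> induced from the representation
  \<open>T i \<mapsto> Q\<close> of the row stabilizer; the action of the generators on it is
  \<open>T i u = Q u\<close> if \<open>i\<close> and \<open>i + 1\<close> are in the same row, and, writing \<open>s u\<close> for \<open>u\<close> with the
  letters \<open>i\<close> and \<open>i + 1\<close> exchanged, \<open>T i u = s u\<close> if \<open>i\<close> is in a higher row than \<open>i + 1\<close>, and
  \<open>T i u = Q (s u) + (Q - 1) u\<close> otherwise (see \<open>hecke_act_basis_vec\<close> below).
  Words are 0-based lists, so the letter of \<open>i\<close> is \<^term>\<open>w ! (i - 1)\<close>.
\<close>

definition swap_letters :: "nat \<Rightarrow> nat list \<Rightarrow> nat list" where
  "swap_letters i w = w[i - 1 := w ! i, i := w ! (i - 1)]"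

definition hecke_act :: "complex \<Rightarrow> nat \<Rightarrow> (nat list \<Rightarrow> complex) \<Rightarrow> nat list \<Rightarrow> complex" where
  "hecke_act Q i f = (\<lambda>w.
     if w ! (i - 1) = w ! i then Q * f w
     else if w ! (i - 1) < w ! i then Q * f (swap_letters i w)
     else f (swap_letters i w) + (Q - 1) * f w)"

definition conj_partition :: "nat list \<Rightarrow> nat list" where
  "conj_partition lam = map (\<lambda>c. length (filter (\<lambda>p. c < p) lam)) [0..<fold max lam 0]"

text \<open>
  Let \<open>t\<close> be the standard tableau in which \<open>1, \<dots>, n\<close> are entered column by column.
  \<open>column_word\<close> lists the rows and \<open>column_index\<close> the columns of \<open>1, \<dots>, n\<close> in \<open>t\<close>.
\<close>

definition column_word :: "nat list \<Rightarrow> nat list" where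
  "column_word lam = concat (map (\<lambda>k. [0..<k]) (conj_partition lam))"

definition column_index :: "nat list \<Rightarrow> nat list" where
  "column_index lam =
     concat (map (\<lambda>c. replicate (conj_partition lam ! c) c) [0..<length (conj_partition lam)])"

definition column_stabilizer :: "nat list \<Rightarrow> (nat \<Rightarrow> nat) set" where
  "column_stabilizer lam =
     {\<sigma>. \<sigma> permutes {..<sum_list lam} \<and>
         (\<forall>k<sum_list lam. column_index lam ! \<sigma> k = column_index lam ! k)}"

definition coxeter_length :: "nat \<Rightarrow> (nat \<Rightarrow> nat) \<Rightarrow> nat" where
  "coxeter_length n \<sigma> = card {(i, j). i < j \<and> j < n \<and> \<sigma> i > \<sigma> j}"

text \<open>
  The generator is the sum of \<open>(-Q)\<^bsup>-\<ell>(\<sigma>)\<^esup> T\<^sub>\<sigma> t\<close> over the column stabilizer of \<open>t\<close>. Since the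
  word of \<open>t\<close> increases along every column, \<open>T\<^sub>\<sigma>\<close> just permutes its letters.
\<close>

definition specht_gen :: "complex \<Rightarrow> nat list \<Rightarrow> nat list \<Rightarrow> complex" where
  "specht_gen Q lam =
     (\<Sum>\<sigma>\<in>column_stabilizer lam.
        fscale (inverse (- Q) ^ coxeter_length (sum_list lam) \<sigma>)
               (basis_vec (permute_list \<sigma> (column_word lam))))"

definition specht :: "complex \<Rightarrow> nat list \<Rightarrow> (nat list \<Rightarrow> complex) set" where
  "specht Q lam =
     (\<lambda>V. fvs.subspace V \<and> (\<forall>i\<in>{1..<sum_list lam}. \<forall>u\<in>V. hecke_act Q i u \<in> V))
       hull {specht_gen Q lam}"


section \<open>Invariant Hermitian forms and the refined signature\<close>

text \<open>Forms are linear in the first argument. Only their values on \<^term>\<open>V\<close> matter.\<close>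

definition hermitian_form ::
  "('w \<Rightarrow> complex) set \<Rightarrow> (('w \<Rightarrow> complex) \<Rightarrow> ('w \<Rightarrow> complex) \<Rightarrow> complex) \<Rightarrow> bool" where
  "hermitian_form V B \<longleftrightarrow>
     (\<forall>u\<in>V. \<forall>v\<in>V. \<forall>w\<in>V. B (u + v) w = B u w + B v w) \<and>
     (\<forall>c. \<forall>u\<in>V. \<forall>w\<in>V. B (fscale c u) w = c * B u w) \<and>
     (\<forall>u\<in>V. \<forall>v\<in>V. B v u = cnj (B u v))"

definition nondegenerate_form ::
  "('w \<Rightarrow> complex) set \<Rightarrow> (('w \<Rightarrow> complex) \<Rightarrow> ('w \<Rightarrow> complex) \<Rightarrow> complex) \<Rightarrow> bool" where
  "nondegenerate_form V B \<longleftrightarrow> (\<forall>u\<in>V. (\<forall>v\<in>V. B u v = 0) \<longrightarrow> u = 0)"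

definition invariant_form ::
  "nat \<Rightarrow> ('w \<Rightarrow> complex) set \<Rightarrow> (nat \<Rightarrow> ('w \<Rightarrow> complex) \<Rightarrow> 'w \<Rightarrow> complex) \<Rightarrow>
   (('w \<Rightarrow> complex) \<Rightarrow> ('w \<Rightarrow> complex) \<Rightarrow> complex) \<Rightarrow> bool" where
  "invariant_form n V T B \<longleftrightarrow>
     hermitian_form V B \<and> nondegenerate_form V B \<and>
     (\<forall>i\<in>{1..<n}. \<forall>u\<in>V. \<forall>v\<in>V. B (T i u) (T i v) = B u v)"

definition orthogonal_basis ::
  "('w \<Rightarrow> complex) set \<Rightarrow> (('w \<Rightarrow> complex) \<Rightarrow> ('w \<Rightarrow> complex) \<Rightarrow> complex) \<Rightarrow>
   ('w \<Rightarrow> complex) set \<Rightarrow> bool" where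
  "orthogonal_basis V B X \<longleftrightarrow>
     finite X \<and> fvs.independent X \<and> fvs.span X = V \<and> pairwise (\<lambda>x y. B x y = 0) X"

text \<open>
  By Sylvester's law of inertia the value does not depend on the orthogonal basis. The norms
  \<^term>\<open>B x x\<close> are real since \<^term>\<open>B\<close> is Hermitian.
\<close>

definition refined_signature ::
  "('w \<Rightarrow> complex) set \<Rightarrow> (('w \<Rightarrow> complex) \<Rightarrow> ('w \<Rightarrow> complex) \<Rightarrow> complex) \<Rightarrow> sgn_ring" where
  "refined_signature V B =
     (THE s. \<exists>X. orthogonal_basis V B X \<and>
        s = of_nat (card {x \<in> X. Re (B x x) > 0}) + of_nat (card {x \<in> X. Re (B x x) < 0}) * zz)"


section \<open>Signs of quantum integers\<close>

definition qint :: "complex \<Rightarrow> int \<Rightarrow> complex" where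
  "qint q i = (q powi i - q powi (- i)) / (q - inverse q)"

text \<open>
  For \<^term>\<open>norm q = 1\<close> the value \<^term>\<open>qint q i\<close> is real, and it is nonzero if \<^term>\<open>i \<noteq> 0\<close> and
  \<^term>\<open>q\<close> is not a root of unity.
\<close>

definition qsign :: "complex \<Rightarrow> int \<Rightarrow> sgn_ring" where
  "qsign q i = (if Re (qint q i) > 0 then 1 else zz)"


section \<open>Consistency of the definitions\<close>

lemma length_swap_letters [simp]: "length (swap_letters i w) = length w"
  by (simp add: swap_letters_def)

lemma nth_swap_letters:
  assumes "1 \<le> i" "i < length w" "k < length w"
  shows "swap_letters i w ! k = (if k = i then w ! (i - 1) else if k = i - 1 then w ! i else w ! k)"
  using assms by (auto simp: swap_letters_def nth_list_update)

lemma swap_letters_invol: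
  assumes "1 \<le> i" "i < length w"
  shows "swap_letters i (swap_letters i w) = w"
  using assms by (intro nth_equalityI) (auto simp: nth_swap_letters)

lemma swap_letters_eq:
  assumes "1 \<le> i" "i < length w" "w ! (i - 1) = w ! i"
  shows "swap_letters i w = w"
  using assms by (intro nth_equalityI) (auto simp: nth_swap_letters)

lemma hecke_act_basis_vec:
  assumes "1 \<le> i" "i < length u" "length w = length u"
  shows "hecke_act Q i (basis_vec u) w =
    (if u ! (i - 1) = u ! i then fscale Q (basis_vec u)
     else if u ! (i - 1) < u ! i then basis_vec (swap_letters i u)
     else fscale Q (basis_vec (swap_letters i u)) + fscale (Q - 1) (basis_vec u)) w"
proof -
  have 1: "swap_letters i w = u \<longleftrightarrow> w = swap_letters i u"
    using assms swap_letters_invol by metis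
  have 2: "w = swap_letters i u \<Longrightarrow> w ! i = u ! (i - 1) \<and> w ! (i - 1) = u ! i"
    using assms by (auto simp: nth_swap_letters)
  have 3: "swap_letters i u = u \<Longrightarrow> u ! (i - 1) = u ! i"
    using assms by (metis nth_swap_letters)
  have 4: "u ! (i - 1) = u ! i \<Longrightarrow> swap_letters i u = u"
    using assms swap_letters_eq by blast
  show ?thesis
    using 1 2 3 4 by (auto simp: hecke_act_def basis_vec_def fscale_def)
qed

lemma hecke_act_quadratic:
  assumes "1 \<le> i" "i < length w"
  shows "(hecke_act Q i (hecke_act Q i f - fscale Q f) + (hecke_act Q i f - fscale Q f)) w = 0"
proof -
  have "swap_letters i w ! i = w ! (i - 1)" "swap_letters i w ! (i - 1) = w ! i"
    using assms by (auto simp: nth_swap_letters)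
  thus ?thesis
    using assms swap_letters_invol[of i w]
    by (auto simp: hecke_act_def fscale_def algebra_simps)
qed

lemma hecke_act_commute:
  assumes "1 \<le> i" "i < length w" "1 \<le> j" "j < length w" "\<bar>int i - int j\<bar> > 1"
  shows "hecke_act Q i (hecke_act Q j f) w = hecke_act Q j (hecke_act Q i f) w"
proof -
  have ne: "i \<noteq> j" "i \<noteq> j - 1" "i - 1 \<noteq> j" "i - 1 \<noteq> j - 1"
    using assms by auto
  have "swap_letters i (swap_letters j w) = swap_letters j (swap_letters i w)"
    using assms ne by (intro nth_equalityI) (auto simp: nth_swap_letters)
  moreover have "swap_letters i w ! j = w ! j" "swap_letters i w ! (j - 1) = w ! (j - 1)"
    "swap_letters j w ! i = w ! i" "swap_letters j w ! (i - 1) = w ! (i - 1)"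
    using assms ne by (auto simp: nth_swap_letters)
  ultimately show ?thesis
    by (auto simp: hecke_act_def algebra_simps)
qed

lemma hecke_act_braid:
  assumes "1 \<le> i" "Suc i < length w"
  shows "hecke_act Q i (hecke_act Q (Suc i) (hecke_act Q i f)) w =
         hecke_act Q (Suc i) (hecke_act Q i (hecke_act Q (Suc i) f)) w"
proof -
  define W where "W x y z = w[i - 1 := x, i := y, Suc i := z]" for x y z
  obtain k where k: "i = Suc k"
    using assms by (cases i) auto
  have nth: "W x y z ! (i - 1) = x" "W x y z ! i = y" "W x y z ! Suc i = z" for x y z
    using assms k by (auto simp: W_def nth_list_update)
  have sw: "swap_letters i (W x y z) = W y x z" "swap_letters (Suc i) (W x y z) = W x z y" for x y z
    using assms k by (auto intro!: nth_equalityI simp: nth_swap_letters W_def nth_list_update)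
  have w: "w = W (w ! (i - 1)) (w ! i) (w ! Suc i)"
    using assms by (auto simp: W_def)
  have act: "hecke_act Q i g (W x y z) = (if x = y then Q * g (W x y z)
      else if x < y then Q * g (W y x z) else g (W y x z) + (Q - 1) * g (W x y z))"
    "hecke_act Q (Suc i) g (W x y z) = (if y = z then Q * g (W x y z)
      else if y < z then Q * g (W x z y) else g (W x z y) + (Q - 1) * g (W x y z))" for g x y z
    using nth sw by (auto simp: hecke_act_def)
  have "hecke_act Q i (hecke_act Q (Suc i) (hecke_act Q i f)) (W x y z) =
        hecke_act Q (Suc i) (hecke_act Q i (hecke_act Q (Suc i) f)) (W x y z)" for x y z
    by (cases x y rule: linorder_cases; cases y z rule: linorder_cases;
        cases x z rule: linorder_cases) (simp_all add: act algebra_simps)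
  thus ?thesis
    by (subst (1 2) w)
qed

lemma specht_gen_in_specht: "specht_gen Q lam \<in> specht Q lam"
  unfolding specht_def by (meson hull_inc insertI1)

lemma specht_minimal:
  assumes "fvs.subspace V" "\<And>i u. i \<in> {1..<sum_list lam} \<Longrightarrow> u \<in> V \<Longrightarrow> hecke_act Q i u \<in> V"
    and "specht_gen Q lam \<in> V"
  shows "specht Q lam \<subseteq> V"
  unfolding specht_def using assms by (intro hull_minimal) auto

lemma subspace_specht: "fvs.subspace (specht Q lam)"
  unfolding specht_def hull_def fvs.subspace_def by blast

lemma hecke_act_in_specht:
  "i \<in> {1..<sum_list lam} \<Longrightarrow> u \<in> specht Q lam \<Longrightarrow> hecke_act Q i u \<in> specht Q lam"
  unfolding specht_def hull_def by blast

lemma length_column_word_hook: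
  assumes "l < n"
  shows "length (column_word ((n - l) # replicate l 1)) = n"
proof -
  have "fold max (replicate l (1::nat)) m = m" if "1 \<le> m" for m
    using that by (induction l) (auto simp: max_def)
  hence m: "fold max ((n - l) # replicate l 1) 0 = n - l"
    using assms by simp
  have "conj_partition ((n - l) # replicate l 1) = Suc l # replicate (n - l - 1) 1"
    unfolding conj_partition_def m using assms
    by (intro nth_equalityI) (auto simp: nth_Cons filter_replicate split: nat.split)
  thus ?thesis
    using assms by (simp add: column_word_def length_concat comp_def sum_list_replicate)
qed

lemma specht_supp:
  assumes "length (column_word lam) = sum_list lam" "f \<in> specht Q lam" "length w \<noteq> sum_list lam"
  shows "f w = 0"
proof -
  have "specht Q lam \<subseteq> {f. \<forall>w. length w \<noteq> sum_list lam \<longrightarrow> f w = 0}"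
  proof (rule specht_minimal)
    show "fvs.subspace {f. \<forall>w. length w \<noteq> sum_list lam \<longrightarrow> f w = 0}"
      by (auto simp: fvs.subspace_def fscale_def)
    have *: "(\<Sum>\<sigma>\<in>A. g \<sigma>) w = (\<Sum>\<sigma>\<in>A. g \<sigma> w)"
      for A :: "(nat \<Rightarrow> nat) set" and g :: "_ \<Rightarrow> nat list \<Rightarrow> complex" and w
      by (induction A rule: infinite_finite_induct) auto
    show "specht_gen Q lam \<in> {f. \<forall>w. length w \<noteq> sum_list lam \<longrightarrow> f w = 0}"
      using assms(1) by (auto simp: specht_gen_def * fscale_def basis_vec_def intro!: sum.neutral)
  qed (auto simp: hecke_act_def)
  thus ?thesis
    using assms by blast
qed

lemma hecke_module_specht_hook:
  assumes "l < n"
  shows "hecke_module n Q (specht Q ((n - l) # replicate l 1)) (hecke_act Q)"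
proof -
  define lam where "lam = (n - l) # replicate l (1::nat)"
  have n: "sum_list lam = n" "length (column_word lam) = sum_list lam"
    using assms length_column_word_hook[OF assms]
    by (auto simp: lam_def sum_list_replicate simp del: replicate_Suc)
  have supp: "f w = 0" if "f \<in> specht Q lam" "length w \<noteq> n" for f w
    using specht_supp n that by metis
  have act: "hecke_act Q i f \<in> specht Q lam" if "i \<in> {1..<n}" "f \<in> specht Q lam" for i f
    using hecke_act_in_specht n that by metis
  note sub = subspace_specht[of Q lam]
  have eq: "f = g" if "f \<in> specht Q lam" "g \<in> specht Q lam" "\<And>w. length w = n \<Longrightarrow> f w = g w" for f g
    using that supp by (metis ext)
  show ?thesis
    unfolding hecke_module_def lam_def[symmetric]
  proof (intro conjI ballI allI impI)
    fix i u v assume "i \<in> {1..<n}" "u \<in> specht Q lam" "v \<in> specht Q lam"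
    show "hecke_act Q i (u + v) = hecke_act Q i u + hecke_act Q i v"
      by (auto simp: hecke_act_def fun_eq_iff algebra_simps)
  next
    fix i u c
    show "hecke_act Q i (fscale c u) = fscale c (hecke_act Q i u)"
      by (auto simp: hecke_act_def fscale_def fun_eq_iff algebra_simps)
  next
    fix i j u
    assume "i \<in> {1..<n}" "j \<in> {1..<n}" "1 < \<bar>int i - int j\<bar>" "u \<in> specht Q lam"
    thus "hecke_act Q i (hecke_act Q j u) = hecke_act Q j (hecke_act Q i u)"
      by (intro eq act hecke_act_commute) auto
  next
    fix i u
    assume "1 \<le> i \<and> Suc i < n" "u \<in> specht Q lam"
    thus "hecke_act Q i (hecke_act Q (Suc i) (hecke_act Q i u)) =
          hecke_act Q (Suc i) (hecke_act Q i (hecke_act Q (Suc i) u))"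
      by (intro eq act hecke_act_braid) auto
  next
    fix i u
    assume *: "i \<in> {1..<n}" "u \<in> specht Q lam"
    show "hecke_act Q i (hecke_act Q i u - fscale Q u) + (hecke_act Q i u - fscale Q u) = 0"
    proof (rule eq)
      show "hecke_act Q i (hecke_act Q i u - fscale Q u) + (hecke_act Q i u - fscale Q u)
              \<in> specht Q lam"
        using * by (intro fvs.subspace_add fvs.subspace_diff fvs.subspace_scale sub act)
      show "0 \<in> specht Q lam"
        using sub by (rule fvs.subspace_0)
    next
      fix w :: "nat list" assume "length w = n"
      thus "(hecke_act Q i (hecke_act Q i u - fscale Q u) + (hecke_act Q i u - fscale Q u)) w = 0 w"
        using * hecke_act_quadratic[of i w Q u] by simp
    qed
  qed (use sub act in auto)
qed

end

theory Submission
  imports Defs "Jordan_Normal_Form.Determinant"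
begin

text \<open>
  Write \<open>Q = q\<^sup>2\<close>, and number positions from \<open>0\<close>. A word \<open>w\<close> of hook shape contains each of the
  letters \<open>1, \<dots>, l\<close> once, all its other letters being \<open>0\<close>.

  The hook module \<open>S\<^bsup>(n-l,1^l)\<^esup>\<close> is the \<open>l\<close>-th exterior power of the reflection module
  \<open>S\<^bsup>(n-1,1)\<^esup>\<close>, with \<open>T\<^sub>i\<close> acting as \<open>Q\<close> times the exterior power of \<open>T\<^sub>i / Q\<close>. Inside the
  permutation module on words, the product \<open>x\<^sub>0 \<and> \<dots> \<and> x\<^bsub>l-1\<^esub>\<close> of vectors of \<open>\<complex>\<^sup>n\<close> is the function
  \<open>wedge\<close>: its value at a word is the minor of the matrix of the \<open>x\<^sub>a\<close> in the columns occupied by the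
  letters \<open>1, \<dots>, l\<close>, divided by a power of \<open>Q\<close> that counts inversions (\<open>hecke_act_wedge\<close>).

  The reflection module has a basis \<open>u\<^sub>1, \<dots>, u\<^bsub>n-1\<^esub>\<close> (\<open>refl_vec\<close>) adapted to the chain of parabolic
  subalgebras: \<open>T\<^sub>i\<close> preserves the plane of \<open>u\<^bsub>i-1\<^esub>\<close> and \<open>u\<^sub>i\<close> and multiplies the other \<open>u\<^sub>j\<close> by
  \<open>Q\<close>. The exterior products \<open>v\<^sub>J\<close> of the \<open>u\<^sub>j\<close> with \<open>j \<in> J\<close>, for \<open>J \<subseteq> {1..n-1}\<close> and \<open>|J| = l\<close>
  (\<open>leg_vec\<close>), then behave as in Young's seminormal form: \<open>T\<^sub>i v\<^sub>J\<close> is a combination of \<open>v\<^sub>J\<close> and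
  \<open>v\<^bsub>s J\<^esub>\<close>, where \<open>s\<close> exchanges \<open>i - 1\<close> and \<open>i\<close> (\<open>hecke_act_leg_vec\<close>). They are linearly
  independent by a triangularity argument. All of them are generated by \<open>v\<^bsub>{1..l}\<^esub>\<close>, which is a
  nonzero multiple of the generator of the Specht module, so they form a basis of that module
  (\<open>specht_hook_eq_span\<close>).

  If all \<open>v\<^sub>J\<close> are declared orthogonal, \<open>v\<^sub>J\<close> having norm \<open>\<Prod>\<^bsub>j \<in> J\<^esub> [[j]] [[j+1]]\<close>, then every \<open>T\<^sub>i\<close>
  is unitary; this rests on \<open>[[i-1]] [[i+1]] = [[i]]\<^sup>2 - 1\<close>, and it gives the existence of the form
  (\<open>invariant_seminormal_form\<close>). Conversely, in any invariant form the \<open>v\<^sub>J\<close> are orthogonal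
  (\<open>orthogonal\<close>) and their norms are a common real multiple of these products
  (\<open>norm_proportional\<close>). After rescaling, \<open>v\<^sub>J\<close> contributes \<open>\<Prod>\<^bsub>j \<in> J\<^esub> a\<^sub>j a\<^bsub>j+1\<^esub>\<close> to the refined
  signature, which is well defined by Sylvester's law (\<open>refined_signature_eq\<close>). Shifting the
  elements of \<open>J\<close> by one gives the formula.
\<close>

section \<open>Determinants of square families\<close>

text \<open>
  The determinant of the \<open>l \<times> l\<close> matrix with entries \<open>F a b\<close>. With matrices given as functions,
  \<open>F(k := f)\<close> has the row \<open>k\<close> replaced by \<open>f\<close>.
\<close>
definition fdet :: "nat \<Rightarrow> (nat \<Rightarrow> nat \<Rightarrow> 'a::comm_ring_1) \<Rightarrow> 'a" where
  "fdet l F = det (mat l l (\<lambda>(a, b). F a b))"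

lemma fdet_leibniz:
  "fdet l F = (\<Sum>p | p permutes {0..<l}. signof p * (\<Prod>a = 0..<l. F a (p a)))"
proof -
  have "p a < l" if "p permutes {0..<l}" "a < l" for p a
    using permutes_in_image[OF that(1)] that(2) by simp
  thus ?thesis
    unfolding fdet_def det_def by (auto intro!: sum.cong prod.cong)
qed

lemma fdet_cong:
  assumes "\<And>a b. a < l \<Longrightarrow> b < l \<Longrightarrow> F a b = G a b"
  shows "fdet l F = fdet l G"
  unfolding fdet_def by (intro arg_cong[of _ _ det] eq_matI) (auto simp: assms)

lemma fdet_transpose: "fdet l (\<lambda>a b. F b a) = fdet l F"
proof -
  have "mat l l (\<lambda>(a, b). F b a) = transpose_mat (mat l l (\<lambda>(a, b). F a b))"
    by (intro eq_matI) auto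
  thus ?thesis
    unfolding fdet_def using det_transpose[of "mat l l (\<lambda>(a, b). F a b)" l] by simp
qed

lemma fdet_row_linear:
  assumes "k < l"
  shows "fdet l (F(k := \<lambda>b. c * f b + d * g b)) = c * fdet l (F(k := f)) + d * fdet l (F(k := g))"
proof -
  have *: "(\<Prod>a = 0..<l. (F(k := f)) a (p a)) = f (p k) * (\<Prod>a \<in> {0..<l} - {k}. F a (p a))" for f p
    using assms by (subst prod.remove[of _ k]) (auto intro!: prod.cong)
  show ?thesis
    unfolding fdet_leibniz * by (simp add: sum_distrib_left sum.distrib algebra_simps)
qed

lemma fdet_identical_rows:
  assumes "i < l" "j < l" "i \<noteq> j" "\<And>b. b < l \<Longrightarrow> F i b = F j b"
  shows "fdet l F = 0"
  unfolding fdet_def using assms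
  by (intro det_identical_rows[of _ l i j]) (auto intro!: eq_vecI)

lemma fdet_two_rows:
  assumes "i < l" "j < l" "i \<noteq> j"
  shows "fdet l (F(i := \<lambda>b. \<alpha> * f b + \<beta> * g b, j := \<lambda>b. \<gamma> * f b + \<delta> * g b)) =
         (\<alpha> * \<delta> - \<beta> * \<gamma>) * fdet l (F(i := f, j := g))"
proof -
  define D where "D x y = fdet l (F(i := x, j := y))" for x y
  have lin: "D (\<lambda>b. c * x b + d * x' b) y = c * D x y + d * D x' y"
    "D y (\<lambda>b. c * x b + d * x' b) = c * D y x + d * D y x'" for c d x x' y
    using assms fdet_row_linear[of i l "F(j := y)"] fdet_row_linear[of j l "F(i := y)"]
    by (simp_all add: D_def fun_upd_twist)
  have alt: "D x x = 0" for x
    unfolding D_def using assms by (intro fdet_identical_rows[of i l j]) auto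
  have "D (\<lambda>b. 1 * f b + 1 * g b) (\<lambda>b. 1 * f b + 1 * g b) = D f g + D g f"
    unfolding lin by (simp add: alt)
  hence "D g f = - D f g"
    by (simp add: alt add_eq_0_iff)
  thus ?thesis
    unfolding D_def[symmetric] lin by (simp add: alt algebra_simps)
qed

section \<open>Inversions\<close>

text \<open>
  The number of positions \<open>i < j < n\<close> at which the values of \<open>f\<close> are related by \<open>R\<close>. With \<open>(>)\<close> for
  \<open>R\<close> these are the inversions of \<open>f\<close>; other relations count inversions among selected values only.
\<close>
definition ninv :: "('a \<Rightarrow> 'a \<Rightarrow> bool) \<Rightarrow> nat \<Rightarrow> (nat \<Rightarrow> 'a) \<Rightarrow> nat" where
  "ninv R n f = card {(i, j). i < j \<and> j < n \<and> R (f i) (f j)}"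

lemma ninv_cong:
  assumes "\<And>i. i < n \<Longrightarrow> f i = g i"
  shows "ninv R n f = ninv R n g"
  unfolding ninv_def using assms by (intro arg_cong[of _ _ card]) auto

lemma ninv_adjacent:
  assumes "1 \<le> i" "i < n"
  shows "ninv R n (f \<circ> transpose (i - 1) i) + (if R (f (i - 1)) (f i) then 1 else 0) =
         ninv R n f + (if R (f i) (f (i - 1)) then 1 else 0)"
proof -
  \<comment> \<open>Pairs other than \<open>(i - 1, i)\<close> keep their order under the transposition, which permutes them.\<close>
  define s where "s = transpose (i - 1) i"
  define A where "A g = {(a, b). a < b \<and> b < n \<and> R (g a) (g b) \<and> (a, b) \<noteq> (i - 1, i)}" for g
  have s: "s x < n \<longleftrightarrow> x < n" "s (s x) = x" for x
    using assms by (auto simp: s_def transpose_def)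
  have lt: "s a < s b \<or> a = i - 1 \<and> b = i" if "a < b" for a b
    using that assms by (auto simp: s_def transpose_def)
  have fin: "finite (A g)" for g
    by (rule finite_subset[of _ "{..<n} \<times> {..<n}"]) (auto simp: A_def)
  have bij: "bij_betw (map_prod s s) (A (f \<circ> s)) (A f)"
  proof (rule bij_betwI[of _ _ _ "map_prod s s"])
    have ne: "\<not> (s a = i - 1 \<and> s b = i)" if "a < b" for a b
      using that assms by (auto simp: s_def transpose_def split: if_splits)
    show "map_prod s s \<in> A (f \<circ> s) \<rightarrow> A f" "map_prod s s \<in> A f \<rightarrow> A (f \<circ> s)"
      using lt ne by (fastforce simp: A_def s)+
  qed (auto simp: s)
  have split: "ninv R n g = card (A g) + (if R (g (i - 1)) (g i) then 1 else 0)" for g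
  proof -
    have "{(a, b). a < b \<and> b < n \<and> R (g a) (g b)} =
          (if R (g (i - 1)) (g i) then insert (i - 1, i) (A g) else A g)"
      using assms by (auto simp: A_def)
    moreover have "(i - 1, i) \<notin> A g"
      by (simp add: A_def)
    ultimately show ?thesis
      unfolding ninv_def using fin[of g] by simp
  qed
  show ?thesis
    using bij_betw_same_card[OF bij] unfolding s_def[symmetric] split
    by (simp add: s_def)
qed

section \<open>Exterior products in the permutation module\<close>

text \<open>The words of row standard tableaux of shape \<open>(n - l, 1\<^sup>l)\<close>: each letter \<open>1, \<dots>, l\<close> occurs once.\<close>
definition hook_word :: "nat \<Rightarrow> nat \<Rightarrow> nat list \<Rightarrow> bool" where
  "hook_word n l w \<longleftrightarrow> length w = n \<and> (\<forall>k<n. w ! k \<le> l) \<and> (\<forall>b<l. \<exists>!k. k < n \<and> w ! k = Suc b)"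

text \<open>The position of the letter \<open>b + 1\<close>; the shift makes the indices of minors start at \<open>0\<close>.\<close>
definition letter_pos :: "nat list \<Rightarrow> nat \<Rightarrow> nat" where
  "letter_pos w b = (THE k. k < length w \<and> w ! k = Suc b)"

lemma letter_pos_eqI:
  assumes "hook_word n l w" "b < l" "k < n" "w ! k = Suc b"
  shows "letter_pos w b = k"
  unfolding letter_pos_def
proof (rule the_equality)
  show "k < length w \<and> w ! k = Suc b"
    using assms by (simp add: hook_word_def)
  show "k' = k" if "k' < length w \<and> w ! k' = Suc b" for k'
    using assms that unfolding hook_word_def by blast
qed

lemma
  assumes "hook_word n l w" "b < l"
  shows letter_pos_less: "letter_pos w b < n" and nth_letter_pos: "w ! letter_pos w b = Suc b"
proof -
  obtain k where k: "k < n" "w ! k = Suc b"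
    using assms unfolding hook_word_def by blast
  thus "letter_pos w b < n" "w ! letter_pos w b = Suc b"
    using letter_pos_eqI[OF assms k] by simp_all
qed

lemma nth_swap_letters_transpose:
  assumes "1 \<le> i" "i < length w" "k < length w"
  shows "swap_letters i w ! k = w ! transpose (i - 1) i k"
  using assms by (auto simp: nth_swap_letters transpose_def)

lemma hook_word_swap_letters:
  assumes "1 \<le> i" "i < n"
  shows "hook_word n l (swap_letters i w) \<longleftrightarrow> hook_word n l w"
proof -
  have *: "hook_word n l (swap_letters i w)" if w: "hook_word n l w" for w
  proof -
    define s where "s = transpose (i - 1) i"
    have s: "s k < n \<longleftrightarrow> k < n" "s (s k) = k" for k
      using assms by (auto simp: s_def transpose_def)
    have nth: "swap_letters i w ! k = w ! s k" if "k < n" for k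
      using nth_swap_letters_transpose assms that w by (simp add: hook_word_def s_def)
    have "\<exists>!k. k < n \<and> swap_letters i w ! k = Suc b" if b: "b < l" for b
    proof (rule ex1I[of _ "s (letter_pos w b)"])
      show "s (letter_pos w b) < n \<and> swap_letters i w ! s (letter_pos w b) = Suc b"
        using s letter_pos_less[OF w b] nth_letter_pos[OF w b] by (simp add: nth)
      show "k = s (letter_pos w b)" if "k < n \<and> swap_letters i w ! k = Suc b" for k
      proof -
        have "letter_pos w b = s k"
          using that s by (intro letter_pos_eqI[OF w b]) (auto simp: nth)
        thus ?thesis
          using s by simp
      qed
    qed
    thus ?thesis
      using w s nth by (auto simp: hook_word_def)
  qed
  show ?thesis
  proof (cases "length w = n")
    case True
    thus ?thesis
      using *[of w] *[of "swap_letters i w"] swap_letters_invol[of i w] assms by auto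
  qed (simp add: hook_word_def)
qed

lemma letter_pos_swap_letters:
  assumes "1 \<le> i" "i < n" "hook_word n l w" "b < l"
  shows "letter_pos (swap_letters i w) b = transpose (i - 1) i (letter_pos w b)"
proof (rule letter_pos_eqI)
  have "length w = n"
    using assms by (simp add: hook_word_def)
  moreover have "transpose (i - 1) i (letter_pos w b) < n"
    using assms letter_pos_less[OF assms(3,4)] by (auto simp: transpose_def)
  ultimately show "transpose (i - 1) i (letter_pos w b) < n"
    "swap_letters i w ! transpose (i - 1) i (letter_pos w b) = Suc b"
    using assms nth_letter_pos[OF assms(3,4)] by (simp_all add: nth_swap_letters_transpose)
qed (use assms hook_word_swap_letters in auto)

text \<open>
  The exterior product \<open>x\<^sub>0 \<and> \<dots> \<and> x\<^bsub>l-1\<^esub>\<close> of vectors \<open>x\<^sub>a\<close> of \<open>\<complex>\<^sup>n\<close>, with coordinates \<open>x\<^sub>a(k)\<close>,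
  as an element of the permutation module. The exponent counts the inversions among the nonzero
  letters of \<open>w\<close>, and the sign of these inversions is provided by the determinant.
\<close>
definition wedge :: "nat \<Rightarrow> nat \<Rightarrow> complex \<Rightarrow> (nat \<Rightarrow> nat \<Rightarrow> complex) \<Rightarrow> nat list \<Rightarrow> complex" where
  "wedge n l Q x w =
     (if hook_word n l w
      then inverse Q ^ ninv (\<lambda>a b. 0 < b \<and> b < a) n (nth w) * fdet l (\<lambda>b a. x a (letter_pos w b))
      else 0)"

text \<open>
  The action of \<open>T\<^sub>i / Q\<close> on \<open>\<complex>\<^sup>n\<close>, that is, on words with a single nonzero letter, which are
  identified with the position of that letter (the Burau representation).
\<close>
definition burau_act :: "complex \<Rightarrow> nat \<Rightarrow> (nat \<Rightarrow> complex) \<Rightarrow> nat \<Rightarrow> complex" where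
  "burau_act Q i x = (\<lambda>k. if k = i - 1 then (1 - 1 / Q) * x (i - 1) + 1 / Q * x i
                     else if k = i then x (i - 1) else x k)"

text \<open>
  \<open>T\<^sub>i\<close> acts on exterior products as \<open>Q\<close> times the exterior power of \<open>T\<^sub>i / Q\<close>. For a word with two
  nonzero letters at the positions \<open>i - 1\<close> and \<open>i\<close> this holds because \<open>T\<^sub>i / Q\<close> has determinant
  \<open>-1/Q\<close> on the two coordinates involved.
\<close>
lemma hecke_act_wedge:
  assumes "Q \<noteq> 0" "1 \<le> i" "i < n"
  shows "hecke_act Q i (wedge n l Q x) = fscale Q (wedge n l Q (\<lambda>a. burau_act Q i (x a)))"
proof
  fix w
  show "hecke_act Q i (wedge n l Q x) w = fscale Q (wedge n l Q (\<lambda>a. burau_act Q i (x a))) w"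
  proof (cases "hook_word n l w")
    case False
    thus ?thesis
      using assms by (simp add: hecke_act_def wedge_def fscale_def hook_word_swap_letters)
  next
    case w: True
    \<comment> \<open>\<open>G k\<close> and \<open>G' k\<close> are the \<open>k\<close>-th columns before and after the action; \<open>E\<close>, \<open>E1\<close>, \<open>E2\<close> are
      the minors at \<open>w\<close>, at the swapped word, and at \<open>w\<close> after the action.\<close>
    define s where "s = transpose (i - 1) i"
    define R where "R = (\<lambda>a b :: nat. 0 < b \<and> b < a)"
    define N where "N w = inverse Q ^ ninv R n (nth w)" for w
    define G where "G k = (\<lambda>a. x a k)" for k
    define G' where "G' k = (\<lambda>a. burau_act Q i (x a) k)" for k
    define F where "F b = G (letter_pos w b)" for b
    define E E1 E2 where "E = fdet l F" and "E1 = fdet l (\<lambda>b. G (s (letter_pos w b)))"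
      and "E2 = fdet l (\<lambda>b. G' (letter_pos w b))"
    have len: "length w = n" and ii: "i - 1 < n" "i - 1 \<noteq> i"
      using w assms by (auto simp: hook_word_def)
    have G': "G' (i - 1) = (\<lambda>a. (1 - 1 / Q) * G (i - 1) a + 1 / Q * G i a)"
      "G' i = (\<lambda>a. 1 * G (i - 1) a + 0 * G i a)" "k \<noteq> i - 1 \<Longrightarrow> k \<noteq> i \<Longrightarrow> G' k = G k" for k
      using ii by (auto simp: G'_def G_def burau_act_def)
    have val: "wedge n l Q x w = N w * E"
      "wedge n l Q x (swap_letters i w) = N (swap_letters i w) * E1"
      "wedge n l Q (\<lambda>a. burau_act Q i (x a)) w = N w * E2"
      using w assms
      by (auto simp: wedge_def N_def R_def E_def E1_def E2_def F_def G_def G'_def s_def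
          hook_word_swap_letters letter_pos_swap_letters intro!: fdet_cong)
    have "ninv R n (nth (swap_letters i w)) = ninv R n (nth w \<circ> s)"
      using nth_swap_letters_transpose assms len by (intro ninv_cong) (simp add: s_def)
    hence inv: "ninv R n (nth (swap_letters i w)) + (if R (w ! (i - 1)) (w ! i) then 1 else 0) =
      ninv R n (nth w) + (if R (w ! i) (w ! (i - 1)) then 1 else 0)"
      using ninv_adjacent[of i n R "nth w"] assms unfolding s_def by simp
    have posD: "w ! k = Suc b" if "letter_pos w b = k" "b < l" for b k
      using that nth_letter_pos[OF w] by blast
    have letter: "\<exists>c<l. w ! k = Suc c \<and> letter_pos w c = k" if k: "k < n" "w ! k \<noteq> 0" for k
    proof -
      obtain c where "w ! k = Suc c"
        using k(2) not0_implies_Suc by blast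
      moreover have "c < l"
        using calculation w k(1) by (metis hook_word_def Suc_le_eq)
      ultimately show ?thesis
        using letter_pos_eqI[OF w _ k(1)] by auto
    qed
    have act: "hecke_act Q i (wedge n l Q x) w =
      (if w ! (i - 1) = w ! i then Q * (N w * E)
       else if w ! (i - 1) < w ! i then Q * (N (swap_letters i w) * E1)
       else N (swap_letters i w) * E1 + (Q - 1) * (N w * E))"
      by (simp add: hecke_act_def val)
    consider "w ! (i - 1) = 0" "w ! i = 0" | "w ! (i - 1) = 0" "w ! i \<noteq> 0"
      | "w ! (i - 1) \<noteq> 0" "w ! i = 0" | "w ! (i - 1) \<noteq> 0" "w ! i \<noteq> 0"
      by blast
    thus ?thesis
    proof cases
      case 1
      hence "E2 = E"
        unfolding E2_def E_def F_def using G'(3) posD by (intro fdet_cong) fastforce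
      thus ?thesis
        using 1 by (simp add: act val fscale_def)
    next
      case 2
      then obtain c where c: "c < l" "w ! i = Suc c" "letter_pos w c = i"
        using letter assms by blast
      have "G' (letter_pos w b) a = G (s (letter_pos w b)) a" if "b < l" for a b
      proof (cases "b = c")
        case False
        hence "letter_pos w b \<noteq> i - 1" "letter_pos w b \<noteq> i"
          using posD[OF refl that] 2 c by auto
        thus ?thesis
          using G'(3) by (simp add: s_def)
      qed (use c G'(2) in \<open>simp add: s_def\<close>)
      hence "E2 = E1"
        unfolding E2_def E1_def by (intro fdet_cong) auto
      moreover have "N (swap_letters i w) = N w"
        using inv 2 by (simp add: N_def R_def)
      ultimately show ?thesis
        using 2 by (simp add: act val fscale_def)
    next
      case 3
      then obtain c where c: "c < l" "w ! (i - 1) = Suc c" "letter_pos w c = i - 1"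
        using letter ii by blast
      have ne: "letter_pos w b \<noteq> i - 1" "letter_pos w b \<noteq> i" if "b < l" "b \<noteq> c" for b
        using posD[OF refl that(1)] that 3 c by auto
      have "E1 = fdet l (F(c := G i))"
        unfolding E1_def using c ne by (intro fdet_cong) (auto simp: F_def s_def)
      moreover have "E = fdet l (F(c := G (i - 1)))"
        unfolding E_def using c by (intro fdet_cong) (auto simp: F_def)
      moreover have "E2 = fdet l (F(c := G' (i - 1)))"
        unfolding E2_def using c ne G'(3) by (intro fdet_cong) (auto simp: F_def)
      ultimately have "E2 = (1 - 1 / Q) * E + 1 / Q * E1"
        unfolding G' using fdet_row_linear[OF c(1)] by metis
      hence "Q * E2 = Q * E - E + E1"
        using assms by (simp add: field_simps)
      hence q: "N w * (Q * E2) = N w * (Q * E - E + E1)"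
        by simp
      moreover have "N (swap_letters i w) = N w"
        using inv 3 by (simp add: N_def R_def)
      ultimately show ?thesis
        using 3 q by (simp add: act val fscale_def algebra_simps)
    next
      case 4
      then obtain c where c: "c < l" "w ! (i - 1) = Suc c" "letter_pos w c = i - 1"
        using letter ii by blast
      obtain d where d: "d < l" "w ! i = Suc d" "letter_pos w d = i"
        using letter assms 4 by blast
      have cd: "c \<noteq> d"
        using c d ii by auto
      have ne: "letter_pos w b \<noteq> i - 1" "letter_pos w b \<noteq> i" if "b < l" "b \<noteq> c" "b \<noteq> d" for b
        using posD[OF refl that(1)] that c d by auto
      have E: "E = fdet l (F(c := G (i - 1), d := G i))"
        unfolding E_def using c d by (intro fdet_cong) (auto simp: F_def)
      have "E1 = fdet l (F(c := \<lambda>a. 0 * G (i - 1) a + 1 * G i a, d := \<lambda>a. 1 * G (i - 1) a + 0 * G i a))"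
        unfolding E1_def using c d ne by (intro fdet_cong) (auto simp: F_def s_def)
      hence "E1 = (0 * 0 - 1 * 1) * E"
        unfolding E fdet_two_rows[OF c(1) d(1) cd] .
      hence E1: "E1 = - E"
        by simp
      have "E2 = fdet l (F(c := G' (i - 1), d := G' i))"
        unfolding E2_def using c d ne G'(3) by (intro fdet_cong) (auto simp: F_def)
      hence "E2 = ((1 - 1 / Q) * 0 - 1 / Q * 1) * E"
        unfolding G' E fdet_two_rows[OF c(1) d(1) cd] .
      hence E2: "Q * E2 = - E"
        using assms by simp
      show ?thesis
      proof (cases "c < d")
        case True
        hence "ninv R n (nth (swap_letters i w)) = Suc (ninv R n (nth w))"
          using inv c d by (simp add: R_def)
        hence "Q * N (swap_letters i w) = N w"
          using assms by (simp add: N_def)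
        hence "hecke_act Q i (wedge n l Q x) w = N w * (- E)"
          using True c d unfolding act E1 by (simp flip: mult.assoc)
        thus ?thesis
          by (simp add: val fscale_def flip: E2)
      next
        case False
        hence "Suc (ninv R n (nth (swap_letters i w))) = ninv R n (nth w)"
          using inv c d cd by (simp add: R_def)
        hence "N w = inverse Q * N (swap_letters i w)"
          unfolding N_def by (metis power_Suc)
        hence "N (swap_letters i w) = Q * N w"
          using assms by simp
        hence "hecke_act Q i (wedge n l Q x) w = N w * (- E)"
          using False cd c d unfolding act E1 by (simp add: algebra_simps)
        thus ?thesis
          by (simp add: val fscale_def flip: E2)
      qed
    qed
  qed
qed

section \<open>The reflection module and its exterior powers\<close>

text \<open>The sum \<open>Q + Q\<^sup>2 + \<dots> + Q\<^sup>j\<close>; for \<open>Q = q\<^sup>2\<close> it is \<open>q\<^bsup>j+1\<^esup> [[j]]\<close> (see \<open>geo_sum_qreal\<close> below).\<close>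
definition geo_sum :: "complex \<Rightarrow> nat \<Rightarrow> complex" where
  "geo_sum Q j = (\<Sum>k=1..j. Q ^ k)"

lemma geo_sum_0 [simp]: "geo_sum Q 0 = 0"
  by (simp add: geo_sum_def)

lemma geo_sum_Suc: "geo_sum Q (Suc j) = Q * (1 + geo_sum Q j)"
proof -
  have "geo_sum Q (Suc j) = (\<Sum>k=0..j. Q ^ Suc k)"
    unfolding geo_sum_def by (subst sum.shift_bounds_cl_Suc_ivl[symmetric]) simp
  also have "\<dots> = Q * (\<Sum>k=0..j. Q ^ k)"
    by (simp add: sum_distrib_left)
  also have "(\<Sum>k=0..j. Q ^ k) = 1 + geo_sum Q j"
    unfolding geo_sum_def by (subst sum.atLeast_Suc_atMost) simp_all
  finally show ?thesis .
qed

lemma geo_sum_Suc': "geo_sum Q (Suc j) = geo_sum Q j + Q ^ Suc j"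
  by (simp add: geo_sum_def)

text \<open>
  The vectors \<open>u\<^sub>j\<close>, written in coordinates. If the entries \<open>Q + \<dots> + Q\<^sup>j\<close> do not vanish, those
  with \<open>1 \<le> j < n\<close> form a basis of the reflection module, the space of all \<open>x\<close> with \<open>\<Sum>\<^sub>k Q\<^bsup>-k\<^esup> x(k) = 0\<close>;
  these entries are dictated by this equation. On the coordinates below \<open>j\<close> the vector is constant,
  hence fixed by \<open>T\<^sub>i / Q\<close> for \<open>i < j\<close>. The degenerate case is \<open>u\<^sub>0 = 0\<close>.
\<close>
definition refl_vec :: "complex \<Rightarrow> nat \<Rightarrow> nat \<Rightarrow> complex" where
  "refl_vec Q j k = (if k < j then -1 else if k = j then geo_sum Q j else 0)"

lemma refl_vec_0 [simp]: "refl_vec Q 0 = (\<lambda>k. 0)"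
  by (auto simp: refl_vec_def)

lemma burau_act_refl_vec_other:
  assumes "Q \<noteq> 0" "1 \<le> i" "j \<noteq> i - 1" "j \<noteq> i"
  shows "burau_act Q i (refl_vec Q j) = refl_vec Q j"
  using assms by (auto simp: burau_act_def refl_vec_def fun_eq_iff)

lemma burau_act_refl_vec_pred:
  assumes "Q \<noteq> 0" "1 \<le> i" "geo_sum Q i \<noteq> 0"
  shows "burau_act Q i (refl_vec Q (i - 1)) = (\<lambda>k. (1 - geo_sum Q (i - 1) / geo_sum Q i) * refl_vec Q (i - 1) k
           + geo_sum Q (i - 1) / geo_sum Q i * refl_vec Q i k)"
proof -
  obtain m where m: "i = Suc m"
    using assms by (cases i) auto
  define b where "b = geo_sum Q (i - 1) / geo_sum Q i"
  have b: "b * geo_sum Q i = geo_sum Q m"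
    using assms by (simp add: b_def m)
  hence "Q * (b + b * geo_sum Q m) = geo_sum Q m"
    by (simp add: m geo_sum_Suc algebra_simps)
  hence b': "b + b * geo_sum Q m = geo_sum Q m / Q"
    using assms by (simp add: field_simps)
  show ?thesis
    unfolding b_def[symmetric]
  proof
    fix k
    consider "k < m" | "k = m" | "k = Suc m" | "k > Suc m"
      by linarith
    thus "burau_act Q i (refl_vec Q (i - 1)) k = (1 - b) * refl_vec Q (i - 1) k + b * refl_vec Q i k"
    proof cases
      case 2
      have "(1 - b) * geo_sum Q m - b = geo_sum Q m - (b + b * geo_sum Q m)"
        by (simp add: algebra_simps)
      thus ?thesis
        unfolding b' using 2 by (simp add: burau_act_def refl_vec_def m algebra_simps)
    qed (use b in \<open>auto simp: burau_act_def refl_vec_def m\<close>)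
  qed
qed

lemma burau_act_refl_vec_self:
  assumes "Q \<noteq> 0" "1 \<le> i" "geo_sum Q i \<noteq> 0"
  shows "burau_act Q i (refl_vec Q i) = (\<lambda>k. (1 + 1 / geo_sum Q i) * refl_vec Q (i - 1) k
           + (- 1 / geo_sum Q i) * refl_vec Q i k)"
proof -
  obtain m where m: "i = Suc m"
    using assms by (cases i) auto
  define e where "e = 1 / geo_sum Q i"
  have e: "e * geo_sum Q i = 1" and neg: "- 1 / geo_sum Q i = - e"
    using assms by (simp_all add: e_def)
  have "Q * (e + e * geo_sum Q m) = e * geo_sum Q i"
    by (simp add: m geo_sum_Suc algebra_simps)
  hence e': "e + e * geo_sum Q m = 1 / Q"
    unfolding e using assms by (simp add: field_simps)
  have H: "geo_sum Q i / Q = 1 + geo_sum Q m"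
    using assms by (simp add: m geo_sum_Suc)
  show ?thesis
    unfolding neg e_def[symmetric]
  proof
    fix k
    consider "k < m" | "k = m" | "k = Suc m" | "k > Suc m"
      by linarith
    thus "burau_act Q i (refl_vec Q i) k = (1 + e) * refl_vec Q (i - 1) k + (- e) * refl_vec Q i k"
    proof cases
      case 2
      have "(1 + e) * geo_sum Q m + e = geo_sum Q m + (e + e * geo_sum Q m)"
        by (simp add: algebra_simps)
      also have "\<dots> = (1 - 1 / Q) * (- 1) + geo_sum Q i / Q"
        unfolding e' H by simp
      finally show ?thesis
        using 2 by (simp add: burau_act_def refl_vec_def m)
    qed (use e in \<open>auto simp: burau_act_def refl_vec_def m\<close>)
  qed
qed

text \<open>The determinant of \<open>T\<^sub>i / Q\<close> on the plane spanned by \<open>u\<^bsub>i-1\<^esub>\<close> and \<open>u\<^sub>i\<close>.\<close>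
lemma burau_act_refl_vec_det:
  assumes "Q \<noteq> 0" "1 \<le> i" "geo_sum Q i \<noteq> 0"
  shows "(1 - geo_sum Q (i - 1) / geo_sum Q i) * (- 1 / geo_sum Q i)
           - geo_sum Q (i - 1) / geo_sum Q i * (1 + 1 / geo_sum Q i) = - 1 / Q"
proof -
  obtain m where m: "i = Suc m"
    using assms by (cases i) auto
  define e where "e = 1 / geo_sum Q i"
  have e: "e * geo_sum Q i = 1" and div: "- 1 / geo_sum Q i = - e" "geo_sum Q (i - 1) / geo_sum Q i = geo_sum Q m * e"
    using assms by (simp_all add: e_def m)
  have "Q * (e + e * geo_sum Q m) = e * geo_sum Q i"
    by (simp add: m geo_sum_Suc algebra_simps)
  hence e': "e + e * geo_sum Q m = 1 / Q"
    unfolding e using assms by (simp add: field_simps)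
  have "(1 - geo_sum Q m * e) * (- e) - geo_sum Q m * e * (1 + e) = - (e + e * geo_sum Q m)"
    by (simp add: algebra_simps)
  thus ?thesis
    unfolding div e' e_def[symmetric] by simp
qed

lemma wedge_cong:
  assumes "\<And>a k. a < l \<Longrightarrow> x a k = y a k"
  shows "wedge n l Q x = wedge n l Q y"
proof -
  have "fdet l (\<lambda>b a. x a (letter_pos w b)) = fdet l (\<lambda>b a. y a (letter_pos w b))" for w
    using assms by (intro fdet_cong) auto
  thus ?thesis
    by (simp add: wedge_def fun_eq_iff)
qed

lemma wedge_det_transpose: "fdet l (\<lambda>b a. x a (letter_pos w b)) = fdet l (\<lambda>a b. x a (letter_pos w b))"
  using fdet_transpose[of l "\<lambda>a b. x a (letter_pos w b)"] by simp

lemma wedge_row_linear: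
  assumes "c < l"
  shows "wedge n l Q (x(c := \<lambda>k. \<alpha> * f k + \<beta> * g k)) =
         fscale \<alpha> (wedge n l Q (x(c := f))) + fscale \<beta> (wedge n l Q (x(c := g)))"
proof
  fix w
  define X where "X a = (\<lambda>b. x a (letter_pos w b))" for a
  have *: "(\<lambda>a b. (x(c := h)) a (letter_pos w b)) = X(c := \<lambda>b. h (letter_pos w b))" for h
    by (auto simp: X_def fun_eq_iff)
  have val: "wedge n l Q (x(c := h)) w = (if hook_word n l w
      then inverse Q ^ ninv (\<lambda>a b. 0 < b \<and> b < a) n (nth w) * fdet l (X(c := \<lambda>b. h (letter_pos w b)))
      else 0)" for h
    unfolding wedge_def wedge_det_transpose * ..
  show "wedge n l Q (x(c := \<lambda>k. \<alpha> * f k + \<beta> * g k)) w =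
         (fscale \<alpha> (wedge n l Q (x(c := f))) + fscale \<beta> (wedge n l Q (x(c := g)))) w"
    using fdet_row_linear[OF assms, of X \<alpha> "\<lambda>b. f (letter_pos w b)" \<beta> "\<lambda>b. g (letter_pos w b)"]
    by (simp add: val fscale_def algebra_simps)
qed

lemma wedge_two_rows:
  assumes "c < l" "d < l" "c \<noteq> d"
  shows "wedge n l Q (x(c := \<lambda>k. \<alpha> * f k + \<beta> * g k, d := \<lambda>k. \<gamma> * f k + \<delta> * g k)) =
         fscale (\<alpha> * \<delta> - \<beta> * \<gamma>) (wedge n l Q (x(c := f, d := g)))"
proof
  fix w
  define X where "X a = (\<lambda>b. x a (letter_pos w b))" for a
  have *: "(\<lambda>a b. (x(c := h, d := h')) a (letter_pos w b)) =
      X(c := \<lambda>b. h (letter_pos w b), d := \<lambda>b. h' (letter_pos w b))" for h h'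
    by (auto simp: X_def fun_eq_iff)
  have val: "wedge n l Q (x(c := h, d := h')) w = (if hook_word n l w
      then inverse Q ^ ninv (\<lambda>a b. 0 < b \<and> b < a) n (nth w) *
        fdet l (X(c := \<lambda>b. h (letter_pos w b), d := \<lambda>b. h' (letter_pos w b)))
      else 0)" for h h'
    unfolding wedge_def wedge_det_transpose * ..
  show "wedge n l Q (x(c := \<lambda>k. \<alpha> * f k + \<beta> * g k, d := \<lambda>k. \<gamma> * f k + \<delta> * g k)) w =
         fscale (\<alpha> * \<delta> - \<beta> * \<gamma>) (wedge n l Q (x(c := f, d := g))) w"
    using fdet_two_rows[OF assms, of X \<alpha> "\<lambda>b. f (letter_pos w b)" \<beta> "\<lambda>b. g (letter_pos w b)" \<gamma> \<delta>]
    by (simp add: val fscale_def mult_ac)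
qed

lemma wedge_row_zero:
  assumes "c < l" "x c = (\<lambda>k. 0)"
  shows "wedge n l Q x = 0"
proof -
  have "x = x(c := \<lambda>k. 0 * x c k + 0 * x c k)"
    using assms(2) by (auto simp: fun_eq_iff)
  hence "wedge n l Q x = wedge n l Q (x(c := \<lambda>k. 0 * x c k + 0 * x c k))"
    by (rule arg_cong)
  thus ?thesis
    unfolding wedge_row_linear[OF assms(1)] by (simp add: fscale_def fun_eq_iff)
qed

text \<open>The exterior product \<open>v\<^sub>J\<close> of the \<open>u\<^sub>j\<close> with \<open>j \<in> J\<close>, the factors being taken in increasing order.\<close>
definition leg_vec :: "complex \<Rightarrow> nat \<Rightarrow> nat \<Rightarrow> nat set \<Rightarrow> nat list \<Rightarrow> complex" where
  "leg_vec Q n l J = wedge n l Q (\<lambda>a. refl_vec Q (sorted_list_of_set J ! a))"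

lemma sorted_list_replace_pred:
  fixes J :: "nat set"
  assumes "finite J" "1 \<le> i" "i \<notin> J" "c < card J" "sorted_list_of_set J ! c = i - 1"
  shows "sorted_list_of_set (insert i (J - {i - 1})) = (sorted_list_of_set J)[c := i]"
proof -
  define js where "js = sorted_list_of_set J"
  have js: "sorted_wrt (<) js" "set js = J" "length js = card J" "distinct js"
    using assms by (auto simp: js_def)
  have c: "c < length js" "js ! c = i - 1"
    using assms js by (auto simp: js_def)
  have "sorted_wrt (<) (js[c := i])"
    unfolding sorted_wrt_iff_nth_less
  proof (intro allI impI)
    fix a b assume ab: "a < b" "b < length (js[c := i])"
    hence lt: "js ! a < js ! b"
      using js(1) by (simp add: sorted_wrt_iff_nth_less)
    have "js ! b \<noteq> i"
      using ab js assms by (metis length_list_update nth_mem)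
    thus "js[c := i] ! a < js[c := i] ! b"
      using ab lt c assms(2) by (auto simp: nth_list_update)
  qed
  moreover have "set (js[c := i]) = insert i (J - {i - 1})"
    using set_update_distinct[OF js(4) c(1)] js(2) c(2) by simp
  ultimately show ?thesis
    using assms(1) unfolding js_def
    by (metis finite_Diff finite_insert sorted_list_of_set.idem_if_sorted_distinct
        strict_sorted_iff)
qed

lemma leg_vec_zero:
  assumes "finite J" "card J = l" "0 \<in> J"
  shows "leg_vec Q n l J = 0"
proof -
  obtain c where "c < l" "sorted_list_of_set J ! c = 0"
    using assms by (metis in_set_conv_nth length_sorted_list_of_set set_sorted_list_of_set)
  thus ?thesis
    unfolding leg_vec_def by (intro wedge_row_zero[of c]) auto
qed

text \<open>
  The action of \<open>T\<^sub>i\<close> on \<open>v\<^sub>J\<close> depends on which of \<open>i - 1\<close> and \<open>i\<close> belong to \<open>J\<close>. If exactly one of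
  them does, then replacing it by the other one keeps the increasing order of the factors.
\<close>
context
  fixes Q :: complex and n l i :: nat and J :: "nat set"
  assumes Q: "Q \<noteq> 0" and i: "1 \<le> i" "i < n" and h: "geo_sum Q i \<noteq> 0"
    and J: "finite J" "card J = l"
begin

lemma index_ex: "j \<in> J \<Longrightarrow> \<exists>c<l. sorted_list_of_set J ! c = j"
  using J by (metis in_set_conv_nth length_sorted_list_of_set set_sorted_list_of_set)

lemma index_inj: "c < l \<Longrightarrow> d < l \<Longrightarrow> sorted_list_of_set J ! c = sorted_list_of_set J ! d \<Longrightarrow> c = d"
  using J nth_eq_iff_index_eq[of "sorted_list_of_set J" c d] by simp

lemma index_in: "c < l \<Longrightarrow> sorted_list_of_set J ! c \<in> J"
  using J by (metis nth_mem length_sorted_list_of_set set_sorted_list_of_set)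

lemma hecke_act_leg_vec_neither:
  assumes "i - 1 \<notin> J" "i \<notin> J"
  shows "hecke_act Q i (leg_vec Q n l J) = fscale Q (leg_vec Q n l J)"
proof -
  have "burau_act Q i (refl_vec Q (sorted_list_of_set J ! a)) k = refl_vec Q (sorted_list_of_set J ! a) k"
    if "a < l" for a k
    using index_in[OF that] assms i Q by (subst burau_act_refl_vec_other) auto
  thus ?thesis
    unfolding leg_vec_def hecke_act_wedge[OF Q i] by (intro arg_cong[of _ _ "fscale Q"] wedge_cong)
qed

lemma hecke_act_leg_vec_both:
  assumes "i - 1 \<in> J" "i \<in> J"
  shows "hecke_act Q i (leg_vec Q n l J) = fscale (-1) (leg_vec Q n l J)"
proof -
  define js where "js = sorted_list_of_set J"
  define x where "x a = refl_vec Q (js ! a)" for a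
  obtain c where c: "c < l" "js ! c = i - 1"
    using index_ex[OF assms(1)] by (auto simp: js_def)
  obtain d where d: "d < l" "js ! d = i"
    using index_ex[OF assms(2)] by (auto simp: js_def)
  have cd: "c \<noteq> d"
    using c d i by auto
  have "wedge n l Q (\<lambda>a. burau_act Q i (x a)) =
        wedge n l Q (x(c := burau_act Q i (refl_vec Q (i - 1)), d := burau_act Q i (refl_vec Q i)))"
  proof (rule wedge_cong)
    fix a k assume a: "a < l"
    show "burau_act Q i (x a) k = (x(c := burau_act Q i (refl_vec Q (i - 1)), d := burau_act Q i (refl_vec Q i))) a k"
    proof (cases "a = c \<or> a = d")
      case False
      hence "js ! a \<noteq> i - 1" "js ! a \<noteq> i"
        using index_inj[OF a c(1)] index_inj[OF a d(1)] c d by (auto simp: js_def)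
      thus ?thesis
        using False Q i by (simp add: x_def burau_act_refl_vec_other)
    qed (use c d in \<open>auto simp: x_def\<close>)
  qed
  also have "\<dots> = fscale (- 1 / Q) (wedge n l Q (x(c := refl_vec Q (i - 1), d := refl_vec Q i)))"
    unfolding burau_act_refl_vec_pred[OF Q i(1) h] burau_act_refl_vec_self[OF Q i(1) h]
      wedge_two_rows[OF c(1) d(1) cd] burau_act_refl_vec_det[OF Q i(1) h] ..
  also have "x(c := refl_vec Q (i - 1), d := refl_vec Q i) = x"
    using c d by (auto simp: x_def fun_eq_iff)
  finally show ?thesis
    using Q unfolding leg_vec_def hecke_act_wedge[OF Q i] x_def js_def by (simp add: fscale_def fun_eq_iff)
qed

lemma hecke_act_leg_vec_single:
  assumes "c < l" and r: "sorted_list_of_set J ! c = r" "r = i - 1 \<or> r = i"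
    and other: "\<And>a. a < l \<Longrightarrow> a \<noteq> c \<Longrightarrow> sorted_list_of_set J ! a \<noteq> i - 1 \<and> sorted_list_of_set J ! a \<noteq> i"
    and u: "burau_act Q i (refl_vec Q r) = (\<lambda>k. \<alpha> * refl_vec Q (i - 1) k + \<beta> * refl_vec Q i k)"
  shows "hecke_act Q i (leg_vec Q n l J) =
     fscale (Q * \<alpha>) (wedge n l Q (\<lambda>a. refl_vec Q ((sorted_list_of_set J)[c := i - 1] ! a))) +
     fscale (Q * \<beta>) (wedge n l Q (\<lambda>a. refl_vec Q ((sorted_list_of_set J)[c := i] ! a)))"
proof -
  define js where "js = sorted_list_of_set J"
  define x where "x a = refl_vec Q (js ! a)" for a
  have len: "length js = l"
    using J by (simp add: js_def)
  have "wedge n l Q (\<lambda>a. burau_act Q i (x a)) = wedge n l Q (x(c := burau_act Q i (refl_vec Q r)))"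
  proof (rule wedge_cong)
    fix a k assume a: "a < l"
    show "burau_act Q i (x a) k = (x(c := burau_act Q i (refl_vec Q r))) a k"
      using other[OF a] r Q i by (cases "a = c") (auto simp: x_def js_def burau_act_refl_vec_other)
  qed
  also have "\<dots> = fscale \<alpha> (wedge n l Q (\<lambda>a. refl_vec Q (js[c := i - 1] ! a))) +
      fscale \<beta> (wedge n l Q (\<lambda>a. refl_vec Q (js[c := i] ! a)))"
  proof -
    have "wedge n l Q (x(c := refl_vec Q r')) = wedge n l Q (\<lambda>a. refl_vec Q (js[c := r'] ! a))" for r'
      using assms(1) len by (intro wedge_cong) (auto simp: x_def nth_list_update)
    thus ?thesis
      unfolding u wedge_row_linear[OF assms(1)] by simp
  qed
  finally show ?thesis
    using Q unfolding leg_vec_def hecke_act_wedge[OF Q i] x_def js_def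
    by (simp add: fscale_def fun_eq_iff algebra_simps)
qed

lemma hecke_act_leg_vec_pred:
  assumes "i - 1 \<in> J" "i \<notin> J"
  shows "hecke_act Q i (leg_vec Q n l J) =
     fscale (Q * (1 - geo_sum Q (i - 1) / geo_sum Q i)) (leg_vec Q n l J) +
     fscale (Q * (geo_sum Q (i - 1) / geo_sum Q i)) (leg_vec Q n l (insert i (J - {i - 1})))"
proof -
  obtain c where c: "c < l" "sorted_list_of_set J ! c = i - 1"
    using index_ex[OF assms(1)] by auto
  have other: "sorted_list_of_set J ! a \<noteq> i - 1 \<and> sorted_list_of_set J ! a \<noteq> i"
    if "a < l" "a \<noteq> c" for a
    using index_inj[OF that(1) c(1)] index_in[OF that(1)] that assms c by auto
  have "hecke_act Q i (leg_vec Q n l J) =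
     fscale (Q * (1 - geo_sum Q (i - 1) / geo_sum Q i))
       (wedge n l Q (\<lambda>a. refl_vec Q ((sorted_list_of_set J)[c := i - 1] ! a))) +
     fscale (Q * (geo_sum Q (i - 1) / geo_sum Q i))
       (wedge n l Q (\<lambda>a. refl_vec Q ((sorted_list_of_set J)[c := i] ! a)))"
    by (rule hecke_act_leg_vec_single[OF c _ _ burau_act_refl_vec_pred[OF Q i(1) h]]) (use other in auto)
  moreover have "sorted_list_of_set (insert i (J - {i - 1})) = (sorted_list_of_set J)[c := i]"
    by (rule sorted_list_replace_pred) (use J i assms c in auto)
  moreover have "(sorted_list_of_set J)[c := i - 1] = sorted_list_of_set J"
    using c by (metis list_update_id)
  ultimately show ?thesis
    unfolding leg_vec_def by (simp only:)
qed

lemma hecke_act_leg_vec_self: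
  assumes "i - 1 \<notin> J" "i \<in> J"
  shows "hecke_act Q i (leg_vec Q n l J) =
     fscale (Q * (- 1 / geo_sum Q i)) (leg_vec Q n l J) +
     fscale (Q * (1 + 1 / geo_sum Q i)) (leg_vec Q n l (insert (i - 1) (J - {i})))"
proof -
  define J' where "J' = insert (i - 1) (J - {i})"
  have J': "finite J'" "card J' = l" "i \<notin> J'" "i - 1 \<in> J'" "insert i (J' - {i - 1}) = J"
    using J i assms card_Suc_Diff1[of J i] by (auto simp: J'_def simp del: card_Diff_insert)
  obtain c where c: "c < l" "sorted_list_of_set J' ! c = i - 1"
    using J' by (metis in_set_conv_nth length_sorted_list_of_set set_sorted_list_of_set)
  have upd: "sorted_list_of_set J = (sorted_list_of_set J')[c := i]"
  proof -
    have "sorted_list_of_set (insert i (J' - {i - 1})) = (sorted_list_of_set J')[c := i]"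
      by (rule sorted_list_replace_pred) (use J' i c in auto)
    thus ?thesis
      unfolding J'(5) .
  qed
  have ci: "sorted_list_of_set J ! c = i"
    using c J' unfolding upd by simp
  have other: "sorted_list_of_set J ! a \<noteq> i - 1 \<and> sorted_list_of_set J ! a \<noteq> i"
    if "a < l" "a \<noteq> c" for a
    using index_inj[OF that(1) c(1)] index_in[OF that(1)] that assms ci by auto
  have "hecke_act Q i (leg_vec Q n l J) =
     fscale (Q * (1 + 1 / geo_sum Q i))
       (wedge n l Q (\<lambda>a. refl_vec Q ((sorted_list_of_set J)[c := i - 1] ! a))) +
     fscale (Q * (- 1 / geo_sum Q i))
       (wedge n l Q (\<lambda>a. refl_vec Q ((sorted_list_of_set J)[c := i] ! a)))"
    by (rule hecke_act_leg_vec_single[OF c(1) ci _ _ burau_act_refl_vec_self[OF Q i(1) h]]) (use other in auto)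
  moreover have "(sorted_list_of_set J)[c := i] = sorted_list_of_set J"
    using ci by (metis list_update_id)
  moreover have "(sorted_list_of_set J)[c := i - 1] = sorted_list_of_set J'"
    unfolding upd using c by (metis list_update_id list_update_overwrite)
  ultimately show ?thesis
    unfolding leg_vec_def J'_def by (simp add: add.commute)
qed

end

section \<open>The seminormal basis\<close>

text \<open>
  The index sets of the basis. A standard tableau of hook shape is determined by the entries
  of its leg; \<open>J\<close> consists of these entries diminished by one.
\<close>
definition legs :: "nat \<Rightarrow> nat \<Rightarrow> nat set set" where
  "legs n l = {J. J \<subseteq> {1..<n} \<and> card J = l}"

lemma legsD:
  assumes "J \<in> legs n l"
  shows "finite J" "card J = l" "J \<subseteq> {1..<n}" "0 \<notin> J"
  using assms finite_subset[of J "{1..<n}"] by (auto simp: legs_def)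

lemma finite_legs [simp]: "finite (legs n l)"
  by (rule finite_subset[of _ "Pow {1..<n}"]) (auto simp: legs_def)

lemma bij_betw_sorted_list:
  fixes J :: "nat set"
  assumes "finite J" "card J = l"
  shows "bij_betw ((!) (sorted_list_of_set J)) {0..<l} J"
  using assms by (intro bij_betw_nth) auto

text \<open>The action of the transposition of \<open>i - 1\<close> and \<open>i\<close> on sets.\<close>
definition leg_swap :: "nat \<Rightarrow> nat set \<Rightarrow> nat set" where
  "leg_swap i J = transpose (i - 1) i ` J"

lemma leg_swap_invol: "leg_swap i (leg_swap i J) = J"
  by (auto simp: leg_swap_def image_image)

lemma leg_swap_in_legs:
  assumes "J \<in> legs n l" "2 \<le> i" "i < n"
  shows "leg_swap i J \<in> legs n l"
proof -
  have "card (leg_swap i J) = card J"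
    unfolding leg_swap_def by (rule card_image) (rule inj_on_subset[OF inj_transpose], simp)
  moreover have "transpose (i - 1) i k \<in> {1..<n}" if "k \<in> {1..<n}" for k
    using that assms by (auto simp: transpose_def)
  ultimately show ?thesis
    using assms unfolding legs_def leg_swap_def by auto
qed

lemma mem_leg_swap: "k \<in> leg_swap i J \<longleftrightarrow> transpose (i - 1) i k \<in> J"
  unfolding leg_swap_def by (metis (no_types, lifting) image_iff transpose_involutory)

lemma leg_swap_mem:
  "i - 1 \<in> leg_swap i J \<longleftrightarrow> i \<in> J" "i \<in> leg_swap i J \<longleftrightarrow> i - 1 \<in> J"
  "k \<noteq> i - 1 \<Longrightarrow> k \<noteq> i \<Longrightarrow> k \<in> leg_swap i J \<longleftrightarrow> k \<in> J"
  by (simp_all add: mem_leg_swap)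

lemma leg_swap_eq:
  "i - 1 \<in> J \<Longrightarrow> i \<notin> J \<Longrightarrow> leg_swap i J = insert i (J - {i - 1})"
  "i - 1 \<notin> J \<Longrightarrow> i \<in> J \<Longrightarrow> leg_swap i J = insert (i - 1) (J - {i})"
  "(i - 1 \<in> J \<longleftrightarrow> i \<in> J) \<Longrightarrow> leg_swap i J = J"
  by (auto simp: set_eq_iff mem_leg_swap transpose_def)

lemma sum_leg_swap:
  assumes "J \<in> legs n l" "i \<in> J" "i - 1 \<notin> J"
  shows "\<Sum>(leg_swap i J) < \<Sum>J"
proof -
  have fin: "finite J" and "i \<noteq> 0"
    using legsD[OF assms(1)] assms(2) by (auto intro!: gr0I)
  have "\<Sum>J = i + \<Sum>(J - {i})"
    using fin assms(2) by (simp add: sum.remove)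
  moreover have "\<Sum>(leg_swap i J) = (i - 1) + \<Sum>(J - {i})"
    unfolding leg_swap_eq(2)[OF assms(3,2)] using fin assms(3) by simp
  ultimately show ?thesis
    using \<open>i \<noteq> 0\<close> by simp
qed

text \<open>A set that no admissible transposition can lower is the initial segment.\<close>
lemma initial_leg:
  assumes "J \<in> legs n l" "\<And>i. i \<in> J \<Longrightarrow> 2 \<le> i \<Longrightarrow> i - 1 \<in> J"
  shows "J = {1..l}"
proof (cases "J = {}")
  case True
  thus ?thesis
    using legsD(2)[OF assms(1)] by simp
next
  case False
  note J = legsD[OF assms(1)]
  define m where "m = Max J"
  have m: "m \<in> J"
    using J False by (simp add: m_def)
  have down: "m - k \<in> J" if "k < m" for k
    using that
  proof (induction k)
    case (Suc k)
    thus ?case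
      using assms(2)[of "m - k"] by simp
  qed (use m in simp)
  have "J = {1..m}"
  proof
    show "J \<subseteq> {1..m}"
      using J by (auto simp: m_def)
    show "{1..m} \<subseteq> J"
    proof
      fix k assume "k \<in> {1..m}"
      thus "k \<in> J"
        using down[of "m - k"] by simp
    qed
  qed
  thus ?thesis
    using J(2) by simp
qed

text \<open>
  Every index set arises from \<open>{1..l}\<close> by steps that replace an element \<open>i - 1\<close> by \<open>i\<close>.
\<close>
lemma legs_induct [consumes 1, case_names initial step]:
  assumes "J \<in> legs n l"
    and "P {1..l}"
    and "\<And>J i. J \<in> legs n l \<Longrightarrow> 2 \<le> i \<Longrightarrow> i < n \<Longrightarrow> i - 1 \<in> J \<Longrightarrow> i \<notin> J \<Longrightarrow> P J \<Longrightarrow>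
           P (leg_swap i J)"
  shows "P J"
  using assms(1)
proof (induction "\<Sum>J" arbitrary: J rule: less_induct)
  case less
  show ?case
  proof (cases "\<exists>i\<in>J. 2 \<le> i \<and> i - 1 \<notin> J")
    case True
    then obtain i where i: "i \<in> J" "2 \<le> i" "i - 1 \<notin> J"
      by blast
    hence "i < n"
      using legsD(3)[OF less.prems] by auto
    hence J': "leg_swap i J \<in> legs n l"
      using leg_swap_in_legs less.prems i by blast
    have "P (leg_swap i J)"
      using less.hyps[OF sum_leg_swap[OF less.prems i(1,3)] J'] .
    hence "P (leg_swap i (leg_swap i J))"
      using assms(3)[OF J' i(2) \<open>i < n\<close>] leg_swap_mem(1,2)[of i J] i by blast
    thus ?thesis
      by (simp add: leg_swap_invol)
  next
    case False
    thus ?thesis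
      using initial_leg[OF less.prems] assms(2) by blast
  qed
qed

text \<open>
  The coefficients of \<open>T\<^sub>i v\<^sub>J\<close> at \<open>v\<^sub>J\<close> and at \<open>v\<^bsub>s J\<^esub>\<close>, where \<open>s\<close> exchanges \<open>i - 1\<close> and \<open>i\<close>. For
  \<open>i = 1\<close> the second one is set to \<open>0\<close>, since then either \<open>s J = J\<close>, or \<open>v\<^bsub>s J\<^esub>\<close> contains the factor
  \<open>u\<^sub>0 = 0\<close>.
\<close>
definition diag_coeff :: "complex \<Rightarrow> nat \<Rightarrow> nat set \<Rightarrow> complex" where
  "diag_coeff Q i J =
     (if i - 1 \<in> J then if i \<in> J then - 1 else Q * (1 - geo_sum Q (i - 1) / geo_sum Q i)
      else if i \<in> J then Q * (- 1 / geo_sum Q i) else Q)"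

definition swap_coeff :: "complex \<Rightarrow> nat \<Rightarrow> nat set \<Rightarrow> complex" where
  "swap_coeff Q i J =
     (if i = 1 then 0
      else if i - 1 \<in> J \<and> i \<notin> J then Q * (geo_sum Q (i - 1) / geo_sum Q i)
      else if i - 1 \<notin> J \<and> i \<in> J then Q * (1 + 1 / geo_sum Q i) else 0)"

lemma hecke_act_leg_vec:
  assumes "Q \<noteq> 0" "1 \<le> i" "i < n" "geo_sum Q i \<noteq> 0" "J \<in> legs n l"
  shows "hecke_act Q i (leg_vec Q n l J) =
    fscale (diag_coeff Q i J) (leg_vec Q n l J) + fscale (swap_coeff Q i J) (leg_vec Q n l (leg_swap i J))"
proof -
  note J = legsD[OF assms(5)]
  note ctx = assms(1-4) J(1,2)
  have zero: "fscale 0 f = (0 :: nat list \<Rightarrow> complex)" for f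
    by (simp add: fscale_def fun_eq_iff)
  consider "i - 1 \<in> J" "i \<in> J" | "i - 1 \<in> J" "i \<notin> J" | "i - 1 \<notin> J" "i \<in> J" "i = 1"
    | "i - 1 \<notin> J" "i \<in> J" "i \<noteq> 1" | "i - 1 \<notin> J" "i \<notin> J"
    by blast
  thus ?thesis
  proof cases
    case 1
    thus ?thesis
      using hecke_act_leg_vec_both[OF ctx 1] by (simp add: diag_coeff_def swap_coeff_def zero)
  next
    case 2
    hence "i \<noteq> 1"
      using J(4) by auto
    thus ?thesis
      using 2 hecke_act_leg_vec_pred[OF ctx 2] leg_swap_eq(1)[OF 2]
      by (simp add: diag_coeff_def swap_coeff_def)
  next
    case 3
    have "card (insert (i - 1) (J - {i})) = card J"
      using 3 J card_Suc_Diff1[of J i] by (simp del: card_Diff_insert)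
    hence "leg_vec Q n l (insert (i - 1) (J - {i})) = 0"
      using J 3 by (intro leg_vec_zero) auto
    thus ?thesis
      using 3 hecke_act_leg_vec_self[OF ctx 3(1,2)]
      by (simp add: diag_coeff_def swap_coeff_def zero fvs.scale_zero_right)
  next
    case 4
    thus ?thesis
      using hecke_act_leg_vec_self[OF ctx 4(1,2)] leg_swap_eq(2)[OF 4(1,2)]
      by (simp add: diag_coeff_def swap_coeff_def)
  next
    case 5
    thus ?thesis
      using hecke_act_leg_vec_neither[OF ctx 5] by (simp add: diag_coeff_def swap_coeff_def zero)
  qed
qed

text \<open>\<open>w\<close> is a word in which the letters \<open>1, 2, \<dots>\<close> occupy the positions in \<open>J\<close> in increasing order.\<close>
definition leg_word :: "nat \<Rightarrow> nat set \<Rightarrow> nat list \<Rightarrow> bool" where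
  "leg_word n J w \<longleftrightarrow> hook_word n (card J) w \<and> (\<forall>b<card J. letter_pos w b = sorted_list_of_set J ! b)"

lemma leg_word_ex:
  assumes "J \<in> legs n l"
  shows "\<exists>w. leg_word n J w"
proof -
  note J = legsD[OF assms]
  define js where "js = sorted_list_of_set J"
  have bij: "bij_betw ((!) js) {0..<l} J"
    unfolding js_def using J(1,2) by (rule bij_betw_sorted_list)
  define f where "f = inv_into {0..<l} ((!) js)"
  have f: "f (js ! b) = b" if "b < l" for b
    using bij that by (simp add: f_def bij_betw_inv_into_left)
  have f': "f k < l" "js ! f k = k" if "k \<in> J" for k
    using bij_betw_inv_into[OF bij] bij_betw_inv_into_right[OF bij that] that
    by (auto simp: f_def bij_betw_def)
  have js: "js ! b \<in> J" if "b < l" for b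
    using bij that by (auto simp: bij_betw_def)
  define w where "w = map (\<lambda>k. if k \<in> J then Suc (f k) else 0) [0..<n]"
  have nth: "w ! k = (if k \<in> J then Suc (f k) else 0)" if "k < n" for k
    using that by (simp add: w_def)
  have js_n: "js ! b < n" if "b < l" for b
    using js[OF that] J(3) by auto
  have hook: "hook_word n l w"
    unfolding hook_word_def
  proof (intro conjI allI impI)
    show "length w = n"
      by (simp add: w_def)
    show "w ! k \<le> l" if "k < n" for k
      using nth[OF that] f'(1)[of k] by auto
    show "\<exists>!k. k < n \<and> w ! k = Suc b" if b: "b < l" for b
    proof (rule ex1I[of _ "js ! b"])
      show "js ! b < n \<and> w ! (js ! b) = Suc b"
        using js[OF b] js_n[OF b] f[OF b] by (simp add: nth)
      show "k = js ! b" if "k < n \<and> w ! k = Suc b" for k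
        using that f'(2)[of k] nth[of k] by (auto split: if_splits)
    qed
  qed
  moreover have "letter_pos w b = js ! b" if "b < l" for b
    by (rule letter_pos_eqI[OF hook that js_n[OF that]]) (use that js js_n f nth in auto)
  ultimately show ?thesis
    using J(2) by (auto simp: leg_word_def js_def)
qed

text \<open>
  Triangularity. Since \<open>u\<^sub>j\<close> vanishes beyond the coordinate \<open>j\<close>, a nonzero term in the expansion of
  the determinant for \<open>v\<^sub>K\<close> at the word of \<open>J\<close> matches the elements of \<open>J\<close> with elements of \<open>K\<close> that
  are at least as large. If the sum of \<open>K\<close> does not exceed that of \<open>J\<close>, all of these inequalities are
  equalities.
\<close>
lemma leg_vec_leg_word:
  assumes J: "J \<in> legs n l" and K: "K \<in> legs n l" and w: "leg_word n J w"
    and le: "\<Sum>K \<le> \<Sum>J"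
  shows "leg_vec Q n l K w = (if K = J then inverse Q ^ ninv (\<lambda>a b. 0 < b \<and> b < a) n (nth w) *
    (\<Prod>j\<in>J. geo_sum Q j) else 0)"
proof -
  define js ks where "js = sorted_list_of_set J" and "ks = sorted_list_of_set K"
  have bij: "bij_betw ((!) js) {0..<l} J" "bij_betw ((!) ks) {0..<l} K"
    unfolding js_def ks_def using legsD[OF J] legsD[OF K] by (auto intro!: bij_betw_sorted_list)
  have hook: "hook_word n l w" and letter_pos: "\<And>b. b < l \<Longrightarrow> letter_pos w b = js ! b"
    using w legsD(2)[OF J] by (auto simp: leg_word_def js_def)
  define summand where "summand p = signof p * (\<Prod>b = 0..<l. refl_vec Q (ks ! p b) (js ! b))" for p
  have det: "fdet l (\<lambda>b a. refl_vec Q (ks ! a) (letter_pos w b)) = (\<Sum>p | p permutes {0..<l}. summand p)"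
    unfolding fdet_leibniz summand_def by (intro sum.cong refl arg_cong2[of _ _ _ _ "(*)"] prod.cong)
      (auto simp: letter_pos)
  have key: "K = J \<and> p = id" if p: "p permutes {0..<l}" and nz: "summand p \<noteq> 0" for p
  proof -
    have "refl_vec Q (ks ! p b) (js ! b) \<noteq> 0" if "b < l" for b
      using nz that unfolding summand_def by auto
    hence ge: "js ! b \<le> ks ! p b" if "b < l" for b
      using that by (force simp: refl_vec_def split: if_splits)
    have sums: "(\<Sum>b = 0..<l. js ! b) = \<Sum>J" "(\<Sum>b = 0..<l. ks ! p b) = \<Sum>K"
      using sum.reindex_bij_betw[OF bij(1), of "\<lambda>x. x"] sum.reindex_bij_betw[OF bij(2), of "\<lambda>x. x"]
        sum.reindex_bij_betw[OF permutes_imp_bij[OF p], of "\<lambda>b. ks ! b"] by simp_all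
    have "(\<Sum>b = 0..<l. js ! b) \<le> (\<Sum>b = 0..<l. ks ! p b)"
      using ge by (intro sum_mono) auto
    hence eq_sum: "(\<Sum>b = 0..<l. js ! b) = (\<Sum>b = 0..<l. ks ! p b)"
      using sums le by simp
    have eq: "js ! b = ks ! p b" if "b < l" for b
      using sum_mono_inv[OF eq_sum, of b] ge that by simp
    have "J = (\<lambda>b. ks ! p b) ` {0..<l}"
      using bij(1) eq by (auto simp: bij_betw_def)
    also have "\<dots> = (!) ks ` p ` {0..<l}"
      by (simp add: image_image)
    also have "\<dots> = K"
      using bij(2) permutes_image[OF p] by (simp add: bij_betw_def)
    finally have "K = J" ..
    moreover have "p b = b" for b
    proof (cases "b < l")
      case True
      hence "p b < l" "js ! b = js ! p b"
        using eq[OF True] permutes_in_image[OF p, of b] \<open>K = J\<close> by (auto simp: js_def ks_def)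
      thus ?thesis
        using bij(1) True by (auto simp: bij_betw_def inj_on_def)
    qed (use permutes_not_in[OF p] in simp)
    ultimately show ?thesis
      by auto
  qed
  show ?thesis
  proof (cases "K = J")
    case True
    have "(\<Sum>p | p permutes {0..<l}. summand p) = (\<Sum>p\<in>{id}. summand p)"
      using key by (intro sum.mono_neutral_right) (auto simp: finite_permutations)
    also have "\<dots> = (\<Prod>b = 0..<l. geo_sum Q (js ! b))"
      using True by (simp add: summand_def refl_vec_def js_def ks_def)
    also have "\<dots> = (\<Prod>j\<in>J. geo_sum Q j)"
      by (rule prod.reindex_bij_betw[OF bij(1)])
    finally show ?thesis
      using True hook det by (simp add: leg_vec_def wedge_def ks_def)
  next
    case False
    hence "(\<Sum>p | p permutes {0..<l}. summand p) = 0"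
      using key by (intro sum.neutral) auto
    thus ?thesis
      using False hook det by (simp add: leg_vec_def wedge_def ks_def)
  qed
qed

lemma sum_fun_apply: "(\<Sum>x\<in>A. g x) w = (\<Sum>x\<in>A. g x w :: complex)"
  by (induction A rule: infinite_finite_induct) auto

lemma leg_vec_independent_family:
  assumes "Q \<noteq> 0" "\<And>j. 1 \<le> j \<Longrightarrow> j < n \<Longrightarrow> geo_sum Q j \<noteq> 0"
    and "(\<Sum>J\<in>legs n l. fscale (c J) (leg_vec Q n l J)) = 0" "K \<in> legs n l"
  shows "c K = 0"
proof (rule ccontr)
  assume "c K \<noteq> 0"
  \<comment> \<open>Evaluation at the word of \<open>J\<close> isolates the coefficient of \<open>v\<^sub>J\<close> if \<open>J\<close> has the largest sum.\<close>
  define S where "S = {J \<in> legs n l. c J \<noteq> 0}"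
  have "finite S" "K \<in> S"
    using assms \<open>c K \<noteq> 0\<close> by (auto simp: S_def)
  hence "Max (Sum ` S) \<in> Sum ` S"
    by (intro Max_in) auto
  then obtain J where J: "J \<in> S" "\<Sum>J = Max (Sum ` S)"
    by (auto simp: image_iff)
  have max: "\<Sum>J' \<le> \<Sum>J" if "J' \<in> S" for J'
    unfolding J(2) using that \<open>finite S\<close> by (intro Max_ge) auto
  have leg: "J \<in> legs n l" and cJ: "c J \<noteq> 0"
    using J(1) by (auto simp: S_def)
  obtain w where w: "leg_word n J w"
    using leg_word_ex[OF leg] by blast
  have "0 = (\<Sum>J'\<in>legs n l. c J' * leg_vec Q n l J' w)"
    using fun_cong[OF assms(3), of w] by (simp add: sum_fun_apply fscale_def)
  also have "\<dots> = (\<Sum>J'\<in>{J}. c J' * leg_vec Q n l J' w)"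
  proof (rule sum.mono_neutral_right)
    show "\<forall>J'\<in>legs n l - {J}. c J' * leg_vec Q n l J' w = 0"
    proof
      fix J' assume J': "J' \<in> legs n l - {J}"
      show "c J' * leg_vec Q n l J' w = 0"
      proof (cases "J' \<in> S")
        case True
        thus ?thesis
          using leg_vec_leg_word[OF leg _ w max[OF True]] J' by simp
      qed (use J' in \<open>simp add: S_def\<close>)
    qed
  qed (use leg in auto)
  also have "\<dots> = c J * (inverse Q ^ ninv (\<lambda>a b. 0 < b \<and> b < a) n (nth w) * (\<Prod>j\<in>J. geo_sum Q j))"
    using leg_vec_leg_word[OF leg leg w] by simp
  finally show False
    using cJ assms(1,2) legsD(1,3)[OF leg] by (auto simp: subset_iff)
qed

lemma inj_on_leg_vec:
  assumes "Q \<noteq> 0" "\<And>j. 1 \<le> j \<Longrightarrow> j < n \<Longrightarrow> geo_sum Q j \<noteq> 0"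
  shows "inj_on (leg_vec Q n l) (legs n l)"
proof (rule inj_onI, rule ccontr)
  fix J K assume JK: "J \<in> legs n l" "K \<in> legs n l" "leg_vec Q n l J = leg_vec Q n l K" "J \<noteq> K"
  define c :: "nat set \<Rightarrow> complex" where "c = (\<lambda>I. if I = J then 1 else if I = K then -1 else 0)"
  have "(\<Sum>I\<in>legs n l. fscale (c I) (leg_vec Q n l I)) = (\<Sum>I\<in>{J, K}. fscale (c I) (leg_vec Q n l I))"
    using JK by (intro sum.mono_neutral_right) (auto simp: c_def fscale_def fun_eq_iff)
  also have "\<dots> = 0"
    using JK by (simp add: c_def fscale_def fun_eq_iff)
  finally have "c J = 0"
    using leg_vec_independent_family[OF assms _ JK(1)] by blast
  thus False
    by (simp add: c_def)
qed

lemma independent_leg_vec: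
  assumes "Q \<noteq> 0" "\<And>j. 1 \<le> j \<Longrightarrow> j < n \<Longrightarrow> geo_sum Q j \<noteq> 0"
  shows "fvs.independent (leg_vec Q n l ` legs n l)"
proof (rule fvs.independent_if_scalars_zero)
  fix f x assume *: "(\<Sum>x\<in>leg_vec Q n l ` legs n l. fscale (f x) x) = 0" "x \<in> leg_vec Q n l ` legs n l"
  have "(\<Sum>J\<in>legs n l. fscale (f (leg_vec Q n l J)) (leg_vec Q n l J)) = 0"
    using *(1) by (simp add: sum.reindex[OF inj_on_leg_vec[OF assms]])
  thus "f x = 0"
    using leg_vec_independent_family[OF assms, where c = "\<lambda>J. f (leg_vec Q n l J)"] *(2) by blast
qed simp

section \<open>The Specht module of a hook\<close>

lemma hecke_act_add: "hecke_act Q i (u + v) = hecke_act Q i u + hecke_act Q i v"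
  by (auto simp: hecke_act_def fun_eq_iff algebra_simps)

lemma hecke_act_scale: "hecke_act Q i (fscale c u) = fscale c (hecke_act Q i u)"
  by (auto simp: hecke_act_def fscale_def fun_eq_iff algebra_simps)

lemma hecke_act_zero: "hecke_act Q i 0 = 0"
  by (auto simp: hecke_act_def fun_eq_iff)

text \<open>The partition \<open>(n - l, 1\<^sup>l)\<close>.\<close>
definition hook :: "nat \<Rightarrow> nat \<Rightarrow> nat list" where
  "hook n l = (n - l) # replicate l 1"

lemma sum_list_hook: "l < n \<Longrightarrow> sum_list (hook n l) = n"
  by (simp add: hook_def sum_list_replicate)

lemma conj_partition_hook:
  assumes "l < n"
  shows "conj_partition (hook n l) = Suc l # replicate (n - l - 1) 1"
proof -
  have "fold max (replicate l (1::nat)) m = m" if "1 \<le> m" for m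
    using that by (induction l) (auto simp: max_def)
  hence m: "fold max ((n - l) # replicate l 1) 0 = n - l"
    using assms by simp
  show ?thesis
    unfolding hook_def conj_partition_def m using assms
    by (intro nth_equalityI) (auto simp: nth_Cons filter_replicate split: nat.split)
qed

lemma column_word_hook:
  assumes "l < n"
  shows "column_word (hook n l) = [0..<Suc l] @ replicate (n - l - 1) 0"
proof -
  have "concat (map (\<lambda>k. [0..<k]) (replicate m 1)) = replicate m 0" for m
    by (induction m) auto
  thus ?thesis
    unfolding column_word_def conj_partition_hook[OF assms] by (simp del: upt_Suc)
qed

lemma nth_column_word_hook:
  assumes "l < n" "k < n"
  shows "column_word (hook n l) ! k = (if k \<le> l then k else 0)"
  using assms by (simp add: column_word_hook nth_append del: upt_Suc)

lemma column_index_hook: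
  assumes "l < n"
  shows "column_index (hook n l) = replicate (Suc l) 0 @ [1..<n - l]"
proof -
  have "[0..<n - l] = 0 # [1..<n - l]"
    using assms by (simp add: upt_conv_Cons)
  moreover have "concat (map (\<lambda>c. replicate ((Suc l # replicate (n - l - 1) 1) ! c) c) [1..<n - l]) =
      concat (map (\<lambda>c. [c]) [1..<n - l])"
    by (intro arg_cong[of _ _ concat] map_cong) (auto simp: nth_Cons split: nat.split)
  moreover have "length (conj_partition (hook n l)) = n - l"
    using assms by (simp add: conj_partition_hook)
  ultimately show ?thesis
    unfolding column_index_def by (simp add: conj_partition_hook[OF assms])
qed

lemma nth_column_index_hook:
  assumes "l < n" "k < n"
  shows "column_index (hook n l) ! k = k - l"
  using assms by (auto simp: column_index_hook nth_append simp del: replicate_Suc)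

lemma column_stabilizer_hook:
  assumes "l < n"
  shows "column_stabilizer (hook n l) = {\<sigma>. \<sigma> permutes {..l}}"
proof (intro equalityI subsetI CollectI)
  fix \<sigma> assume "\<sigma> \<in> column_stabilizer (hook n l)"
  hence p: "\<sigma> permutes {..<n}" and col: "\<And>k. k < n \<Longrightarrow> column_index (hook n l) ! \<sigma> k = column_index (hook n l) ! k"
    by (auto simp: column_stabilizer_def sum_list_hook[OF assms])
  have "\<sigma> k = k" if "k \<in> {..<n} - {..l}" for k
  proof -
    have "\<sigma> k < n"
      using permutes_in_image[OF p, of k] that by simp
    hence "\<sigma> k - l = k - l" "l < k"
      using col[of k] that by (simp_all add: nth_column_index_hook[OF assms])
    thus ?thesis
      by arith
  qed
  thus "\<sigma> permutes {..l}"
    using permutes_superset[OF p] by blast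
next
  fix \<sigma> assume "\<sigma> \<in> {\<sigma>. \<sigma> permutes {..l}}"
  hence p: "\<sigma> permutes {..l}"
    by simp
  have pn: "\<sigma> permutes {..<n}"
    by (rule permutes_subset[OF p]) (use assms in auto)
  moreover have "column_index (hook n l) ! \<sigma> k = column_index (hook n l) ! k" if "k < n" for k
  proof (cases "k \<le> l")
    case True
    thus ?thesis
      using permutes_in_image[OF p, of k] assms that by (simp add: nth_column_index_hook)
  qed (use permutes_not_in[OF p] in simp)
  ultimately show "\<sigma> \<in> column_stabilizer (hook n l)"
    by (simp add: column_stabilizer_def sum_list_hook[OF assms])
qed

lemma coxeter_length_ninv: "coxeter_length n \<sigma> = ninv (>) n \<sigma>"
  by (simp add: coxeter_length_def ninv_def conj_assoc)

lemma initial_in_legs: "l < n \<Longrightarrow> {1..l} \<in> legs n l"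
  by (auto simp: legs_def)

lemma hecke_act_leg_vec_initial:
  assumes "Q \<noteq> 0" "l < n" "\<And>j. 1 \<le> j \<Longrightarrow> j < n \<Longrightarrow> geo_sum Q j \<noteq> 0" "1 \<le> i" "i \<le> l"
  shows "hecke_act Q i (leg_vec Q n l {1..l}) = fscale (-1) (leg_vec Q n l {1..l})"
proof -
  have h: "geo_sum Q 1 = Q"
    using geo_sum_Suc[of Q 0] by simp
  have swp: "swap_coeff Q i {1..l} = 0" and diag: "diag_coeff Q i {1..l} = -1"
    using assms h by (cases "i = 1"; auto simp: swap_coeff_def diag_coeff_def)+
  have "hecke_act Q i (leg_vec Q n l {1..l}) = fscale (diag_coeff Q i {1..l}) (leg_vec Q n l {1..l}) +
      fscale (swap_coeff Q i {1..l}) (leg_vec Q n l (leg_swap i {1..l}))"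
    using assms by (intro hecke_act_leg_vec initial_in_legs) auto
  thus ?thesis
    unfolding swp diag by (simp add: fscale_def fun_eq_iff)
qed

text \<open>
  As \<open>T\<^sub>i\<close> acts by \<open>-1\<close> on \<open>v\<^bsub>{1..l}\<^esub>\<close> for \<open>1 \<le> i \<le> l\<close>, every inversion of the first \<open>l + 1\<close>
  letters contributes a factor \<open>-1/Q\<close> to the value of \<open>v\<^bsub>{1..l}\<^esub>\<close>. The resulting powers are the
  coefficients of the generator of the Specht module.
\<close>
lemma leg_vec_initial_permute:
  assumes "Q \<noteq> 0" "l < n" "\<And>j. 1 \<le> j \<Longrightarrow> j < n \<Longrightarrow> geo_sum Q j \<noteq> 0" "\<sigma> permutes {..l}"
  shows "leg_vec Q n l {1..l} (permute_list \<sigma> (column_word (hook n l))) =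
    inverse (- Q) ^ coxeter_length n \<sigma> * leg_vec Q n l {1..l} (column_word (hook n l))"
  using assms(4)
proof (induction "coxeter_length n \<sigma>" arbitrary: \<sigma> rule: less_induct)
  case less
  define cw where "cw = column_word (hook n l)"
  have len: "length cw = n"
    using assms(2) by (simp add: cw_def column_word_hook)
  have cw: "cw ! k = k" if "k \<le> l" for k
    using that assms(2) by (simp add: cw_def nth_column_word_hook)
  have pn: "\<tau> permutes {..<n}" if "\<tau> permutes {..l}" for \<tau>
    by (rule permutes_subset[OF that]) (use assms(2) in auto)
  show ?case
    unfolding cw_def[symmetric]
  proof (cases "\<exists>i. 1 \<le> i \<and> i \<le> l \<and> \<sigma> i < \<sigma> (i - 1)")
    case True
    then obtain i where i: "1 \<le> i" "i \<le> l" "\<sigma> i < \<sigma> (i - 1)"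
      by blast
    define s where "s = transpose (i - 1) i"
    define \<tau> where "\<tau> = \<sigma> \<circ> s"
    have s: "s permutes {..l}" "s (s k) = k" for k
      using i by (auto simp: s_def intro!: permutes_swap_id)
    have \<tau>: "\<tau> permutes {..l}"
      unfolding \<tau>_def using permutes_compose[OF s(1) less.prems] .
    have c: "coxeter_length n \<sigma> = Suc (coxeter_length n \<tau>)"
      using ninv_adjacent[of i n "(>)" \<sigma>] i assms(2)
      by (simp add: coxeter_length_ninv \<tau>_def s_def)
    define w where "w = permute_list \<tau> cw"
    have w: "w ! k = cw ! \<tau> k" "length w = n" if "k < n" for k
      using permute_list_nth[of \<tau> cw k] pn[OF \<tau>] len that by (simp_all add: w_def)
    have "permute_list \<sigma> cw = swap_letters i w"
    proof (rule nth_equalityI)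
      fix k assume "k < length (permute_list \<sigma> cw)"
      hence k: "k < n"
        by (simp add: len)
      have "s k < n"
        using permutes_in_image[OF pn[OF s(1)], of k] k by simp
      have "permute_list \<sigma> cw ! k = cw ! \<sigma> k"
        using permute_list_nth[of \<sigma> cw k] pn[OF less.prems] k len by simp
      also have "\<dots> = cw ! \<tau> (s k)"
        by (simp add: \<tau>_def s)
      also have "\<dots> = swap_letters i w ! k"
        using nth_swap_letters_transpose[of i w k] w[OF \<open>s k < n\<close>] i assms(2) k by (simp add: s_def)
      finally show "permute_list \<sigma> cw ! k = swap_letters i w ! k" .
    qed (simp add: w_def)
    moreover have "Q * leg_vec Q n l {1..l} (swap_letters i w) = - leg_vec Q n l {1..l} w"
    proof -
      have "\<sigma> i \<le> l" "\<sigma> (i - 1) \<le> l"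
        using permutes_in_image[OF less.prems, of i] permutes_in_image[OF less.prems, of "i - 1"] i
        by auto
      hence "w ! (i - 1) < w ! i"
        using w[of i] w[of "i - 1"] i assms(2) by (simp add: \<tau>_def s_def cw)
      thus ?thesis
        using fun_cong[OF hecke_act_leg_vec_initial[OF assms(1-3) i(1,2)], of w]
        by (simp add: hecke_act_def fscale_def)
    qed
    moreover have "leg_vec Q n l {1..l} w = inverse (- Q) ^ coxeter_length n \<tau> * leg_vec Q n l {1..l} cw"
      using less.hyps[OF _ \<tau>] c by (simp add: w_def cw_def)
    ultimately show "leg_vec Q n l {1..l} (permute_list \<sigma> cw) =
        inverse (- Q) ^ coxeter_length n \<sigma> * leg_vec Q n l {1..l} cw"
      using assms(1) by (simp add: c field_simps)
  next
    case False
    have "\<sigma> i \<ge> i" if "i \<le> l" for i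
      using that
    proof (induction i)
      case (Suc i)
      have "\<sigma> i \<noteq> \<sigma> (Suc i)"
        using inj_eq[OF permutes_inj[OF less.prems], of i "Suc i"] by simp
      moreover have "\<not> \<sigma> (Suc i) < \<sigma> i"
      proof -
        have "\<not> (1 \<le> Suc i \<and> Suc i \<le> l \<and> \<sigma> (Suc i) < \<sigma> (Suc i - 1))"
          using False by blast
        thus ?thesis
          using Suc.prems by simp
      qed
      ultimately show ?case
        using Suc by simp
    qed simp
    hence "\<sigma> = id"
      using permutes_natset_ge[OF less.prems] by auto
    moreover have "coxeter_length n id = 0"
    proof -
      have "{(i, j). i < j \<and> j < n \<and> id i > id j} = {}"
        by auto
      thus ?thesis
        unfolding coxeter_length_def by (simp only: card.empty)
    qed
    ultimately show "leg_vec Q n l {1..l} (permute_list \<sigma> cw) =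
        inverse (- Q) ^ coxeter_length n \<sigma> * leg_vec Q n l {1..l} cw"
      by simp
  qed
qed

lemma leg_word_column_word:
  assumes "l < n"
  shows "leg_word n {1..l} (column_word (hook n l))"
proof -
  define cw where "cw = column_word (hook n l)"
  have nth: "cw ! k = (if k \<le> l then k else 0)" if "k < n" for k
    using nth_column_word_hook[OF assms that] by (simp add: cw_def)
  have hook: "hook_word n l cw"
    unfolding hook_word_def
  proof (intro conjI allI impI)
    show "\<exists>!k. k < n \<and> cw ! k = Suc b" if "b < l" for b
      using that assms nth by (intro ex1I[of _ "Suc b"]) (auto split: if_splits)
  qed (use assms nth in \<open>auto simp: cw_def column_word_hook\<close>)
  have "sorted_list_of_set {1..l} = [1..<Suc l]"
    by (metis atLeastLessThanSuc_atLeastAtMost sorted_list_of_set_range)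
  hence "sorted_list_of_set {1..l} ! b = Suc b" if "b < l" for b
    using that by (simp del: upt_Suc)
  moreover have "letter_pos cw b = Suc b" if "b < l" for b
    using that assms nth by (intro letter_pos_eqI[OF hook]) auto
  ultimately show ?thesis
    using hook by (simp add: leg_word_def cw_def)
qed

text \<open>
  The factors of \<open>v\<^bsub>{1..l}\<^esub>\<close> vanish beyond the coordinate \<open>l\<close>, so the nonzero letters of a word in its
  support occupy \<open>l\<close> of the first \<open>l + 1\<close> positions.
\<close>
lemma leg_vec_initial_support:
  assumes "l < n" "leg_vec Q n l {1..l} w \<noteq> 0"
  shows "\<exists>\<sigma>. \<sigma> permutes {..l} \<and> w = permute_list \<sigma> (column_word (hook n l))"
proof -
  define ks where "ks = sorted_list_of_set {1..l}"
  have hook: "hook_word n l w" and det: "fdet l (\<lambda>b a. refl_vec Q (ks ! a) (letter_pos w b)) \<noteq> 0"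
    using assms(2) by (auto simp: leg_vec_def wedge_def ks_def split: if_splits)
  have len: "length w = n"
    using hook by (simp add: hook_word_def)
  obtain p where p: "p permutes {0..<l}"
    and nz: "(\<Prod>b = 0..<l. refl_vec Q (ks ! p b) (letter_pos w b)) \<noteq> 0"
  proof -
    obtain p where "p \<in> {p. p permutes {0..<l}}"
      "signof p * (\<Prod>b = 0..<l. refl_vec Q (ks ! p b) (letter_pos w b)) \<noteq> 0"
      using det unfolding fdet_leibniz by (rule sum.not_neutral_contains_not_neutral)
    thus ?thesis
      using that by auto
  qed
  have pos_le: "letter_pos w b \<le> l" if "b < l" for b
  proof -
    have "p b < l"
      using permutes_in_image[OF p, of b] that by simp
    hence "ks ! p b \<in> set ks"
      by (intro nth_mem) (simp add: ks_def)
    hence "ks ! p b \<le> l"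
      by (simp add: ks_def)
    moreover have "letter_pos w b \<le> ks ! p b"
      using nz that by (force simp: refl_vec_def split: if_splits)
    ultimately show ?thesis
      by simp
  qed
  have zero: "w ! k = 0" if "k < n" "\<not> k \<le> l" for k
  proof (rule ccontr)
    assume "w ! k \<noteq> 0"
    then obtain b where b: "w ! k = Suc b"
      using not0_implies_Suc by blast
    have "b < l"
      using hook that(1) b by (metis Suc_le_eq hook_word_def)
    thus False
      using letter_pos_eqI[OF hook _ that(1) b] pos_le that(2) by auto
  qed
  have letters: "Suc b \<in> (!) w ` {..l}" if "b < l" for b
    using nth_letter_pos[OF hook that] pos_le[OF that] by (metis atMost_iff imageI)
  have le: "w ! k \<le> l" if "k \<le> l" for k
    using hook that assms(1) by (simp add: hook_word_def)
  have "0 \<in> (!) w ` {..l}"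
  proof (rule ccontr)
    assume "0 \<notin> (!) w ` {..l}"
    hence sub: "(!) w ` {..l} \<subseteq> {1..l}"
      using le by (force simp: Suc_le_eq)
    have "inj_on ((!) w) {..l}"
    proof (rule inj_onI)
      fix k k' assume k: "k \<in> {..l}" "k' \<in> {..l}" "w ! k = w ! k'"
      obtain b where b: "w ! k = Suc b" "b < l"
        using sub k(1) by (cases "w ! k") force+
      thus "k = k'"
        using letter_pos_eqI[OF hook b(2), of k] letter_pos_eqI[OF hook b(2), of k'] k assms(1) by auto
    qed
    hence "card {..l} \<le> card {1..l}"
      using sub card_inj_on_le by blast
    thus False
      by simp
  qed
  hence "{..l} \<subseteq> (!) w ` {..l}"
    using letters by (metis Suc_le_eq atMost_iff not0_implies_Suc subsetI)
  hence img: "(!) w ` {..l} = {..l}"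
    using le by auto
  define \<sigma> where "\<sigma> k = (if k \<le> l then w ! k else k)" for k
  have "bij_betw ((!) w) {..l} {..l}"
    using img by (simp add: bij_betw_def eq_card_imp_inj_on)
  hence "bij_betw \<sigma> {..l} {..l}"
    by (rule bij_betw_cong[THEN iffD1, rotated]) (simp add: \<sigma>_def)
  hence \<sigma>: "\<sigma> permutes {..l}"
    by (rule bij_imp_permutes) (simp add: \<sigma>_def)
  have "w = permute_list \<sigma> (column_word (hook n l))"
  proof (rule nth_equalityI)
    have len': "length (column_word (hook n l)) = n"
      using assms(1) by (simp add: column_word_hook)
    show "length w = length (permute_list \<sigma> (column_word (hook n l)))"
      by (simp add: len len')
    fix k assume "k < length w"
    hence k: "k < n"
      by (simp add: len)
    have "\<sigma> permutes {..<n}"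
      by (rule permutes_subset[OF \<sigma>]) (use assms(1) in auto)
    hence "permute_list \<sigma> (column_word (hook n l)) ! k = column_word (hook n l) ! \<sigma> k"
      using k len' by (intro permute_list_nth) auto
    thus "w ! k = permute_list \<sigma> (column_word (hook n l)) ! k"
      using k le[of k] zero[OF k] assms(1)
      by (cases "k \<le> l") (simp_all add: \<sigma>_def nth_column_word_hook)
  qed
  thus ?thesis
    using \<sigma> by blast
qed

lemma leg_vec_initial_eq_specht_gen:
  assumes "Q \<noteq> 0" "l < n" "\<And>j. 1 \<le> j \<Longrightarrow> j < n \<Longrightarrow> geo_sum Q j \<noteq> 0"
  shows "leg_vec Q n l {1..l} =
    fscale (leg_vec Q n l {1..l} (column_word (hook n l))) (specht_gen Q (hook n l))"
proof
  fix w
  define cw where "cw = column_word (hook n l)"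
  define v where "v = leg_vec Q n l {1..l}"
  have gen: "specht_gen Q (hook n l) w = (\<Sum>\<sigma> | \<sigma> permutes {..l}.
      if w = permute_list \<sigma> cw then inverse (- Q) ^ coxeter_length n \<sigma> else 0)"
    unfolding specht_gen_def column_stabilizer_hook[OF assms(2)] sum_list_hook[OF assms(2)]
      sum_fun_apply cw_def by (intro sum.cong refl) (simp add: fscale_def basis_vec_def)
  have "v w = v cw * specht_gen Q (hook n l) w"
  proof (cases "\<exists>\<sigma>. \<sigma> permutes {..l} \<and> w = permute_list \<sigma> cw")
    case False
    hence "v w = 0"
      using leg_vec_initial_support[OF assms(2)] by (auto simp: v_def cw_def)
    moreover have "specht_gen Q (hook n l) w = 0"
      unfolding gen using False by (intro sum.neutral) auto
    ultimately show ?thesis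
      by simp
  next
    case True
    then obtain \<sigma> where \<sigma>: "\<sigma> permutes {..l}" "w = permute_list \<sigma> cw"
      by blast
    have len: "length cw = n"
      using assms(2) by (simp add: cw_def column_word_hook)
    have nth: "permute_list \<tau> cw ! k = \<tau> k" if "\<tau> permutes {..l}" "k \<le> l" for \<tau> k
    proof -
      have "\<tau> permutes {..<n}"
        by (rule permutes_subset[OF that(1)]) (use assms(2) in auto)
      hence "permute_list \<tau> cw ! k = cw ! \<tau> k"
        using len that assms(2) by (intro permute_list_nth) auto
      moreover have "\<tau> k \<le> l"
        using permutes_in_image[OF that(1), of k] that(2) by simp
      ultimately show ?thesis
        using assms(2) by (simp add: cw_def nth_column_word_hook)
    qed
    have uniq: "\<tau> = \<sigma>" if "\<tau> permutes {..l}" "w = permute_list \<tau> cw" for \<tau>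
    proof
      fix k show "\<tau> k = \<sigma> k"
        using nth[OF that(1), of k] nth[OF \<sigma>(1), of k] that(2) \<sigma>(2)
          permutes_not_in[OF that(1), of k] permutes_not_in[OF \<sigma>(1), of k] by (cases "k \<le> l") auto
    qed
    have "specht_gen Q (hook n l) w = (\<Sum>\<tau>\<in>{\<sigma>}. inverse (- Q) ^ coxeter_length n \<tau>)"
      unfolding gen using uniq \<sigma>
      by (intro sum.mono_neutral_cong_right) (auto simp: finite_permutations)
    thus ?thesis
      using leg_vec_initial_permute[OF assms \<sigma>(1)] by (simp add: \<sigma>(2) v_def cw_def)
  qed
  thus "leg_vec Q n l {1..l} w =
      fscale (leg_vec Q n l {1..l} (column_word (hook n l))) (specht_gen Q (hook n l)) w"
    by (simp add: fscale_def v_def cw_def)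
qed

lemma specht_hook_eq_span:
  assumes "Q \<noteq> 0" "l < n" "\<And>j. 1 \<le> j \<Longrightarrow> j < n \<Longrightarrow> geo_sum Q j \<noteq> 0"
  shows "specht Q (hook n l) = fvs.span (leg_vec Q n l ` legs n l)"
proof
  define v where "v = leg_vec Q n l"
  define c where "c = v {1..l} (column_word (hook n l))"
  have init: "v {1..l} = fscale c (specht_gen Q (hook n l))"
    using leg_vec_initial_eq_specht_gen[OF assms] by (simp add: v_def c_def)
  have c: "c \<noteq> 0"
    using leg_vec_leg_word[OF initial_in_legs initial_in_legs leg_word_column_word, of l n Q] assms
    by (auto simp: c_def v_def)
  have act: "hecke_act Q i (v J) =
      fscale (diag_coeff Q i J) (v J) + fscale (swap_coeff Q i J) (v (leg_swap i J))"
    if "1 \<le> i" "i < n" "J \<in> legs n l" for i J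
    unfolding v_def using assms that by (intro hecke_act_leg_vec) auto
  show "specht Q (hook n l) \<subseteq> fvs.span (leg_vec Q n l ` legs n l)"
    unfolding v_def[symmetric]
  proof (rule specht_minimal)
    have "specht_gen Q (hook n l) = fscale (1 / c) (v {1..l})"
      using c unfolding init by (simp add: fscale_def fun_eq_iff)
    thus "specht_gen Q (hook n l) \<in> fvs.span (v ` legs n l)"
      using initial_in_legs[OF assms(2)] by (simp add: fvs.span_scale fvs.span_base)
  next
    fix i u assume i: "i \<in> {1..<sum_list (hook n l)}" and u: "u \<in> fvs.span (v ` legs n l)"
    have i': "1 \<le> i" "i < n"
      using i by (simp_all add: sum_list_hook[OF assms(2)])
    have basis: "hecke_act Q i (v J) \<in> fvs.span (v ` legs n l)" if J: "J \<in> legs n l" for J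
    proof (cases "i = 1")
      case True
      hence "hecke_act Q i (v J) = fscale (diag_coeff Q i J) (v J)"
        using act[OF i' J] by (simp add: swap_coeff_def fscale_def fun_eq_iff)
      thus ?thesis
        using J by (simp add: fvs.span_scale fvs.span_base)
    next
      case False
      hence "leg_swap i J \<in> legs n l"
        using i' J by (intro leg_swap_in_legs) auto
      thus ?thesis
        unfolding act[OF i' J] using J by (intro fvs.span_add fvs.span_scale fvs.span_base) auto
    qed
    show "hecke_act Q i u \<in> fvs.span (v ` legs n l)"
      using u
    proof (induction rule: fvs.span_induct_alt)
      case base
      show ?case
        unfolding hecke_act_zero by (rule fvs.span_zero)
    next
      case (step a x y)
      thus ?case
        unfolding hecke_act_add hecke_act_scale
        using basis by (intro fvs.span_add fvs.span_scale) auto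
    qed
  qed (rule fvs.subspace_span)
  note sub = subspace_specht[of Q "hook n l"]
  have "v J \<in> specht Q (hook n l)" if "J \<in> legs n l" for J
    using that
  proof (induction rule: legs_induct)
    case initial
    show ?case
      unfolding init by (intro fvs.subspace_scale sub specht_gen_in_specht)
  next
    case (step J i)
    define b where "b = swap_coeff Q i J"
    have "b \<noteq> 0"
      using step assms by (simp add: b_def swap_coeff_def)
    have "v (leg_swap i J) = fscale (1 / b) (hecke_act Q i (v J) - fscale (diag_coeff Q i J) (v J))"
      using step \<open>b \<noteq> 0\<close> act[of i J] by (simp add: b_def fscale_def fun_eq_iff)
    moreover have "hecke_act Q i (v J) \<in> specht Q (hook n l)"
      using step sum_list_hook[OF assms(2)] by (intro hecke_act_in_specht) auto
    ultimately show ?case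
      using step.IH by (simp add: fvs.subspace_scale fvs.subspace_diff sub)
  qed
  thus "fvs.span (leg_vec Q n l ` legs n l) \<subseteq> specht Q (hook n l)"
    by (intro fvs.span_minimal sub) (auto simp: v_def)
qed

section \<open>Hermitian forms and the law of inertia\<close>

text \<open>A space of functions with a Hermitian form, which may be degenerate.\<close>
locale hermitian_space =
  fixes V :: "('w \<Rightarrow> complex) set" and B :: "('w \<Rightarrow> complex) \<Rightarrow> ('w \<Rightarrow> complex) \<Rightarrow> complex"
  assumes subspace: "fvs.subspace V" and hermitian: "hermitian_form V B"
begin

lemma add_left: "u \<in> V \<Longrightarrow> v \<in> V \<Longrightarrow> w \<in> V \<Longrightarrow> B (u + v) w = B u w + B v w"
  and scale_left: "u \<in> V \<Longrightarrow> w \<in> V \<Longrightarrow> B (fscale c u) w = c * B u w"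
  and sym: "u \<in> V \<Longrightarrow> v \<in> V \<Longrightarrow> B v u = cnj (B u v)"
  using hermitian unfolding hermitian_form_def by blast+

lemma add_right: "u \<in> V \<Longrightarrow> v \<in> V \<Longrightarrow> w \<in> V \<Longrightarrow> B w (u + v) = B w u + B w v"
  using sym[of "u + v" w] sym[of u w] sym[of v w] add_left fvs.subspace_add[OF subspace] by simp

lemma scale_right: "u \<in> V \<Longrightarrow> w \<in> V \<Longrightarrow> B w (fscale c u) = cnj c * B w u"
  using sym[of "fscale c u" w] sym[of u w] scale_left fvs.subspace_scale[OF subspace] by simp

lemma zero_left: "w \<in> V \<Longrightarrow> B 0 w = 0"
  using scale_left[of 0 w 0] fvs.subspace_0[OF subspace] by (simp add: fscale_def zero_fun_def)

lemma zero_right: "w \<in> V \<Longrightarrow> B w 0 = 0"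
  using zero_left[of w] sym[of 0 w] fvs.subspace_0[OF subspace] by simp

lemma sum_left:
  assumes "\<And>x. x \<in> S \<Longrightarrow> x \<in> V" "w \<in> V"
  shows "B (\<Sum>x\<in>S. fscale (c x) x) w = (\<Sum>x\<in>S. c x * B x w)"
  using assms
proof (induction S rule: infinite_finite_induct)
  case (insert x S)
  have "(\<Sum>x\<in>S. fscale (c x) x) \<in> V"
    using insert by (intro fvs.subspace_sum fvs.subspace_scale subspace) auto
  moreover have "fscale (c x) x \<in> V"
    using insert by (intro fvs.subspace_scale subspace) auto
  ultimately have "B (\<Sum>y\<in>insert x S. fscale (c y) y) w =
      B (fscale (c x) x) w + B (\<Sum>y\<in>S. fscale (c y) y) w"
    unfolding sum.insert[OF insert.hyps] using insert.prems by (intro add_left) auto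
  also have "\<dots> = c x * B x w + (\<Sum>y\<in>S. c y * B y w)"
    using insert scale_left[of x w "c x"] by simp
  also have "\<dots> = (\<Sum>y\<in>insert x S. c y * B y w)"
    using insert.hyps by simp
  finally show ?case .
qed (simp_all add: zero_left)

lemma norm_real: "u \<in> V \<Longrightarrow> Im (B u u) = 0"
  using sym[of u u] by (metis Reals_cnj_iff complex_is_Real_iff)

lemma norm_orthogonal_sum:
  assumes "finite S" "S \<subseteq> V" "pairwise (\<lambda>x y. B x y = 0) S"
  shows "Re (B (\<Sum>x\<in>S. fscale (c x) x) (\<Sum>x\<in>S. fscale (c x) x)) = (\<Sum>x\<in>S. (cmod (c x))\<^sup>2 * Re (B x x))"
proof -
  define z where "z = (\<Sum>x\<in>S. fscale (c x) x)"
  have z: "z \<in> V"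
    unfolding z_def using assms(2) by (intro fvs.subspace_sum fvs.subspace_scale subspace) auto
  have "B z x = c x * B x x" if "x \<in> S" for x
  proof -
    have "B z x = (\<Sum>y\<in>S. c y * B y x)"
      unfolding z_def using assms(2) that by (intro sum_left) auto
    also have "\<dots> = (\<Sum>y\<in>{x}. c y * B y x)"
      using assms that by (intro sum.mono_neutral_right) (auto simp: pairwise_def)
    finally show ?thesis
      by simp
  qed
  hence *: "B x z = cnj (c x) * B x x" if "x \<in> S" for x
    using sym[of z x] sym[of x x] z assms(2) that by (metis complex_cnj_mult subsetD)
  have "B z z = (\<Sum>x\<in>S. c x * B x z)"
    unfolding z_def[symmetric] using assms(2) z sum_left[of S z c] by (auto simp: z_def)
  also have "\<dots> = (\<Sum>x\<in>S. of_real ((cmod (c x))\<^sup>2) * B x x)"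
    by (intro sum.cong refl) (simp only: * complex_norm_square mult.assoc)
  finally show ?thesis
    unfolding z_def[symmetric] by simp
qed

text \<open>
  Sylvester's law: the vectors of positive norm in \<open>X\<close> and those of nonpositive norm in \<open>Y\<close> are
  together linearly independent, because their spans intersect in \<open>0\<close>.
\<close>
lemma card_positive_le:
  assumes X: "orthogonal_basis V B X" and Y: "orthogonal_basis V B Y"
  shows "card {x \<in> X. Re (B x x) > 0} \<le> card {y \<in> Y. Re (B y y) > 0}"
proof -
  define P where "P = {x \<in> X. Re (B x x) > 0}"
  define N where "N = {y \<in> Y. \<not> Re (B y y) > 0}"
  have fin: "finite P" "finite N" "finite Y"
    using X Y by (auto simp: orthogonal_basis_def P_def N_def)
  have PV: "P \<subseteq> V" and NV: "N \<subseteq> V" and YV: "fvs.span Y = V"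
    using X Y fvs.span_superset by (auto simp: orthogonal_basis_def P_def N_def)
  have pw: "pairwise (\<lambda>x y. B x y = 0) P" "pairwise (\<lambda>x y. B x y = 0) N"
    using X Y by (auto simp: orthogonal_basis_def P_def N_def pairwise_def)
  have disj: "P \<inter> N = {}"
    by (auto simp: P_def N_def)
  have indep: "fvs.independent (P \<union> N)"
  proof (rule fvs.independent_if_scalars_zero)
    fix f x assume sum: "(\<Sum>x\<in>P \<union> N. fscale (f x) x) = 0" and x: "x \<in> P \<union> N"
    define zP zN where "zP = (\<Sum>x\<in>P. fscale (f x) x)" and "zN = (\<Sum>x\<in>N. fscale (f x) x)"
    have "zP + zN = 0"
      using sum by (simp only: zP_def zN_def sum.union_disjoint[OF fin(1,2) disj])
    have zN: "zN = fscale (-1) zP"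
    proof
      fix w show "zN w = fscale (-1) zP w"
        using fun_cong[OF \<open>zP + zN = 0\<close>, of w] by (simp add: fscale_def add_eq_0_iff)
    qed
    have zPV: "zP \<in> V"
      unfolding zP_def using PV by (intro fvs.subspace_sum fvs.subspace_scale subspace) auto
    have "B zN zN = B zP zP"
      unfolding zN using scale_left[OF zPV fvs.subspace_scale[OF subspace zPV], of "-1" "-1"]
        scale_right[OF zPV zPV, of "-1"] by simp
    hence eq: "(\<Sum>x\<in>P. (cmod (f x))\<^sup>2 * Re (B x x)) = (\<Sum>x\<in>N. (cmod (f x))\<^sup>2 * Re (B x x))"
      using norm_orthogonal_sum[OF fin(1) PV pw(1), of f] norm_orthogonal_sum[OF fin(2) NV pw(2), of f]
      by (simp add: zP_def zN_def)
    have "(\<Sum>x\<in>N. (cmod (f x))\<^sup>2 * Re (B x x)) \<le> 0"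
      by (intro sum_nonpos mult_nonneg_nonpos) (auto simp: N_def)
    moreover have nonneg: "0 \<le> (cmod (f x))\<^sup>2 * Re (B x x)" if "x \<in> P" for x
      using that by (simp add: P_def)
    ultimately have "(\<Sum>x\<in>P. (cmod (f x))\<^sup>2 * Re (B x x)) = 0"
      using eq sum_nonneg[of P "\<lambda>x. (cmod (f x))\<^sup>2 * Re (B x x)"] by simp
    hence "\<forall>x\<in>P. (cmod (f x))\<^sup>2 * Re (B x x) = 0"
      using sum_nonneg_eq_0_iff[OF fin(1), of "\<lambda>x. (cmod (f x))\<^sup>2 * Re (B x x)"] nonneg by blast
    hence fP: "f x = 0" if "x \<in> P" for x
      using that by (force simp: P_def)
    hence "zP = 0"
      unfolding zP_def by (intro sum.neutral) (simp add: fscale_def zero_fun_def)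
    hence "zN = 0"
      by (simp only: zN fvs.scale_zero_right)
    hence "f x = 0" if "x \<in> N" for x
      using fvs.independentD[of Y N f x] Y fin(2) that unfolding zN_def N_def
      by (auto simp: orthogonal_basis_def)
    thus "f x = 0"
      using x fP by blast
  qed (use fin in auto)
  have "P \<union> N \<subseteq> fvs.span Y"
    using PV NV YV by simp
  hence "card (P \<union> N) \<le> card Y"
    using fvs.independent_span_bound[OF fin(3) indep] by blast
  moreover have "card (P \<union> N) = card P + card N"
    using fin disj by (intro card_Un_disjoint) auto
  moreover have "card Y = card {y \<in> Y. Re (B y y) > 0} + card N"
  proof -
    have "Y = {y \<in> Y. Re (B y y) > 0} \<union> N"
      by (auto simp: N_def)
    thus ?thesis
      using fin by (metis (no_types, lifting) N_def card_Un_disjoint disjoint_iff finite_Un mem_Collect_eq)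
  qed
  ultimately show ?thesis
    by (simp add: P_def)
qed

lemma scale_form:
  "hermitian_space V (\<lambda>u v. complex_of_real c * B u v)"
proof
  show "hermitian_form V (\<lambda>u v. complex_of_real c * B u v)"
    unfolding hermitian_form_def
  proof (intro conjI ballI allI)
    fix u v w a assume uvw: "u \<in> V" "w \<in> V"
    show "complex_of_real c * B (fscale a u) w = a * (complex_of_real c * B u w)"
      unfolding scale_left[OF uvw] by simp
    show "complex_of_real c * B (u + v) w = complex_of_real c * B u w + complex_of_real c * B v w"
      if "v \<in> V"
      unfolding add_left[OF uvw(1) that uvw(2)] by (rule distrib_left)
    show "complex_of_real c * B w u = cnj (complex_of_real c * B u w)"
      unfolding sym[OF uvw] by simp
  qed
qed (rule subspace)

text \<open>The same law for the form with the opposite sign.\<close>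
lemma card_negative_le:
  assumes "orthogonal_basis V B X" "orthogonal_basis V B Y"
  shows "card {x \<in> X. Re (B x x) < 0} \<le> card {y \<in> Y. Re (B y y) < 0}"
proof -
  interpret neg: hermitian_space V "\<lambda>u v. complex_of_real (-1) * B u v"
    by (rule scale_form)
  have "orthogonal_basis V (\<lambda>u v. complex_of_real (-1) * B u v) X"
    "orthogonal_basis V (\<lambda>u v. complex_of_real (-1) * B u v) Y"
    using assms by (simp_all add: orthogonal_basis_def)
  from neg.card_positive_le[OF this] show ?thesis
    by simp
qed

lemma refined_signature_eq:
  assumes "orthogonal_basis V B X"
  shows "refined_signature V B =
    of_nat (card {x \<in> X. Re (B x x) > 0}) + of_nat (card {x \<in> X. Re (B x x) < 0}) * zz"
  unfolding refined_signature_def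
proof (rule the_equality)
  fix s
  assume "\<exists>Y. orthogonal_basis V B Y \<and>
    s = of_nat (card {x \<in> Y. Re (B x x) > 0}) + of_nat (card {x \<in> Y. Re (B x x) < 0}) * zz"
  then obtain Y where Y: "orthogonal_basis V B Y"
    "s = of_nat (card {x \<in> Y. Re (B x x) > 0}) + of_nat (card {x \<in> Y. Re (B x x) < 0}) * zz"
    by blast
  have "card {x \<in> X. Re (B x x) > 0} = card {x \<in> Y. Re (B x x) > 0}"
    "card {x \<in> X. Re (B x x) < 0} = card {x \<in> Y. Re (B x x) < 0}"
    using card_positive_le card_negative_le assms Y(1) by (auto intro!: antisym)
  thus "s = of_nat (card {x \<in> X. Re (B x x) > 0}) + of_nat (card {x \<in> X. Re (B x x) < 0}) * zz"
    using Y(2) by simp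
qed (use assms in blast)

lemma isometry_on_span:
  assumes "V = fvs.span X"
    and T: "\<And>u. u \<in> V \<Longrightarrow> T u \<in> V" "\<And>u v. T (u + v) = T u + T v" "\<And>c u. T (fscale c u) = fscale c (T u)"
    and basis: "\<And>x y. x \<in> X \<Longrightarrow> y \<in> X \<Longrightarrow> B (T x) (T y) = B x y"
    and "u \<in> V" "v \<in> V"
  shows "B (T u) (T v) = B u v"
proof -
  have T0: "T 0 = 0"
    using T(3)[of 0 0] by (simp add: fscale_def zero_fun_def)
  have XV: "x \<in> V" if "x \<in> X" for x
    using that assms(1) by (simp add: fvs.span_base)
  have one: "u \<in> V \<and> (\<forall>y\<in>X. B (T u) (T y) = B u y)" if "u \<in> V" for u
    using that unfolding assms(1)
  proof (induction rule: fvs.span_induct_alt)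
    case base
    show ?case
    proof (intro conjI ballI)
      show "B (T 0) (T y) = B 0 y" if "y \<in> X" for y
        using zero_left[OF T(1)[OF XV[OF that]]] zero_left[OF XV[OF that]] T0 by simp
    qed (rule fvs.span_zero)
  next
    case (step c x y)
    have x: "x \<in> V" "T x \<in> V" and y: "y \<in> V" "T y \<in> V"
      and IH: "\<And>z. z \<in> X \<Longrightarrow> B (T y) (T z) = B y z"
      using step XV T(1) assms(1) by auto
    note sc = fvs.subspace_scale[OF subspace]
    show ?case
    proof (intro conjI ballI)
      show "fscale c x + y \<in> fvs.span X"
        unfolding assms(1)[symmetric] by (intro fvs.subspace_add subspace sc x y)
      fix z assume z: "z \<in> X"
      note zV = XV[OF z] T(1)[OF XV[OF z]]
      show "B (T (fscale c x + y)) (T z) = B (fscale c x + y) z"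
        unfolding T(2,3) add_left[OF sc[OF x(1)] y(1) zV(1)] add_left[OF sc[OF x(2)] y(2) zV(2)]
          scale_left[OF x(1) zV(1)] scale_left[OF x(2) zV(2)] IH[OF z] basis[OF step(1) z] ..
    qed
  qed
  have "v \<in> V \<and> (\<forall>u\<in>V. B (T u) (T v) = B u v)"
    using assms(7) unfolding assms(1)
  proof (induction rule: fvs.span_induct_alt)
    case base
    show ?case
    proof (intro conjI ballI)
      show "B (T u) (T 0) = B u 0" if "u \<in> fvs.span X" for u
        using zero_right[OF T(1)[of u]] zero_right[of u] T0 that assms(1) by simp
    qed (rule fvs.span_zero)
  next
    case (step c x y)
    have x: "x \<in> V" "T x \<in> V" and y: "y \<in> V" "T y \<in> V"
      and IH: "\<And>z. z \<in> V \<Longrightarrow> B (T z) (T y) = B z y"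
      using step XV T(1) assms(1) by auto
    note sc = fvs.subspace_scale[OF subspace]
    show ?case
    proof (intro conjI ballI)
      show "fscale c x + y \<in> fvs.span X"
        unfolding assms(1)[symmetric] by (intro fvs.subspace_add subspace sc x y)
      fix z assume "z \<in> fvs.span X"
      hence z: "z \<in> V" "T z \<in> V"
        using T(1) assms(1) by auto
      have "B (T z) (T x) = B z x"
        using one[OF z(1)] step(1) by blast
      thus "B (T z) (T (fscale c x + y)) = B z (fscale c x + y)"
        unfolding T(2,3) add_right[OF sc[OF x(1)] y(1) z(1)] add_right[OF sc[OF x(2)] y(2) z(2)]
          scale_right[OF x(1) z(1)] scale_right[OF x(2) z(2)] IH[OF z(1)] by simp
    qed
  qed
  thus ?thesis
    using assms(6) by blast
qed

end

section \<open>Quantum integers and unitarity\<close>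

text \<open>The quantum integer \<open>[[j]]\<close> as a real number.\<close>
definition qreal :: "complex \<Rightarrow> nat \<Rightarrow> real" where
  "qreal q j = Re (qint q (int j))"

text \<open>The norm of \<open>v\<^sub>J\<close> in a suitably normalized invariant form.\<close>
definition leg_weight :: "complex \<Rightarrow> nat set \<Rightarrow> real" where
  "leg_weight q J = (\<Prod>j\<in>J. qreal q j * qreal q (Suc j))"

text \<open>A complex number of absolute value one that is not a root of unity.\<close>
locale generic_unit =
  fixes q :: complex
  assumes norm_q: "norm q = 1" and not_root: "\<And>k::nat. k > 0 \<Longrightarrow> q ^ k \<noteq> 1"
begin

lemma q_nz: "q \<noteq> 0"
  using norm_q by auto

lemma cnj_q: "cnj q = inverse q"
  using complex_norm_square[of q] norm_q by (intro inverse_unique[symmetric]) simp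

lemma diff_inverse_nz: "q - inverse q \<noteq> 0"
proof
  assume "q - inverse q = 0"
  hence "q ^ 2 = 1"
    using q_nz by (simp add: power2_eq_square field_simps)
  thus False
    using not_root[of 2] by simp
qed

lemma qint_nat: "qint q (int j) = (q ^ j - inverse q ^ j) / (q - inverse q)"
  by (simp add: qint_def power_int_minus power_inverse)

lemma of_real_qreal: "complex_of_real (qreal q j) = qint q (int j)"
proof -
  have "cnj (qint q (int j)) = (inverse q ^ j - q ^ j) / (inverse q - q)"
    unfolding qint_nat by (simp add: cnj_q)
  also have "\<dots> = qint q (int j)"
    unfolding qint_nat by (metis minus_diff_eq minus_divide_divide)
  finally show ?thesis
    unfolding qreal_def by (simp add: Reals_cnj_iff)
qed

lemma qreal_0 [simp]: "qreal q 0 = 0"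
  by (simp add: qreal_def qint_def)

lemma qreal_Suc: "q * qreal q (Suc j) = qreal q j + q ^ Suc j"
  unfolding of_real_qreal qint_nat using diff_inverse_nz q_nz
  by (simp add: divide_simps) (simp add: algebra_simps)

lemma qreal_Suc_Suc: "qreal q (Suc (Suc j)) * qreal q j = (qreal q (Suc j))\<^sup>2 - 1"
proof -
  define X Y D where "X = q ^ j" and "Y = inverse q ^ j" and "D = q - inverse q"
  have XY: "X * Y = 1"
    using q_nz by (simp add: X_def Y_def flip: power_mult_distrib)
  have s: "complex_of_real (qreal q j) = (X - Y) / D"
    "complex_of_real (qreal q (Suc j)) = (q * X - inverse q * Y) / D"
    "complex_of_real (qreal q (Suc (Suc j))) = (q * (q * X) - inverse q * (inverse q * Y)) / D"
    unfolding of_real_qreal qint_nat X_def Y_def D_def by simp_all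
  have "(q * (q * X) - inverse q * (inverse q * Y)) * (X - Y) = (q * X - inverse q * Y)\<^sup>2 - D * D"
  proof -
    have "(q * (q * X) - inverse q * (inverse q * Y)) * (X - Y) =
        (q * X - inverse q * Y)\<^sup>2 + 2 * (q * inverse q) * (X * Y) -
        (q * q + inverse q * inverse q) * (X * Y)"
      by (simp add: power2_eq_square algebra_simps)
    moreover have "q * inverse q = 1"
      using q_nz by simp
    ultimately show ?thesis
      unfolding XY D_def by (simp only:) (simp add: algebra_simps q_nz)
  qed
  hence "complex_of_real (qreal q (Suc (Suc j)) * qreal q j) = complex_of_real ((qreal q (Suc j))\<^sup>2 - 1)"
    using diff_inverse_nz unfolding of_real_mult of_real_diff of_real_power s D_def[symmetric]
    by (simp add: power2_eq_square divide_simps)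
  thus ?thesis
    by (simp only: of_real_eq_iff)
qed

lemma qreal_nz:
  assumes "j \<ge> 1"
  shows "qreal q j \<noteq> 0"
proof
  assume "qreal q j = 0"
  hence "q ^ j = inverse q ^ j"
    using of_real_qreal[of j] diff_inverse_nz by (simp add: qint_nat)
  hence "q ^ (j + j) = (q * inverse q) ^ j"
    by (simp add: power_add power_mult_distrib)
  thus False
    using not_root[of "j + j"] assms q_nz by simp
qed

lemma geo_sum_qreal: "geo_sum (q\<^sup>2) j = q ^ Suc j * qreal q j"
proof (induction j)
  case (Suc j)
  have "geo_sum (q\<^sup>2) (Suc j) = q ^ Suc j * (qreal q j + q ^ Suc j)"
    unfolding geo_sum_Suc' Suc by (simp add: distrib_left power2_eq_square power_mult_distrib)
  also have "\<dots> = q ^ Suc (Suc j) * qreal q (Suc j)"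
    unfolding qreal_Suc[symmetric] by simp
  finally show ?case .
qed simp

lemma geo_sum_nz: "j \<ge> 1 \<Longrightarrow> geo_sum (q\<^sup>2) j \<noteq> 0"
  using qreal_nz q_nz by (simp add: geo_sum_qreal)

text \<open>
  The coefficients of \<open>T\<^sub>i v\<^sub>J\<close> in terms of quantum integers: up to factors of absolute value one,
  they are \<open>1/[[i]]\<close> and \<open>[[i-1]]/[[i]]\<close> or \<open>[[i+1]]/[[i]]\<close>.
\<close>
lemma coeff_pred:
  assumes "2 \<le> i" "i - 1 \<in> J" "i \<notin> J"
  shows "diag_coeff (q\<^sup>2) i J = q ^ Suc i / qreal q i"
    and "swap_coeff (q\<^sup>2) i J = q * qreal q (i - 1) / qreal q i"
proof -
  obtain m where m: "i = Suc m"
    using assms by (cases i) auto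
  have nz: "complex_of_real (qreal q (Suc m)) \<noteq> 0"
    using qreal_nz[of "Suc m"] by simp
  have ratio: "geo_sum (q\<^sup>2) m / geo_sum (q\<^sup>2) (Suc m) = qreal q m / (q * qreal q (Suc m))"
    using q_nz nz by (simp add: geo_sum_qreal)
  show "swap_coeff (q\<^sup>2) i J = q * qreal q (i - 1) / qreal q i"
    using assms q_nz ratio by (simp add: swap_coeff_def m power2_eq_square)
  have "1 - qreal q m / (q * qreal q (Suc m)) = (q * qreal q (Suc m) - qreal q m) / (q * qreal q (Suc m))"
    using q_nz nz by (simp add: diff_divide_distrib)
  also have "\<dots> = q ^ Suc m / (q * qreal q (Suc m))"
    unfolding qreal_Suc by simp
  finally show "diag_coeff (q\<^sup>2) i J = q ^ Suc i / qreal q i"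
    using assms q_nz ratio by (simp add: diag_coeff_def m power2_eq_square)
qed

lemma coeff_self:
  assumes "2 \<le> i" "i - 1 \<notin> J" "i \<in> J"
  shows "diag_coeff (q\<^sup>2) i J = - q / (q ^ i * qreal q i)"
    and "swap_coeff (q\<^sup>2) i J = q * qreal q (Suc i) / qreal q i"
proof -
  have nz: "complex_of_real (qreal q i) \<noteq> 0"
    using qreal_nz[of i] assms by simp
  have h: "geo_sum (q\<^sup>2) i = q ^ Suc i * qreal q i"
    by (rule geo_sum_qreal)
  show "diag_coeff (q\<^sup>2) i J = - q / (q ^ i * qreal q i)"
    using assms nz q_nz by (simp add: diag_coeff_def h) (simp add: power2_eq_square)
  have "(q\<^sup>2 * (1 + 1 / geo_sum (q\<^sup>2) i)) * geo_sum (q\<^sup>2) i = geo_sum (q\<^sup>2) (Suc i)"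
    using geo_sum_nz[of i] assms by (simp add: geo_sum_Suc field_simps)
  hence "q\<^sup>2 * (1 + 1 / geo_sum (q\<^sup>2) i) = geo_sum (q\<^sup>2) (Suc i) / geo_sum (q\<^sup>2) i"
    by (rule nonzero_eq_divide_eq[THEN iffD2, rotated]) (use geo_sum_nz[of i] assms in simp)
  also have "\<dots> = q * qreal q (Suc i) / qreal q i"
    unfolding geo_sum_qreal using nz q_nz by simp
  finally show "swap_coeff (q\<^sup>2) i J = q * qreal q (Suc i) / qreal q i"
    using assms by (simp add: swap_coeff_def)
qed

lemma coeff_equal:
  assumes "i - 1 \<in> J \<longleftrightarrow> i \<in> J"
  shows "diag_coeff (q\<^sup>2) i J = (if i \<in> J then - 1 else q\<^sup>2)" "swap_coeff (q\<^sup>2) i J = 0"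
  using assms by (auto simp: diag_coeff_def swap_coeff_def)

lemma coeff_one:
  assumes "0 \<notin> J"
  shows "diag_coeff (q\<^sup>2) 1 J = (if 1 \<in> J then - 1 else q\<^sup>2)" "swap_coeff (q\<^sup>2) 1 J = 0"
  using assms geo_sum_Suc[of "q\<^sup>2" 0] q_nz by (auto simp: diag_coeff_def swap_coeff_def)

lemma leg_weight_nz:
  assumes "J \<in> legs n l"
  shows "leg_weight q J \<noteq> 0"
  using legsD[OF assms] qreal_nz by (auto simp: leg_weight_def subset_iff)

lemma leg_weight_swap:
  assumes "J \<in> legs n l" "2 \<le> i" "i - 1 \<in> J" "i \<notin> J"
  obtains P where "leg_weight q J = P * (qreal q (i - 1) * qreal q i)"
    and "leg_weight q (leg_swap i J) = P * (qreal q i * qreal q (Suc i))"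
proof
  have fin: "finite J"
    using legsD[OF assms(1)] by blast
  show "leg_weight q J = (\<Prod>j\<in>J - {i - 1}. qreal q j * qreal q (Suc j)) * (qreal q (i - 1) * qreal q i)"
    unfolding leg_weight_def using assms fin by (subst prod.remove[of J "i - 1"]) auto
  show "leg_weight q (leg_swap i J) =
      (\<Prod>j\<in>J - {i - 1}. qreal q j * qreal q (Suc j)) * (qreal q i * qreal q (Suc i))"
    unfolding leg_weight_def leg_swap_eq(1)[OF assms(3,4)] using assms fin
    by (subst prod.insert) auto
qed

lemma qreal_neighbours:
  assumes "1 \<le> i"
  shows "qreal q (Suc i) * qreal q (i - 1) = (qreal q i)\<^sup>2 - 1"
  using qreal_Suc_Suc[of "i - 1"] assms by simp

lemma norm_coeff_pred:
  assumes "2 \<le> i" "i - 1 \<in> J" "i \<notin> J"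
  shows "(cmod (diag_coeff (q\<^sup>2) i J))\<^sup>2 = 1 / (qreal q i)\<^sup>2"
    and "(cmod (swap_coeff (q\<^sup>2) i J))\<^sup>2 = (qreal q (i - 1))\<^sup>2 / (qreal q i)\<^sup>2"
  unfolding coeff_pred[OF assms]
  by (simp_all add: norm_divide norm_mult norm_power norm_q power_divide)

lemma norm_coeff_self:
  assumes "2 \<le> i" "i - 1 \<notin> J" "i \<in> J"
  shows "(cmod (diag_coeff (q\<^sup>2) i J))\<^sup>2 = 1 / (qreal q i)\<^sup>2"
    and "(cmod (swap_coeff (q\<^sup>2) i J))\<^sup>2 = (qreal q (Suc i))\<^sup>2 / (qreal q i)\<^sup>2"
  unfolding coeff_self[OF assms]
  by (simp_all add: norm_divide norm_mult norm_power norm_q power_divide)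

text \<open>Absolute value one would force \<open>[[i]]\<^sup>2 = 1\<close>, hence \<open>[[i-1]] [[i+1]] = 0\<close>.\<close>
lemma norm_diag_coeff_ne_1:
  assumes "2 \<le> i" "i - 1 \<in> J \<longleftrightarrow> i \<notin> J"
  shows "cmod (diag_coeff (q\<^sup>2) i J) \<noteq> 1"
proof
  assume 1: "cmod (diag_coeff (q\<^sup>2) i J) = 1"
  have "(cmod (diag_coeff (q\<^sup>2) i J))\<^sup>2 = 1 / (qreal q i)\<^sup>2"
    using norm_coeff_pred(1)[of i J] norm_coeff_self(1)[of i J] assms by blast
  hence "(qreal q i)\<^sup>2 = 1"
    using 1 qreal_nz[of i] assms(1) by simp
  hence "qreal q (Suc i) * qreal q (i - 1) = 0"
    using qreal_neighbours[of i] assms(1) by simp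
  thus False
  proof -
    have "qreal q (i - 1) \<noteq> 0"
      by (rule qreal_nz) (use assms(1) in simp)
    thus ?thesis
      using qreal_nz[of "Suc i"] \<open>qreal q (Suc i) * qreal q (i - 1) = 0\<close> by simp
  qed
qed

text \<open>
  The matrix of \<open>T\<^sub>i\<close> is unitary for the weights: the norm of \<open>T\<^sub>i v\<^sub>J\<close> is the weight of \<open>J\<close>, and
  in \<open>leg_weight_cross\<close> below, \<open>T\<^sub>i v\<^sub>J\<close> is orthogonal to \<open>T\<^sub>i v\<^bsub>s J\<^esub>\<close>.
\<close>
lemma leg_weight_unitary:
  assumes "J \<in> legs n l" "1 \<le> i" "i < n"
  shows "(cmod (diag_coeff (q\<^sup>2) i J))\<^sup>2 * leg_weight q J +
         (cmod (swap_coeff (q\<^sup>2) i J))\<^sup>2 * leg_weight q (leg_swap i J) = leg_weight q J"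
proof -
  have triv: ?thesis
    if "diag_coeff (q\<^sup>2) i J = (if i \<in> J then - 1 else q\<^sup>2)" "swap_coeff (q\<^sup>2) i J = 0"
    using that by (simp add: norm_power norm_q)
  consider "i = 1" | "i \<noteq> 1" "i - 1 \<in> J \<longleftrightarrow> i \<in> J" | "2 \<le> i" "i - 1 \<in> J" "i \<notin> J" | "2 \<le> i" "i - 1 \<notin> J" "i \<in> J"
    using assms by linarith
  thus ?thesis
  proof cases
    case 1
    thus ?thesis
      using coeff_one[OF legsD(4)[OF assms(1)]] by (intro triv) auto
  next
    case 2
    show ?thesis
      by (intro triv coeff_equal 2)
  next
    case 3
    obtain P where P: "leg_weight q J = P * (qreal q (i - 1) * qreal q i)"
      "leg_weight q (leg_swap i J) = P * (qreal q i * qreal q (Suc i))"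
      using leg_weight_swap[OF assms(1) 3] .
    define a b c where "a = qreal q (i - 1)" and "b = qreal q i" and "c = qreal q (Suc i)"
    have b: "b \<noteq> 0" and ac: "c * a = b\<^sup>2 - 1"
      using qreal_nz[of i] qreal_neighbours[of i] assms by (simp_all add: a_def b_def c_def)
    have "1 / b\<^sup>2 * (P * (a * b)) + a\<^sup>2 / b\<^sup>2 * (P * (b * c)) = P * a * (1 + c * a) / b"
      using b by (simp add: field_simps power2_eq_square)
    also have "\<dots> = P * (a * b)"
      unfolding ac using b by (simp add: power2_eq_square)
    finally show ?thesis
      unfolding norm_coeff_pred[OF 3] P a_def b_def c_def .
  next
    case 4
    have J': "leg_swap i J \<in> legs n l" "i - 1 \<in> leg_swap i J" "i \<notin> leg_swap i J"
      using leg_swap_in_legs[OF assms(1) 4(1) assms(3)] 4 leg_swap_mem(1,2)[of i J] by auto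
    obtain P where P: "leg_weight q (leg_swap i J) = P * (qreal q (i - 1) * qreal q i)"
      "leg_weight q J = P * (qreal q i * qreal q (Suc i))"
      using leg_weight_swap[OF J'(1) 4(1) J'(2,3)] unfolding leg_swap_invol .
    define a b c where "a = qreal q (i - 1)" and "b = qreal q i" and "c = qreal q (Suc i)"
    have b: "b \<noteq> 0" and ac: "c * a = b\<^sup>2 - 1"
      using qreal_nz[of i] qreal_neighbours[of i] assms by (simp_all add: a_def b_def c_def)
    have "1 / b\<^sup>2 * (P * (b * c)) + c\<^sup>2 / b\<^sup>2 * (P * (a * b)) = P * c * (1 + c * a) / b"
      using b by (simp add: field_simps power2_eq_square)
    also have "\<dots> = P * (b * c)"
      unfolding ac using b by (simp add: power2_eq_square)
    finally show ?thesis
      unfolding norm_coeff_self[OF 4] P a_def b_def c_def .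
  qed
qed

lemma leg_weight_cross_pred:
  assumes "J \<in> legs n l" "2 \<le> i" "i < n" "i - 1 \<in> J" "i \<notin> J"
  shows "diag_coeff (q\<^sup>2) i J * cnj (swap_coeff (q\<^sup>2) i (leg_swap i J)) * leg_weight q J +
         swap_coeff (q\<^sup>2) i J * cnj (diag_coeff (q\<^sup>2) i (leg_swap i J)) * leg_weight q (leg_swap i J) = 0"
proof -
  have J': "i - 1 \<notin> leg_swap i J" "i \<in> leg_swap i J"
    using leg_swap_mem(1,2)[of i J] assms by auto
  obtain P where P: "leg_weight q J = P * (qreal q (i - 1) * qreal q i)"
    "leg_weight q (leg_swap i J) = P * (qreal q i * qreal q (Suc i))"
    using leg_weight_swap[OF assms(1,2,4,5)] .
  define a b c where "a = complex_of_real (qreal q (i - 1))" and "b = complex_of_real (qreal q i)"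
    and "c = complex_of_real (qreal q (Suc i))"
  have b: "b \<noteq> 0"
    using qreal_nz[of i] assms by (simp add: b_def)
  have "q ^ Suc i / b * (inverse q * c / b) * (P * (a * b)) +
      q * a / b * (- inverse q / (inverse q ^ i * b)) * (P * (b * c)) = 0"
    using b q_nz by (simp add: divide_simps)
  thus ?thesis
    unfolding coeff_pred[OF assms(2,4,5)] coeff_self[OF assms(2) J'] P a_def b_def c_def
    by (simp add: cnj_q)
qed

lemma leg_weight_cross:
  assumes "J \<in> legs n l" "2 \<le> i" "i < n" "leg_swap i J \<noteq> J"
  shows "diag_coeff (q\<^sup>2) i J * cnj (swap_coeff (q\<^sup>2) i (leg_swap i J)) * leg_weight q J +
         swap_coeff (q\<^sup>2) i J * cnj (diag_coeff (q\<^sup>2) i (leg_swap i J)) * leg_weight q (leg_swap i J) = 0"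
proof (cases "i - 1 \<in> J")
  case True
  hence "i \<notin> J"
    using leg_swap_eq(3)[of i J] assms(4) by blast
  thus ?thesis
    using leg_weight_cross_pred[OF assms(1-3) True] by blast
next
  case False
  hence "i \<in> J"
    using leg_swap_eq(3)[of i J] assms(4) by blast
  hence "i - 1 \<in> leg_swap i J" "i \<notin> leg_swap i J"
    using False leg_swap_mem(1,2)[of i J] by auto
  from arg_cong[OF leg_weight_cross_pred[OF leg_swap_in_legs[OF assms(1-3)] assms(2,3) this], of cnj]
  show ?thesis
    unfolding leg_swap_invol by (simp add: algebra_simps)
qed

end

section \<open>Existence of the invariant form\<close>

context generic_unit
begin

lemma specht_span:
  assumes "l < n"
  shows "specht (q\<^sup>2) (hook n l) = fvs.span (leg_vec (q\<^sup>2) n l ` legs n l)"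
  using assms q_nz geo_sum_nz by (intro specht_hook_eq_span) auto

lemma independent_leg_vecs: "fvs.independent (leg_vec (q\<^sup>2) n l ` legs n l)"
  using q_nz geo_sum_nz by (intro independent_leg_vec) auto

lemma inj_leg_vecs: "inj_on (leg_vec (q\<^sup>2) n l) (legs n l)"
  using q_nz geo_sum_nz by (intro inj_on_leg_vec) auto

lemma hecke_act_generic_leg_vec:
  assumes "J \<in> legs n l" "1 \<le> i" "i < n"
  shows "hecke_act (q\<^sup>2) i (leg_vec (q\<^sup>2) n l J) =
    fscale (diag_coeff (q\<^sup>2) i J) (leg_vec (q\<^sup>2) n l J) +
    fscale (swap_coeff (q\<^sup>2) i J) (leg_vec (q\<^sup>2) n l (leg_swap i J))"
  using assms q_nz geo_sum_nz[of i] by (intro hecke_act_leg_vec) auto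

text \<open>The form in which the \<open>v\<^sub>J\<close> are orthogonal and \<open>v\<^sub>J\<close> has norm \<open>leg_weight q J\<close>.\<close>
definition seminormal_form :: "nat \<Rightarrow> nat \<Rightarrow> (nat list \<Rightarrow> complex) \<Rightarrow> (nat list \<Rightarrow> complex) \<Rightarrow> complex" where
  "seminormal_form n l u v = (\<Sum>J\<in>legs n l. leg_weight q J *
     (fvs.representation (leg_vec (q\<^sup>2) n l ` legs n l) u (leg_vec (q\<^sup>2) n l J) *
      cnj (fvs.representation (leg_vec (q\<^sup>2) n l ` legs n l) v (leg_vec (q\<^sup>2) n l J))))"

lemma representation_leg_vec:
  assumes "J \<in> legs n l" "K \<in> legs n l"
  shows "fvs.representation (leg_vec (q\<^sup>2) n l ` legs n l) (leg_vec (q\<^sup>2) n l J) (leg_vec (q\<^sup>2) n l K) =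
    (if J = K then 1 else 0)"
proof -
  have "leg_vec (q\<^sup>2) n l K = leg_vec (q\<^sup>2) n l J \<longleftrightarrow> J = K"
    using inj_onD[OF inj_leg_vecs] assms by blast
  thus ?thesis
    using fvs.representation_basis[OF independent_leg_vecs, of "leg_vec (q\<^sup>2) n l J" n l] assms by simp
qed

lemma seminormal_form_right:
  assumes "K \<in> legs n l"
  shows "seminormal_form n l u (leg_vec (q\<^sup>2) n l K) =
    leg_weight q K * fvs.representation (leg_vec (q\<^sup>2) n l ` legs n l) u (leg_vec (q\<^sup>2) n l K)"
proof -
  have "seminormal_form n l u (leg_vec (q\<^sup>2) n l K) = (\<Sum>J\<in>{K}. leg_weight q J *
     (fvs.representation (leg_vec (q\<^sup>2) n l ` legs n l) u (leg_vec (q\<^sup>2) n l J) *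
      cnj (fvs.representation (leg_vec (q\<^sup>2) n l ` legs n l) (leg_vec (q\<^sup>2) n l K) (leg_vec (q\<^sup>2) n l J))))"
    unfolding seminormal_form_def using assms
    by (intro sum.mono_neutral_right) (auto simp: representation_leg_vec)
  thus ?thesis
    using assms by (simp add: representation_leg_vec)
qed

lemma seminormal_form_leg_vec:
  assumes "J \<in> legs n l" "K \<in> legs n l"
  shows "seminormal_form n l (leg_vec (q\<^sup>2) n l J) (leg_vec (q\<^sup>2) n l K) = (if J = K then leg_weight q K else 0)"
  unfolding seminormal_form_right[OF assms(2)] using assms by (simp add: representation_leg_vec)

lemma hermitian_seminormal_form:
  assumes "l < n"
  shows "hermitian_space (specht (q\<^sup>2) (hook n l)) (seminormal_form n l)"
proof
  show "hermitian_form (specht (q\<^sup>2) (hook n l)) (seminormal_form n l)"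
    unfolding hermitian_form_def specht_span[OF assms]
  proof (intro conjI ballI allI)
    fix u v w c assume u: "u \<in> fvs.span (leg_vec (q\<^sup>2) n l ` legs n l)"
    show "seminormal_form n l (u + v) w = seminormal_form n l u w + seminormal_form n l v w"
      if "v \<in> fvs.span (leg_vec (q\<^sup>2) n l ` legs n l)"
      unfolding seminormal_form_def fvs.representation_add[OF independent_leg_vecs that u]
      by (simp add: sum.distrib distrib_left distrib_right)
    show "seminormal_form n l (fscale c u) w = c * seminormal_form n l u w"
      unfolding seminormal_form_def fvs.representation_scale[OF independent_leg_vecs u]
      by (simp add: sum_distrib_left mult_ac)
    show "seminormal_form n l v u = cnj (seminormal_form n l u v)"
      unfolding seminormal_form_def by (simp add: mult_ac)
  qed
qed (rule subspace_specht)

lemma leg_vec_in_specht: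
  assumes "l < n" "J \<in> legs n l"
  shows "leg_vec (q\<^sup>2) n l J \<in> specht (q\<^sup>2) (hook n l)"
  unfolding specht_span[OF assms(1)] using assms(2) by (intro fvs.span_base) auto

lemma nondegenerate_seminormal_form:
  assumes "l < n"
  shows "nondegenerate_form (specht (q\<^sup>2) (hook n l)) (seminormal_form n l)"
  unfolding nondegenerate_form_def
proof (intro ballI impI)
  fix u assume u: "u \<in> specht (q\<^sup>2) (hook n l)" "\<forall>v\<in>specht (q\<^sup>2) (hook n l). seminormal_form n l u v = 0"
  define R where "R = fvs.representation (leg_vec (q\<^sup>2) n l ` legs n l) u"
  have "R (leg_vec (q\<^sup>2) n l J) = 0" if "J \<in> legs n l" for J
    using u(2) leg_vec_in_specht[OF assms that] seminormal_form_right[OF that, of u] leg_weight_nz[OF that]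
    by (auto simp: R_def)
  hence "(\<Sum>b\<in>leg_vec (q\<^sup>2) n l ` legs n l. fscale (R b) b) = 0"
    by (intro sum.neutral) (auto simp: fscale_def zero_fun_def)
  moreover have "(\<Sum>b\<in>leg_vec (q\<^sup>2) n l ` legs n l. fscale (R b) b) = u"
    unfolding R_def using u(1) specht_span[OF assms] by (intro fvs.sum_representation_eq independent_leg_vecs) auto
  ultimately show "u = 0"
    by simp
qed

lemma seminormal_form_act_leg_vec:
  assumes "l < n" "J \<in> legs n l" "K \<in> legs n l" "1 \<le> i" "i < n"
  shows "seminormal_form n l (hecke_act (q\<^sup>2) i (leg_vec (q\<^sup>2) n l J)) (hecke_act (q\<^sup>2) i (leg_vec (q\<^sup>2) n l K)) =
    seminormal_form n l (leg_vec (q\<^sup>2) n l J) (leg_vec (q\<^sup>2) n l K)"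
proof -
  define v where "v = leg_vec (q\<^sup>2) n l"
  define B where "B = seminormal_form n l"
  define d where "d = diag_coeff (q\<^sup>2) i"
  define e where "e = swap_coeff (q\<^sup>2) i"
  define s where "s = leg_swap i"
  interpret B: hermitian_space "specht (q\<^sup>2) (hook n l)" B
    unfolding B_def using assms(1) by (rule hermitian_seminormal_form)
  have T: "hecke_act (q\<^sup>2) i (v J) = fscale (d J) (v J) + fscale (e J) (v (s J))" if "J \<in> legs n l" for J
    unfolding v_def d_def e_def s_def using hecke_act_generic_leg_vec[OF that assms(4,5)] .
  have B: "B (v J) (v K) = (if J = K then leg_weight q K else 0)" if "J \<in> legs n l" "K \<in> legs n l" for J K
    unfolding B_def v_def using that by (rule seminormal_form_leg_vec)
  have V: "v J \<in> specht (q\<^sup>2) (hook n l)" if "J \<in> legs n l" for J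
    unfolding v_def using assms(1) that by (rule leg_vec_in_specht)
  note sc = fvs.subspace_scale[OF subspace_specht]
  have unit: "d J * cnj (d J) * leg_weight q J + e J * cnj (e J) * leg_weight q (s J) = leg_weight q J"
    if "J \<in> legs n l" for J
    using leg_weight_unitary[OF that assms(4,5)] unfolding d_def[symmetric] e_def[symmetric] s_def[symmetric]
    unfolding complex_norm_square[symmetric] by (metis of_real_add of_real_mult)
  have "B (hecke_act (q\<^sup>2) i (v J)) (hecke_act (q\<^sup>2) i (v K)) = B (v J) (v K)"
  proof (cases "i = 1")
    case True
    hence e0: "e J = 0" for J
      by (simp add: e_def swap_coeff_def)
    hence T': "hecke_act (q\<^sup>2) i (v J) = fscale (d J) (v J)" if "J \<in> legs n l" for J
      unfolding T[OF that] e0 by (simp add: fscale_def fun_eq_iff)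
    have "B (hecke_act (q\<^sup>2) i (v J)) (hecke_act (q\<^sup>2) i (v K)) = d J * (cnj (d K) * B (v J) (v K))"
      unfolding T'[OF assms(2)] T'[OF assms(3)] B.scale_left[OF V[OF assms(2)] sc[OF V[OF assms(3)]]]
        B.scale_right[OF V[OF assms(3)] V[OF assms(2)]] ..
    also have "\<dots> = B (v J) (v K)"
      unfolding B[OF assms(2,3)] using unit[OF assms(3)] e0 by (cases "J = K") simp_all
    finally show ?thesis .
  next
    case False
    hence i: "2 \<le> i"
      using assms(4) by simp
    have s: "s J \<in> legs n l" if "J \<in> legs n l" for J
      unfolding s_def using leg_swap_in_legs[OF that i assms(5)] .
    note J = V[OF assms(2)] V[OF s[OF assms(2)]] and K = V[OF assms(3)] V[OF s[OF assms(3)]]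
    have "B (hecke_act (q\<^sup>2) i (v J)) (hecke_act (q\<^sup>2) i (v K)) =
        d J * (cnj (d K) * B (v J) (v K) + cnj (e K) * B (v J) (v (s K))) +
        e J * (cnj (d K) * B (v (s J)) (v K) + cnj (e K) * B (v (s J)) (v (s K)))"
    proof -
      have right: "B u (fscale (d K) (v K) + fscale (e K) (v (s K))) =
          cnj (d K) * B u (v K) + cnj (e K) * B u (v (s K))" if "u \<in> specht (q\<^sup>2) (hook n l)" for u
        unfolding B.add_right[OF sc[OF K(1)] sc[OF K(2)] that] B.scale_right[OF K(1) that]
          B.scale_right[OF K(2) that] ..
      have w: "fscale (d K) (v K) + fscale (e K) (v (s K)) \<in> specht (q\<^sup>2) (hook n l)"
        by (intro fvs.subspace_add subspace_specht sc K)
      show ?thesis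
        unfolding T[OF assms(2)] T[OF assms(3)] B.add_left[OF sc[OF J(1)] sc[OF J(2)] w]
          B.scale_left[OF J(1) w] B.scale_left[OF J(2) w] right[OF J(1)] right[OF J(2)] ..
    qed
    also have "\<dots> = B (v J) (v K)"
    proof -
      have ss: "s (s J) = J" for J
        by (simp add: s_def leg_swap_invol)
      hence sJK: "s J = s K \<longleftrightarrow> J = K" "s J = K \<longleftrightarrow> J = s K"
        by metis+
      have e0: "e J = 0" if "s J = J" for J
      proof -
        have "i - 1 \<in> J \<longleftrightarrow> i \<in> J"
          using leg_swap_mem(1)[of i J] that by (simp add: s_def)
        thus ?thesis
          unfolding e_def by (rule coeff_equal(2))
      qed
      consider "J = K" | "J \<noteq> K" "J = s K" | "J \<noteq> K" "J \<noteq> s K"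
        by blast
      thus ?thesis
      proof cases
        case 1
        show ?thesis
        proof (cases "e K = 0")
          case True
          thus ?thesis
            using unit[OF assms(3)] B[OF assms(3) assms(3)] by (simp add: 1 algebra_simps)
        next
          case False
          hence "s K \<noteq> K"
            using e0 by blast
          hence "B (v K) (v (s K)) = 0" "B (v (s K)) (v K) = 0"
            using B[OF assms(3) s[OF assms(3)]] B[OF s[OF assms(3)] assms(3)] by auto
          thus ?thesis
            using unit[OF assms(3)] B[OF assms(3) assms(3)] B[OF s[OF assms(3)] s[OF assms(3)]]
            by (simp add: 1 algebra_simps)
        qed
      next
        case 2
        hence sJ: "s J = K" "s J \<noteq> J"
          using ss by auto
        have "d J * cnj (e K) * leg_weight q J + e J * cnj (d K) * leg_weight q K = 0"
          using leg_weight_cross[OF assms(2) i assms(5)] sJ unfolding d_def e_def s_def by simp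
        thus ?thesis
          using 2 sJ ss B[OF assms(2,3)] B[OF assms(2) s[OF assms(3)]] B[OF s[OF assms(2)] assms(3)]
            B[OF s[OF assms(2)] s[OF assms(3)]] by (simp add: algebra_simps)
      next
        case 3
        thus ?thesis
          using sJK B[OF assms(2,3)] B[OF assms(2) s[OF assms(3)]] B[OF s[OF assms(2)] assms(3)]
            B[OF s[OF assms(2)] s[OF assms(3)]] by simp
      qed
    qed
    finally show ?thesis .
  qed
  thus ?thesis
    unfolding B_def v_def .
qed

lemma invariant_seminormal_form:
  assumes "l < n"
  shows "invariant_form n (specht (q\<^sup>2) (hook n l)) (hecke_act (q\<^sup>2)) (seminormal_form n l)"
  unfolding invariant_form_def
proof (intro conjI ballI)
  interpret B: hermitian_space "specht (q\<^sup>2) (hook n l)" "seminormal_form n l"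
    using assms by (rule hermitian_seminormal_form)
  show "hermitian_form (specht (q\<^sup>2) (hook n l)) (seminormal_form n l)"
    by (rule B.hermitian)
  show "nondegenerate_form (specht (q\<^sup>2) (hook n l)) (seminormal_form n l)"
    using assms by (rule nondegenerate_seminormal_form)
  fix i u v assume i: "i \<in> {1..<n}"
    and uv: "u \<in> specht (q\<^sup>2) (hook n l)" "v \<in> specht (q\<^sup>2) (hook n l)"
  show "seminormal_form n l (hecke_act (q\<^sup>2) i u) (hecke_act (q\<^sup>2) i v) = seminormal_form n l u v"
  proof (rule B.isometry_on_span[OF specht_span[OF assms]])
    show "hecke_act (q\<^sup>2) i u \<in> specht (q\<^sup>2) (hook n l)" if "u \<in> specht (q\<^sup>2) (hook n l)" for u
      using that i sum_list_hook[OF assms] by (intro hecke_act_in_specht) auto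
  next
    fix x y assume "x \<in> leg_vec (q\<^sup>2) n l ` legs n l" "y \<in> leg_vec (q\<^sup>2) n l ` legs n l"
    then obtain J K where "J \<in> legs n l" "x = leg_vec (q\<^sup>2) n l J" "K \<in> legs n l" "y = leg_vec (q\<^sup>2) n l K"
      by blast
    thus "seminormal_form n l (hecke_act (q\<^sup>2) i x) (hecke_act (q\<^sup>2) i y) = seminormal_form n l x y"
      using seminormal_form_act_leg_vec[OF assms, of J K i] i by simp
  qed (rule hecke_act_add hecke_act_scale uv)+
qed

end

section \<open>Signs of real numbers\<close>

text \<open>The contribution of a vector of norm \<open>x \<noteq> 0\<close> to the refined signature.\<close>
definition sign_elt :: "real \<Rightarrow> sgn_ring" where
  "sign_elt x = (if x > 0 then 1 else zz)"

lemma zz_square: "zz * zz = 1"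
  by transfer (simp add: one_pCons)

lemma sign_elt_mult:
  assumes "x \<noteq> 0" "y \<noteq> 0"
  shows "sign_elt (x * y) = sign_elt x * sign_elt y"
  using assms by (auto simp: sign_elt_def zz_square zero_less_mult_iff)

lemma sign_elt_prod:
  assumes "\<And>j. j \<in> J \<Longrightarrow> f j \<noteq> 0"
  shows "sign_elt (\<Prod>j\<in>J. f j) = (\<Prod>j\<in>J. sign_elt (f j))"
  using assms
proof (induction J rule: infinite_finite_induct)
  case (insert j J)
  hence "sign_elt (f j * prod f J) = sign_elt (f j) * sign_elt (prod f J)"
    by (intro sign_elt_mult) auto
  thus ?case
    using insert by simp
qed (simp_all add: sign_elt_def)

lemma sum_sign_elt:
  assumes "finite X" "\<And>x. x \<in> X \<Longrightarrow> f x \<noteq> 0"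
  shows "of_nat (card {x \<in> X. f x > 0}) + of_nat (card {x \<in> X. f x < 0}) * zz = (\<Sum>x\<in>X. sign_elt (f x))"
proof -
  have "(\<Sum>x\<in>X. sign_elt (f x)) = (\<Sum>x\<in>{x \<in> X. f x > 0}. 1) + (\<Sum>x\<in>{x \<in> X. f x < 0}. zz)"
  proof -
    have "X = {x \<in> X. f x > 0} \<union> {x \<in> X. f x < 0}"
      using assms(2) by (auto simp: neq_iff)
    hence "(\<Sum>x\<in>X. sign_elt (f x)) = (\<Sum>x\<in>{x \<in> X. f x > 0} \<union> {x \<in> X. f x < 0}. sign_elt (f x))"
      by simp
    also have "\<dots> = (\<Sum>x\<in>{x \<in> X. f x > 0}. sign_elt (f x)) + (\<Sum>x\<in>{x \<in> X. f x < 0}. sign_elt (f x))"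
      using assms(1) by (intro sum.union_disjoint) auto
    finally show ?thesis
      by (simp add: sign_elt_def)
  qed
  thus ?thesis
    by simp
qed

section \<open>Norms in an arbitrary invariant form\<close>

text \<open>An arbitrary invariant form on the Specht module of a hook.\<close>
locale invariant_hook_form = generic_unit +
  fixes n l :: nat and B :: "(nat list \<Rightarrow> complex) \<Rightarrow> (nat list \<Rightarrow> complex) \<Rightarrow> complex"
  assumes l_less: "l < n"
    and invariant: "invariant_form n (specht (q\<^sup>2) (hook n l)) (hecke_act (q\<^sup>2)) B"
begin

sublocale hermitian_space "specht (q\<^sup>2) (hook n l)" B
  using invariant by unfold_locales (auto simp: invariant_form_def subspace_specht)

abbreviation v :: "nat set \<Rightarrow> nat list \<Rightarrow> complex" where
  "v \<equiv> leg_vec (q\<^sup>2) n l"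

lemma v_in: "J \<in> legs n l \<Longrightarrow> v J \<in> specht (q\<^sup>2) (hook n l)"
  using l_less by (rule leg_vec_in_specht)

lemma form_act:
  assumes "J \<in> legs n l" "K \<in> legs n l" "1 \<le> i" "i < n"
  shows "B (hecke_act (q\<^sup>2) i (v J)) (hecke_act (q\<^sup>2) i (v K)) = B (v J) (v K)"
  using invariant v_in[OF assms(1)] v_in[OF assms(2)] assms(3,4) by (simp add: invariant_form_def)

text \<open>
  Induction on the smallest element \<open>m\<close> in which \<open>J\<close> and \<open>K\<close> differ. Apply \<open>T\<^sub>m\<close> to both vectors.
  If \<open>m > 1\<close>, then \<open>m - 1\<close> lies in both sets or in neither. One of the two vectors is an eigenvector,
  with eigenvalue \<open>-1\<close> or \<open>Q\<close>, and exchanging \<open>m - 1\<close> and \<open>m\<close> in the other set leads to a pair that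
  differs already in \<open>m - 1\<close>. So invariance multiplies the product of \<open>v\<^sub>J\<close> and \<open>v\<^sub>K\<close> by a number of
  absolute value different from one. If \<open>m = 1\<close>, both vectors are eigenvectors, with the distinct
  eigenvalues \<open>-1\<close> and \<open>Q\<close> of absolute value one.
\<close>
lemma orthogonal_first_difference:
  assumes "J \<in> legs n l" "K \<in> legs n l" "m \<in> J" "m \<notin> K" "\<And>k. k < m \<Longrightarrow> k \<in> J \<longleftrightarrow> k \<in> K"
  shows "B (v J) (v K) = 0"
  using assms
proof (induction m arbitrary: J K)
  case 0
  thus ?case
    using legsD(4) by blast
next
  case (Suc m)
  define i where "i = Suc m"
  have i: "1 \<le> i" "i < n" "i - 1 = m" "i \<in> J" "i \<notin> K"
    using Suc.prems(3,4) legsD(3)[OF Suc.prems(1)] by (auto simp: i_def)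
  note VJ = v_in[OF Suc.prems(1)] and VK = v_in[OF Suc.prems(2)]
  note sc = fvs.subspace_scale[OF subspace]
  define d where "d = diag_coeff (q\<^sup>2) i"
  define e where "e = swap_coeff (q\<^sup>2) i"
  have simple: "hecke_act (q\<^sup>2) i (v J) = fscale (d J) (v J)" if "J \<in> legs n l" "e J = 0" for J
    using hecke_act_generic_leg_vec[OF that(1) i(1,2)] that(2) unfolding d_def e_def by (simp add: fscale_def fun_eq_iff)
  have final: "B (v J) (v K) = 0" if "a * B (v J) (v K) = B (v J) (v K)" "a \<noteq> 1" for a
    using that by simp
  show ?case
  proof (cases "m = 0")
    case True
    hence "i = 1"
      by (simp add: i_def)
    hence J: "d J = -1" "e J = 0" and K: "d K = q\<^sup>2" "e K = 0"
      unfolding d_def e_def using i coeff_one[OF legsD(4)[OF Suc.prems(1)]]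
        coeff_one[OF legsD(4)[OF Suc.prems(2)]] by simp_all
    have "(- cnj (q\<^sup>2)) * B (v J) (v K) = B (v J) (v K)"
      using form_act[OF Suc.prems(1,2) i(1,2)]
      unfolding simple[OF Suc.prems(1) J(2)] simple[OF Suc.prems(2) K(2)]
        scale_left[OF VJ sc[OF VK]] scale_right[OF VK VJ] J K by simp
    moreover have "- cnj (q\<^sup>2) \<noteq> 1"
    proof
      assume *: "- cnj (q\<^sup>2) = 1"
      have "cnj (- (q\<^sup>2)) = cnj 1"
        using * by simp
      hence "q\<^sup>2 = -1"
        by (metis complex_cnj_cancel_iff minus_equation_iff)
      hence "q ^ 4 = 1"
        using power_mult[of q 2 2] by simp
      thus False
        using not_root[of 4] by simp
    qed
    ultimately show ?thesis
      by (rule final)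
  next
    case False
    hence i2: "2 \<le> i"
      by (simp add: i_def)
    show ?thesis
    proof (cases "m \<in> J")
      case True
      hence mK: "m \<in> K"
        using Suc.prems(5)[of m] by simp
      have J: "d J = -1" "e J = 0"
        unfolding d_def e_def using coeff_equal[of i J] True i by simp_all
      define K' where "K' = leg_swap i K"
      have K': "K' \<in> legs n l"
        unfolding K'_def using leg_swap_in_legs[OF Suc.prems(2) i2 i(2)] .
      have "B (v J) (v K') = 0"
      proof (rule Suc.IH[OF Suc.prems(1) K' True])
        show "m \<notin> K'"
          unfolding K'_def using leg_swap_mem(1)[of i K] i by simp
        show "k \<in> J \<longleftrightarrow> k \<in> K'" if "k < m" for k
          unfolding K'_def using leg_swap_mem(3)[of k i K] Suc.prems(5)[of k] that i(3)
          by (simp add: i_def)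
      qed
      hence "(- cnj (d K)) * B (v J) (v K) = B (v J) (v K)"
        using form_act[OF Suc.prems(1,2) i(1,2)]
        unfolding simple[OF Suc.prems(1) J(2)] hecke_act_generic_leg_vec[OF Suc.prems(2) i(1,2)] d_def[symmetric]
          e_def[symmetric] K'_def[symmetric] J
          scale_left[OF VJ fvs.subspace_add[OF subspace sc[OF VK] sc[OF v_in[OF K']]]]
          add_right[OF sc[OF VK] sc[OF v_in[OF K']] VJ] scale_right[OF VK VJ]
          scale_right[OF v_in[OF K'] VJ] by simp
      moreover have "cmod (d K) \<noteq> 1"
        unfolding d_def using norm_diag_coeff_ne_1[OF i2, of K] mK i by simp
      hence "- cnj (d K) \<noteq> 1"
        by (metis complex_mod_cnj norm_minus_cancel norm_one)
      ultimately show ?thesis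
        by (rule final)
    next
      case False
      hence mK: "m \<notin> K"
        using Suc.prems(5)[of m] by simp
      have K: "d K = q\<^sup>2" "e K = 0"
        unfolding d_def e_def using coeff_equal[of i K] mK i by simp_all
      define J' where "J' = leg_swap i J"
      have J': "J' \<in> legs n l"
        unfolding J'_def using leg_swap_in_legs[OF Suc.prems(1) i2 i(2)] .
      have "B (v J') (v K) = 0"
      proof (rule Suc.IH[OF J' Suc.prems(2) _ mK])
        show "m \<in> J'"
          unfolding J'_def using leg_swap_mem(1)[of i J] i by simp
        show "k \<in> J' \<longleftrightarrow> k \<in> K" if "k < m" for k
          unfolding J'_def using leg_swap_mem(3)[of k i J] Suc.prems(5)[of k] that i(3)
          by (simp add: i_def)
      qed
      hence "(d J * cnj (q\<^sup>2)) * B (v J) (v K) = B (v J) (v K)"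
        using form_act[OF Suc.prems(1,2) i(1,2)]
        unfolding simple[OF Suc.prems(2) K(2)] hecke_act_generic_leg_vec[OF Suc.prems(1) i(1,2)] d_def[symmetric]
          e_def[symmetric] J'_def[symmetric] K
          scale_right[OF VK fvs.subspace_add[OF subspace sc[OF VJ] sc[OF v_in[OF J']]]]
          add_left[OF sc[OF VJ] sc[OF v_in[OF J']] VK] scale_left[OF VJ VK]
          scale_left[OF v_in[OF J'] VK] by (simp add: mult_ac)
      moreover have "cmod (d J) \<noteq> 1"
        unfolding d_def using norm_diag_coeff_ne_1[OF i2, of J] False i by simp
      hence "cmod (d J * cnj (q\<^sup>2)) \<noteq> 1"
        by (simp add: norm_mult norm_power norm_q)
      hence "d J * cnj (q\<^sup>2) \<noteq> 1"
        by (metis norm_one)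
      ultimately show ?thesis
        by (rule final)
    qed
  qed
qed

lemma orthogonal:
  assumes "J \<in> legs n l" "K \<in> legs n l" "J \<noteq> K"
  shows "B (v J) (v K) = 0"
proof -
  define m where "m = (LEAST k. (k \<in> J) \<noteq> (k \<in> K))"
  have "\<exists>k. (k \<in> J) \<noteq> (k \<in> K)"
    using assms(3) by blast
  hence m: "(m \<in> J) \<noteq> (m \<in> K)"
    unfolding m_def by (rule LeastI_ex)
  have below: "k \<in> J \<longleftrightarrow> k \<in> K" if "k < m" for k
    using not_less_Least[of k "\<lambda>k. (k \<in> J) \<noteq> (k \<in> K)"] that unfolding m_def by blast
  show ?thesis
  proof (cases "m \<in> J")
    case True
    thus ?thesis
      using orthogonal_first_difference[OF assms(1,2) True] m below by blast
  next
    case False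
    hence "B (v K) (v J) = 0"
      using orthogonal_first_difference[OF assms(2,1)] m below by blast
    thus ?thesis
      using sym[OF v_in[OF assms(2)] v_in[OF assms(1)]] by simp
  qed
qed

text \<open>
  Invariance of the norm of \<open>v\<^sub>J\<close> under \<open>T\<^sub>i\<close> is a linear relation between the norms of \<open>v\<^sub>J\<close> and
  \<open>v\<^bsub>s J\<^esub>\<close>, which the weights satisfy as well.
\<close>
lemma norm_ratio:
  assumes "J \<in> legs n l" "2 \<le> i" "i < n" "i - 1 \<in> J" "i \<notin> J"
  shows "B (v (leg_swap i J)) (v (leg_swap i J)) * leg_weight q J =
    B (v J) (v J) * leg_weight q (leg_swap i J)"
proof -
  define J' where "J' = leg_swap i J"
  define d where "d = diag_coeff (q\<^sup>2) i J"
  define e where "e = swap_coeff (q\<^sup>2) i J"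
  have J': "J' \<in> legs n l"
    unfolding J'_def using leg_swap_in_legs[OF assms(1-3)] .
  have ne: "J \<noteq> J'"
    unfolding J'_def using leg_swap_mem(2)[of i J] assms(4,5) by blast
  note V = v_in[OF assms(1)] and V' = v_in[OF J']
  note sc = fvs.subspace_scale[OF subspace]
  have i1: "1 \<le> i"
    using assms(2) by simp
  have w: "fscale d (v J) + fscale e (v J') \<in> specht (q\<^sup>2) (hook n l)"
    by (intro fvs.subspace_add subspace sc V V')
  have "B (v J) (v J) = d * (cnj d * B (v J) (v J)) + e * (cnj e * B (v J') (v J'))"
    using form_act[OF assms(1,1) i1 assms(3)]
    unfolding hecke_act_generic_leg_vec[OF assms(1) i1 assms(3)] d_def[symmetric] e_def[symmetric] J'_def[symmetric]
      add_left[OF sc[OF V] sc[OF V'] w] scale_left[OF V w] scale_left[OF V' w]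
      add_right[OF sc[OF V] sc[OF V'] V] add_right[OF sc[OF V] sc[OF V'] V']
      scale_right[OF V V] scale_right[OF V' V] scale_right[OF V V'] scale_right[OF V' V']
      orthogonal[OF assms(1) J' ne] orthogonal[OF J' assms(1) ne[symmetric]] by simp
  hence b: "(1 - (cmod d)\<^sup>2) * B (v J) (v J) = (cmod e)\<^sup>2 * B (v J') (v J')"
    unfolding of_real_diff of_real_1 complex_norm_square by (simp add: algebra_simps)
  have "(1 - (cmod d)\<^sup>2) * leg_weight q J = (cmod e)\<^sup>2 * leg_weight q J'"
    using leg_weight_unitary[OF assms(1) i1 assms(3)]
    unfolding d_def[symmetric] e_def[symmetric] J'_def[symmetric] by (simp add: algebra_simps)
  hence w: "complex_of_real (1 - (cmod d)\<^sup>2) * leg_weight q J = (cmod e)\<^sup>2 * leg_weight q J'"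
    by (metis of_real_mult)
  have "e \<noteq> 0"
  proof -
    have "qreal q (i - 1) \<noteq> 0"
      by (rule qreal_nz) (use assms(2) in simp)
    thus ?thesis
      unfolding e_def coeff_pred(2)[OF assms(2,4,5)] using q_nz qreal_nz[of i] i1 by simp
  qed
  have "complex_of_real ((cmod e)\<^sup>2) * (B (v J') (v J') * leg_weight q J) =
      complex_of_real (1 - (cmod d)\<^sup>2) * B (v J) (v J) * leg_weight q J"
    using b by simp
  also have "\<dots> = (complex_of_real (1 - (cmod d)\<^sup>2) * leg_weight q J) * B (v J) (v J)"
    by (simp only: mult_ac)
  also have "\<dots> = complex_of_real ((cmod e)\<^sup>2) * (B (v J) (v J) * leg_weight q J')"
    unfolding w by simp
  finally show ?thesis
    using \<open>e \<noteq> 0\<close> unfolding J'_def by simp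
qed

lemma norm_proportional:
  "\<exists>C::real. C \<noteq> 0 \<and> (\<forall>J\<in>legs n l. B (v J) (v J) = complex_of_real (C * leg_weight q J))"
proof -
  define C where "C = Re (B (v {1..l}) (v {1..l})) / leg_weight q {1..l}"
  have init: "{1..l} \<in> legs n l"
    using l_less by (rule initial_in_legs)
  have scaled: "B (v J) (v J) = complex_of_real (C * leg_weight q J)" if "J \<in> legs n l" for J
    using that
  proof (induction rule: legs_induct)
    case initial
    have "complex_of_real (Re (B (v {1..l}) (v {1..l}))) = B (v {1..l}) (v {1..l})"
      using norm_real[OF v_in[OF init]] by (simp add: complex_eq_iff)
    thus ?case
      using leg_weight_nz[OF init] by (simp add: C_def)
  next
    case (step J i)
    have "B (v (leg_swap i J)) (v (leg_swap i J)) * leg_weight q J =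
        C * leg_weight q (leg_swap i J) * leg_weight q J"
      using norm_ratio[OF step.hyps(1-5)] step.IH by (simp add: mult_ac)
    thus ?case
      using leg_weight_nz[OF step.hyps(1)] by simp
  qed
  \<comment> \<open>Otherwise \<open>v\<^bsub>{1..l}\<^esub>\<close> would be orthogonal to the whole module, as it is to the other \<open>v\<^sub>J\<close>.\<close>
  have "C \<noteq> 0"
  proof
    assume "C = 0"
    hence "B (v J) (v {1..l}) = 0" if "J \<in> legs n l" for J
      using orthogonal[OF that init] scaled[OF init] by (cases "J = {1..l}") auto
    moreover have "u \<in> specht (q\<^sup>2) (hook n l) \<and> B u (v {1..l}) = 0"
      if "u \<in> fvs.span (v ` legs n l)" for u
      using that
    proof (induction rule: fvs.span_induct_alt)
      case base
      show ?case
        using zero_left[OF v_in[OF init]] fvs.subspace_0[OF subspace] by blast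
    next
      case (step c x y)
      then obtain J where J: "J \<in> legs n l" "x = v J"
        by blast
      have x: "fscale c x \<in> specht (q\<^sup>2) (hook n l)" "y \<in> specht (q\<^sup>2) (hook n l)"
        using step v_in[OF J(1)] fvs.subspace_scale[OF subspace] by (auto simp: J(2))
      have "B (fscale c x + y) (v {1..l}) = 0"
        unfolding add_left[OF x v_in[OF init]]
        unfolding J(2) scale_left[OF v_in[OF J(1)] v_in[OF init]]
        using step calculation[OF J(1)] by simp
      thus ?case
        using fvs.subspace_add[OF subspace x] by blast
    qed
    ultimately have zero: "B u (v {1..l}) = 0" if "u \<in> specht (q\<^sup>2) (hook n l)" for u
      using that specht_span[OF l_less] by blast
    have "B (v {1..l}) u = 0" if "u \<in> specht (q\<^sup>2) (hook n l)" for u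
      using sym[OF that v_in[OF init]] zero[OF that] by simp
    hence "v {1..l} = 0"
      using invariant v_in[OF init] by (simp add: invariant_form_def nondegenerate_form_def)
    thus False
      using independent_leg_vecs fvs.dependent_zero init by (metis image_eqI)
  qed
  thus ?thesis
    using scaled by blast
qed

lemma refined_signature_hook:
  "\<exists>c::real. c \<noteq> 0 \<and>
    refined_signature (specht (q\<^sup>2) (hook n l)) (\<lambda>u v. complex_of_real c * B u v) =
    (\<Sum>J\<in>legs n l. \<Prod>j\<in>J. qsign q (int j) * qsign q (int j + 1))"
proof -
  obtain C where C: "C \<noteq> 0" "\<And>J. J \<in> legs n l \<Longrightarrow> B (v J) (v J) = complex_of_real (C * leg_weight q J)"
    using norm_proportional by blast
  define B' where "B' = (\<lambda>u v. complex_of_real (1 / C) * B u v)"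
  interpret B': hermitian_space "specht (q\<^sup>2) (hook n l)" B'
    unfolding B'_def by (rule scale_form)
  have norm: "B' (v J) (v J) = leg_weight q J" if "J \<in> legs n l" for J
    using C that by (simp add: B'_def)
  have basis: "orthogonal_basis (specht (q\<^sup>2) (hook n l)) B' (v ` legs n l)"
    unfolding orthogonal_basis_def
  proof (intro conjI)
    show "pairwise (\<lambda>x y. B' x y = 0) (v ` legs n l)"
      using orthogonal by (fastforce simp: pairwise_def B'_def)
  qed (use specht_span[OF l_less] independent_leg_vecs in auto)
  have "refined_signature (specht (q\<^sup>2) (hook n l)) B' = (\<Sum>x\<in>v ` legs n l. sign_elt (Re (B' x x)))"
    unfolding B'.refined_signature_eq[OF basis] using leg_weight_nz norm
    by (intro sum_sign_elt) auto
  also have "\<dots> = (\<Sum>J\<in>legs n l. sign_elt (leg_weight q J))"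
    unfolding sum.reindex[OF inj_leg_vecs] using norm by simp
  also have "\<dots> = (\<Sum>J\<in>legs n l. \<Prod>j\<in>J. qsign q (int j) * qsign q (int j + 1))"
  proof (intro sum.cong refl)
    fix J assume J: "J \<in> legs n l"
    have nz: "qreal q j \<noteq> 0" "qreal q (Suc j) \<noteq> 0" if "j \<in> J" for j
      using legsD(3)[OF J] that by (auto intro!: qreal_nz)
    have sgn: "sign_elt (qreal q j) = qsign q (int j)" for j
      by (simp add: sign_elt_def qsign_def qreal_def)
    have "sign_elt (leg_weight q J) = (\<Prod>j\<in>J. sign_elt (qreal q j * qreal q (Suc j)))"
      unfolding leg_weight_def using nz by (intro sign_elt_prod) simp
    also have "\<dots> = (\<Prod>j\<in>J. qsign q (int j) * qsign q (int j + 1))"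
      using nz sgn[of "Suc _"] by (intro prod.cong refl) (simp add: sign_elt_mult sgn add.commute)
    finally show "sign_elt (leg_weight q J) = (\<Prod>j\<in>J. qsign q (int j) * qsign q (int j + 1))" .
  qed
  finally show ?thesis
    using C(1) unfolding B'_def by (intro exI[of _ "1 / C"]) simp
qed

end

section \<open>The refined signature of a hook\<close>

theorem proposition4p2:
  fixes q :: complex and n l :: nat
  assumes "norm q = 1"
    and "\<And>k::nat. k > 0 \<Longrightarrow> q ^ k \<noteq> 1"
    and "n \<ge> 1" and "l \<le> n - 1"
  shows "(\<exists>B. invariant_form n (specht (q\<^sup>2) ((n - l) # replicate l 1)) (hecke_act (q\<^sup>2)) B) \<and>
    (\<forall>B. invariant_form n (specht (q\<^sup>2) ((n - l) # replicate l 1)) (hecke_act (q\<^sup>2)) B \<longrightarrow>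
       (\<exists>c::real. c \<noteq> 0 \<and>
          refined_signature (specht (q\<^sup>2) ((n - l) # replicate l 1))
              (\<lambda>u v. complex_of_real c * B u v) =
            (\<Sum>J\<in>{J. J \<subseteq> {2..n} \<and> card J = l}.
               \<Prod>j\<in>J. qsign q (int j - 1) * qsign q (int j))))"
proof -
  interpret generic_unit q
    using assms(1,2) by unfold_locales
  have l: "l < n"
    using assms(3,4) by simp
  have reindex: "(\<Sum>J\<in>legs n l. \<Prod>j\<in>J. qsign q (int j) * qsign q (int j + 1)) =
    (\<Sum>J\<in>{J. J \<subseteq> {2..n} \<and> card J = l}. \<Prod>j\<in>J. qsign q (int j - 1) * qsign q (int j))"
  proof (rule sum.reindex_bij_witness[of _ "image (\<lambda>j. j - 1)" "image Suc"])
    fix J assume "J \<in> {J. J \<subseteq> {2..n} \<and> card J = l}"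
    hence J: "J \<subseteq> {2..n}" "card J = l"
      by auto
    have "Suc (j - 1) = j" if "j \<in> J" for j
      using J(1) that by force
    thus "Suc ` (\<lambda>j. j - 1) ` J = J"
      unfolding image_image by simp
    have "inj_on (\<lambda>j. j - 1) J"
      using J(1) by (intro inj_on_diff_nat) auto
    thus "(\<lambda>j. j - 1) ` J \<in> legs n l"
      using J by (force simp: legs_def card_image)
  next
    fix J assume J: "J \<in> legs n l"
    show "(\<lambda>j. j - 1) ` Suc ` J = J"
      by (simp add: image_image)
    show "Suc ` J \<in> {J. J \<subseteq> {2..n} \<and> card J = l}"
      using legsD[OF J] by (auto simp: card_image)
    show "(\<Prod>j\<in>Suc ` J. qsign q (int j - 1) * qsign q (int j)) =
        (\<Prod>j\<in>J. qsign q (int j) * qsign q (int j + 1))"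
      by (simp add: prod.reindex add.commute)
  qed
  have "\<exists>B. invariant_form n (specht (q\<^sup>2) (hook n l)) (hecke_act (q\<^sup>2)) B"
    using invariant_seminormal_form[OF l] by blast
  moreover have "\<exists>c::real. c \<noteq> 0 \<and>
      refined_signature (specht (q\<^sup>2) (hook n l)) (\<lambda>u v. complex_of_real c * B u v) =
      (\<Sum>J\<in>legs n l. \<Prod>j\<in>J. qsign q (int j) * qsign q (int j + 1))"
    if "invariant_form n (specht (q\<^sup>2) (hook n l)) (hecke_act (q\<^sup>2)) B" for B
  proof -
    interpret invariant_hook_form q n l B
      using l that by unfold_locales
    show ?thesis
      by (rule refined_signature_hook)
  qed
  ultimately show ?thesis
    unfolding reindex hook_def by blast
qed

end
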